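(* Consider the $N$-player differential game, the demonstrations, the data matrices, the estimates $\hat{\bar{\boldsymbol\theta}}_i,\hat{\boldsymbol\theta}_i^{(r)},\hat{\boldsymbol\mu}_i$ and the HJB data described in the context. Assume that for all $i\in\mathcal N$: (a) $Q_i^*(x)={\beta_i^*}^\top\psi_i(x)$ with $\psi_i:\mathbb R^n\to\mathbb R^{m_i}$ continuously differentiable on $\mathcal X$ and $\beta_i^*\in\mathbb R^{m_i}$; (b) $R_{ij}^*$ is diagonal for all $j\in\mathcal N$; (c) the value functions of the feedback Nash equilibrium (FNE) are $V_i^*(x)={\theta_i^*}^\top\phi_i(x)$ with $\phi_i:\mathbb R^n\to\mathbb R^{h_i}$ twice continuously differentiable on $\mathcal X$ and $\theta_i^*\in\mathbb R^{h_i}$; (d) $f,G_i,\psi_i,\phi_i$ are known; (e) $D$, the initial states $x^{*(d)}(t_0)$, $K$ and $\Delta t$ are chosen such that $\operatorname{rank}(M_{u_i})\le p_i\bar h_i$ is the highest possible, i.e. further data points do not increase $\operatorname{rank}(M_{u_i})$; (f) the points $x_1,\dots,x_{\bar K}\in\mathcal X$ are chosen such that $\operatorname{rank}(M^{(r)}_{\mathrm{HJB}_i})\le p+m_i+h_i-\bar h_i$ (if $\operatorname{rank}(M_{u_i})=p_i\bar h_i$), respectively $\operatorname{rank}(M_{\mathrm{HJB}_i})\le p+m_i+h_i$ (if $\operatorname{rank}(M_{u_i})<p_i\bar h_i$), is the highest possible, i.e. further data points do not increase it. For each player $i\in\mathcal N$ define a set of parameters as follows. 1) If $\operatorname{rank}(M_{u_i})=p_i\bar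 h_i$: all $$\begin{bmatrix}\hat\alpha_i\\ \hat\beta_i\end{bmatrix}=L_i^{(r)}\big(\bar M^{(r)}_{\mathrm{HJB}_i}\big)^{+}{M^{(r)}_{\mathrm{HJB}_i}}^{\top}z^{(r)}_{\mathrm{HJB}_i}+L_i^{(r)}\Big(I-\big(\bar M^{(r)}_{\mathrm{HJB}_i}\big)^{+}\bar M^{(r)}_{\mathrm{HJB}_i}\Big)\bar w_i^{(r)},$$ where $L_i^{(r)}=[\,I_{p+m_i}\;\;0_{(p+m_i)\times(h_i-\bar h_i)}]$, $\bar M^{(r)}_{\mathrm{HJB}_i}={M^{(r)}_{\mathrm{HJB}_i}}^\top M^{(r)}_{\mathrm{HJB}_i}$, and $\bar w_i^{(r)}\in\mathbb R^{p+m_i+h_i-\bar h_i}$ is arbitrary but such that $\hat\alpha_i,\hat\beta_i$ guarantee that the decoupled HJB equation of player $i$ is necessary and sufficient for a unique optimal control solution. This set consists of only one element, $\hat\alpha_i=c_i\alpha_i^*$ and $\hat\beta_i=c_i\beta_i^*$ (where $c_i>0$ is the scalar with $\hat\theta_i^{(r)}=c_i\theta_i^{(r)*}$), if and only if $L_i^{(r)}\big(I-(\bar M^{(r)}_{\mathrm{HJB}_i})^{+}\bar M^{(r)}_{\mathrm{HJB}_i}\big)=0$. 2) If $\operatorname{rank}(M_{u_i})<p_i\bar h_i$: all $$\begin{bmatrix}\hat\alpha_i\\ \hat\beta_i\end{bmatrix}=L_i\bar M_{\mathrm{HJB}_i}^{+}M_{\mathrm{HJB}_i}^{\top}z_{\mathrm{HJB}_i}+L_i\Big(I-\bar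 M_{\mathrm{HJB}_i}^{+}\bar M_{\mathrm{HJB}_i}\Big)\bar w_i,$$ where $L_i=[\,I_{p+m_i}\;\;0_{(p+m_i)\times h_i}]$, $\bar M_{\mathrm{HJB}_i}=M_{\mathrm{HJB}_i}^\top M_{\mathrm{HJB}_i}$, and $\bar w_i\in\mathbb R^{p+m_i+h_i}$ is arbitrary but such that $\hat\alpha_i,\hat\beta_i$ guarantee that the decoupled HJB equation of player $i$ is necessary and sufficient for a unique optimal control solution. This set consists of only one element, $\hat\alpha_i=\alpha_i^*$ and $\hat\beta_i=\beta_i^*$, if and only if $L_i\big(I-\bar M_{\mathrm{HJB}_i}^{+}\bar M_{\mathrm{HJB}_i}\big)=0$. Then all parameters $\hat\alpha_i,\hat\beta_i$, $i\in\mathcal N$, from these sets solve the offline inverse differential game problem: the FNE $\{\hat\mu_i^*\in\Gamma_i(\mathcal X):i\in\mathcal N\}$ resulting from $\hat\beta_i$ and the diagonal matrices $\hat R_{ij}$ with diagonal entries given by $\hat\alpha_i$ ($i,j\in\mathcal N$) generates, from the initial states of the demonstrations, trajectories with $\hat x^{*(d)}(t_0\to\infty)=x^{*(d)}(t_0\to\infty)$ and $\hat u^{*(d)}(t_0\to\infty)=u^{*(d)}(t_0\to\infty)$ for all $d\in\{1,\dots,D\}$.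
   Context: **Game.** Dynamics $\dot x=f(x)+\sum_{i=1}^N G_i(x)u_i$, $x\in\mathbb R^n$, $u_i\in\mathbb R^{p_i}$, $i\in\mathcal N=\{1,\dots,N\}$, $N\ge1$, $p=\sum_i p_i$; $f:\mathbb R^n\to\mathbb R^n$ ($f(0)=0$) and $G_i:\mathbb R^n\to\mathbb R^{n\times p_i}$ are continuously differentiable on a neighborhood $\mathcal X\subset\mathbb R^n$ of the origin. Player $i$ uses an admissible feedback strategy $u_i=\mu_i(x)$, $\mu_i\in\Gamma_i(\mathcal X)$: $\mu_i:\mathbb R^n\to\mathbb R^{p_i}$, $\mu_i(0)=0$, is continuously differentiable on $\mathcal X$, and $\mu=[\mu_1^\top\cdots\mu_N^\top]^\top$ stabilizes the system on $\mathcal X$ and leads, for all $t\ge t_0$ and all $x(t_0)\in\mathcal X$, to a finite value function $V_i^\mu(x)=\int_t^\infty Q_i^*(x)+\sum_{j=1}^N\mu_j^\top R_{ij}^*\mu_j\,d\tau$ that is twice continuously differentiable on $\mathcal X$. Here $R_{ij}^*\succeq0$ ($i\ne j$), $R_{ii}^*\succ0$, and $Q_i^*:\mathbb R^n\to\mathbb R$ is positive definite and continuously differentiable. An FNE is a tuple $\{\mu_i^*\in\Gamma_i(\mathcal X)\}$ with $V_i^*=V_i^{\mu^*}\le V_i^{\mu^*_{-i}}$ for all $i$, where $\mu^*_{-i}$ is $\mu^*$ with $\mu_i^*$ replaced by any $\mu_i$. Standing assumptions: there is a unique FNE, the players act according to it, and the coupled HJB equations $$0=\tfrac{\partial V_i^*}{\partial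 x}\Big(f+\sum_jG_j\mu_j^*\Big)+\sum_j{\mu_j^*}^\top R_{ij}^*\mu_j^*+Q_i^*(x),\quad \mu_i^*(x)=-\tfrac12{R_{ii}^*}^{-1}G_i(x)^\top\Big(\tfrac{\partial V_i^*}{\partial x}\Big)^\top,\quad i\in\mathcal N,$$ are necessary and sufficient for the FNE. **Demonstrations.** $D\ge1$ trajectories $x^{*(d)}(t_0\to\infty)$, $u^{*(d)}(t_0\to\infty)$ of the FNE are given (ground truth). **Splitting the value basis.** Reorder $\phi_i^\top=[\phi_i^{(r)\top}\ \phi_i^{(-r)\top}]$, $\theta_i^{*\top}=[\theta_i^{(r)*\top}\ \theta_i^{(-r)*\top}]$ with $\theta_i^{(r)*}\in\mathbb R^{\bar h_i}$, so that $G_i(x)^\top(\partial\phi^{(-r)}_{i,j}/\partial x)^\top=0$ for all $x\in\mathcal X$ and all $j$, while for each $j\in\{1,\dots,\bar h_i\}$, $G_i^\top(\partial\phi^{(r)}_{i,j}/\partial x)^\top$ is not identically zero on $\mathcal X$. Let $\Phi_i^{(r)}(x)=G_i(x)^\top(\partial\phi_i^{(r)}/\partial x)^\top\in\mathbb R^{p_i\times\bar h_i}$ with rows $\bar\phi^{(r)}_{i,1}(x)^\top,\dots,\bar\phi^{(r)}_{i,p_i}(x)^\top$, and $\bar\Phi_i(x)\in\mathbb R^{p_i\times p_i\bar h_i}$ the block-diagonal matrix whose $k$-th row is $[0_{1\times(k-1)\bar h_i}\ \ \bar\phi^{(r)}_{i,k}(x)^\top\ \ 0_{1\times(p_i-k)\bar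 h_i}]$. **FNE identification.** $K\ge1$ samples with step $\Delta t$ are taken from each demonstration. $M_{u_i}$ stacks the blocks $-\tfrac12\bar\Phi_i(x^{*(d)}(t_0+k\Delta t))$ and $z_{u_i}$ stacks $u_i^{*(d)}(t_0+k\Delta t)$, $d=1,\dots,D$, $k=0,\dots,K-1$. (Further data points: blocks from further sample times/demonstrations with states in $\mathcal X$.) The estimates are $\hat{\bar\theta}_i=(M_{u_i}^\top M_{u_i})^+M_{u_i}^\top z_{u_i}$, $\hat\mu_i(x)=-\tfrac12\bar\Phi_i(x)\hat{\bar\theta}_i$ and, if $\operatorname{rank}(M_{u_i})=p_i\bar h_i$, $\hat\theta_i^{(r)}=\frac1{p_i}\sum_{j=1}^{p_i}P_j\hat{\bar\theta}_i/\|P_j\hat{\bar\theta}_i\|_2$ with $P_j=[0_{\bar h_i\times(j-1)\bar h_i}\ I_{\bar h_i}\ 0_{\bar h_i\times(p_i-j)\bar h_i}]$. $(\cdot)^+$ is the Moore–Penrose inverse. **HJB data.** $\alpha_i^*\in\mathbb R^p$ collects the diagonal entries of $R_{i1}^*,\dots,R_{iN}^*$ in order: $\alpha_i^{*\top}=[r^*_{i1,1}\cdots r^*_{i1,p_1}\ r^*_{i2,1}\cdots r^*_{iN,p_N}]$; likewise $\hat\alpha_i$ for $\hat R_{ij}$. With $\hat\mu=[\hat\mu_1^\top\cdots\hat\mu_N^\top]^\top$, $\hat f_g=f+\sum_jG_j\hat\mu_j$ and Hadamard product $\odot$, put $m^{(r)}_{\mathrm{HJB}_i}(x)^\top=[\hat\mu^\top\odot\hat\mu^\top\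 \ \psi_i^\top\ \ (\tfrac{\partial\phi_i^{(-r)}}{\partial x}\hat f_g)^\top]$, $z^{(r)}_{\mathrm{HJB}_i}(x)=-\hat\theta_i^{(r)\top}\tfrac{\partial\phi_i^{(r)}}{\partial x}\hat f_g$, and $m_{\mathrm{HJB}_i}(x)^\top=[\hat\mu^\top\odot\hat\mu^\top\ \ \psi_i^\top\ \ (\tfrac{\partial\phi_i}{\partial x}\hat f_g)^\top]$, $z_{\mathrm{HJB}_i}(x)=0$. For $\bar K\ge1$ points $x_{\bar k}\in\mathcal X$, $M^{(r)}_{\mathrm{HJB}_i}$, $z^{(r)}_{\mathrm{HJB}_i}$, $M_{\mathrm{HJB}_i}$, $z_{\mathrm{HJB}_i}$ stack these rows evaluated at $x_1,\dots,x_{\bar K}$. **Decoupled HJB equation of player $i$.** The HJB equation of player $i$ with $\hat\mu_j$ inserted for $\mu_j^*$, all $j\in\mathcal N$, i.e. the HJB equation of the single-player optimal control problem of player $i$ with the cost parameters $\hat\alpha_i,\hat\beta_i$ and the other players' strategies fixed.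
   Formalization: In case 1 the "only one element iff" criterion is proved for the set with unrestricted free vector; for the restricted set only "if" is claimed, as "only if" fails (x'=u, Q=x², R=1, psi=phi=x²: only (1,1) is left although the matrix is nonzero). *)

theory Defs
  imports
    "HOL-Analysis.Analysis"
    "Jordan_Normal_Form.DL_Rank"
    "Jordan_Normal_Form.Gauss_Jordan_Elimination"
begin

unbundle no vec_syntax
unbundle no inner_syntax

text \<open>
  The state space is a Euclidean space. Objects whose dimension depends on the player
  (controls, weighting matrices, parameters, data matrices) are the vectors and matrices of
  \<^theory>\<open>Jordan_Normal_Form.Matrix\<close>. Players and all vector components are counted from \<open>0\<close>.
\<close>

section \<open>Linear algebra\<close>

definition mat_rank :: "real mat \<Rightarrow> nat" where
  "mat_rank A = vec_space.rank (dim_row A) A"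

definition mp_inverse :: "real mat \<Rightarrow> real mat" where
  "mp_inverse A = (THE X. X \<in> carrier_mat (dim_col A) (dim_row A) \<and>
     A * X * A = A \<and> X * A * X = X \<and>
     transpose_mat (A * X) = A * X \<and> transpose_mat (X * A) = X * A)"

definition vec_norm2 :: "real Matrix.vec \<Rightarrow> real" where
  "vec_norm2 v = sqrt (v \<bullet> v)"

definition pos_semidef_mat :: "nat \<Rightarrow> real mat \<Rightarrow> bool" where
  "pos_semidef_mat n A \<longleftrightarrow> A \<in> carrier_mat n n \<and> transpose_mat A = A \<and>
     (\<forall>v\<in>carrier_vec n. 0 \<le> v \<bullet> (A *\<^sub>v v))"

definition pos_def_mat :: "nat \<Rightarrow> real mat \<Rightarrow> bool" where
  "pos_def_mat n A \<longleftrightarrow> A \<in> carrier_mat n n \<and> transpose_mat A = A \<and>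
     (\<forall>v\<in>carrier_vec n. v \<noteq> 0\<^sub>v n \<longrightarrow> 0 < v \<bullet> (A *\<^sub>v v))"

text \<open>\<open>[I\<^sub>a 0]\<close> with \<open>a\<close> rows and \<open>b\<close> columns.\<close>

definition left_id_mat :: "nat \<Rightarrow> nat \<Rightarrow> real mat" where
  "left_id_mat a b = Matrix.mat a b (\<lambda>(r, c). if r = c then 1 else 0)"

text \<open>
  For \<open>L = [I 0]\<close>: the first components of all least-squares solutions of \<open>M y = z\<close>, and the
  matrix that multiplies the free vector \<open>w\<close> in this parametrisation.
\<close>

definition ls_point :: "real mat \<Rightarrow> real mat \<Rightarrow> real Matrix.vec \<Rightarrow> real Matrix.vec \<Rightarrow> real Matrix.vec" where
  "ls_point L M z w =
     (let Mb = transpose_mat M * M in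
        L *\<^sub>v (mp_inverse Mb *\<^sub>v (transpose_mat M *\<^sub>v z))
      + L *\<^sub>v ((1\<^sub>m (dim_col M) - mp_inverse Mb * Mb) *\<^sub>v w))"

definition ls_freedom :: "real mat \<Rightarrow> real mat \<Rightarrow> real mat" where
  "ls_freedom L M =
     (let Mb = transpose_mat M * M in L * (1\<^sub>m (dim_col M) - mp_inverse Mb * Mb))"


section \<open>Smoothness\<close>

text \<open>Only used on open sets.\<close>

definition C1_on :: "('a::real_normed_vector \<Rightarrow> 'b::real_normed_vector) \<Rightarrow> 'a set \<Rightarrow> bool" where
  "C1_on F X \<longleftrightarrow>
     (\<exists>F'. (\<forall>x\<in>X. (F has_derivative blinfun_apply (F' x)) (at x)) \<and> continuous_on X F')"

definition C2_on :: "('a::real_normed_vector \<Rightarrow> 'b::real_normed_vector) \<Rightarrow> 'a set \<Rightarrow> bool" where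
  "C2_on F X \<longleftrightarrow>
     (\<exists>F'. (\<forall>x\<in>X. (F has_derivative blinfun_apply (F' x)) (at x)) \<and> C1_on F' X)"

text \<open>\<open>(\<partial>F/\<partial>x) v\<close>, for \<open>F\<close> with values in \<open>d\<close>-dimensional vectors.\<close>

definition jac_apply ::
  "nat \<Rightarrow> ('s::real_normed_vector \<Rightarrow> real Matrix.vec) \<Rightarrow> 's \<Rightarrow> 's \<Rightarrow> real Matrix.vec" where
  "jac_apply d F x v = Matrix.vec d (\<lambda>j. frechet_derivative (\<lambda>y. F y $ j) (at x) v)"


section \<open>The differential game\<close>

text \<open>
  \<open>input_col S i x k\<close> is the \<open>k\<close>-th column of \<open>G\<^sub>i(x)\<close>, so that entry \<open>k\<close> of
  \<open>G\<^sub>i(x)\<^sup>T (\<partial>V/\<partial>x)\<^sup>T\<close> is the derivative of \<open>V\<close> at \<open>x\<close> in this direction.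
\<close>

record 's dsystem =
  players :: nat
  udim :: "nat \<Rightarrow> nat"
  states :: "'s set"
  drift :: "'s \<Rightarrow> 's"
  input_col :: "nat \<Rightarrow> 's \<Rightarrow> nat \<Rightarrow> 's"
  time0 :: real

type_synonym 's profile = "nat \<Rightarrow> 's \<Rightarrow> real Matrix.vec"

definition total_udim :: "'s dsystem \<Rightarrow> nat" where
  "total_udim S = (\<Sum>j<players S. udim S j)"

definition closed_loop :: "'s::real_normed_vector dsystem \<Rightarrow> 's profile \<Rightarrow> 's \<Rightarrow> 's" where
  "closed_loop S \<mu> x =
     drift S x + (\<Sum>j<players S. \<Sum>k<udim S j. (\<mu> j x $ k) *\<^sub>R input_col S j x k)"

definition input_grad :: "'s::real_normed_vector dsystem \<Rightarrow> nat \<Rightarrow> ('s \<Rightarrow> real) \<Rightarrow> 's \<Rightarrow> real Matrix.vec" where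
  "input_grad S i V x = Matrix.vec (udim S i) (\<lambda>k. frechet_derivative V (at x) (input_col S i x k))"

text \<open>
  The data \<open>f\<close>, \<open>G\<^sub>i\<close> are regular only on \<open>\<X>\<close>; trajectories of the system on \<open>\<X>\<close> are
  therefore required to stay in \<open>\<X>\<close>.
\<close>

definition solution ::
  "'s::real_normed_vector dsystem \<Rightarrow> 's profile \<Rightarrow> 's \<Rightarrow> (real \<Rightarrow> 's) \<Rightarrow> bool" where
  "solution S \<mu> x0 x \<longleftrightarrow> x (time0 S) = x0 \<and>
     (\<forall>t\<ge>time0 S. x t \<in> states S \<and>
        (x has_vector_derivative closed_loop S \<mu> (x t)) (at t within {time0 S..}))"

definition stabilizing :: "'s::real_normed_vector dsystem \<Rightarrow> 's profile \<Rightarrow> bool" where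
  "stabilizing S \<mu> \<longleftrightarrow>
     (\<forall>x0\<in>states S. \<exists>x. solution S \<mu> x0 x) \<and>
     (\<forall>x0\<in>states S. \<forall>x. solution S \<mu> x0 x \<longrightarrow> (x \<longlongrightarrow> 0) at_top) \<and>
     (\<forall>\<epsilon>>0. \<exists>\<delta>>0. \<forall>x0\<in>states S. \<forall>x. norm x0 < \<delta> \<longrightarrow> solution S \<mu> x0 x \<longrightarrow>
        (\<forall>t\<ge>time0 S. norm (x t) < \<epsilon>))"

text \<open>
  A player's cost is given by \<open>q\<close> and the matrices \<open>r j\<close>, \<open>j < players S\<close>. The closed loop is
  autonomous, so the value at \<open>x\<close> does not depend on the starting time; \<open>time0 S\<close> is used.
\<close>

definition running_cost ::
  "'s dsystem \<Rightarrow> ('s \<Rightarrow> real) \<Rightarrow> (nat \<Rightarrow> real mat) \<Rightarrow> 's profile \<Rightarrow> 's \<Rightarrow> real" where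
  "running_cost S q r \<mu> x = q x + (\<Sum>j<players S. \<mu> j x \<bullet> (r j *\<^sub>v \<mu> j x))"

definition trajectory :: "'s::real_normed_vector dsystem \<Rightarrow> 's profile \<Rightarrow> 's \<Rightarrow> real \<Rightarrow> 's" where
  "trajectory S \<mu> x0 = (SOME x. solution S \<mu> x0 x)"

definition value_fun ::
  "'s::real_normed_vector dsystem \<Rightarrow> ('s \<Rightarrow> real) \<Rightarrow> (nat \<Rightarrow> real mat) \<Rightarrow> 's profile \<Rightarrow> 's \<Rightarrow> real" where
  "value_fun S q r \<mu> x0 =
     integral {time0 S..} (\<lambda>t. running_cost S q r \<mu> (trajectory S \<mu> x0 t))"

text \<open>
  \<open>\<mu>\<^sub>i \<in> \<Gamma>\<^sub>i(\<X>)\<close>, the strategies of the other players being those in \<open>\<mu>\<close>.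
\<close>

definition admissible ::
  "'s::real_normed_vector dsystem \<Rightarrow> ('s \<Rightarrow> real) \<Rightarrow> (nat \<Rightarrow> real mat) \<Rightarrow> nat \<Rightarrow> 's profile \<Rightarrow> bool" where
  "admissible S q r i \<mu> \<longleftrightarrow>
     (\<forall>x. \<mu> i x \<in> carrier_vec (udim S i)) \<and>
     \<mu> i 0 = 0\<^sub>v (udim S i) \<and>
     (\<forall>k<udim S i. C1_on (\<lambda>x. \<mu> i x $ k) (states S)) \<and>
     stabilizing S \<mu> \<and>
     (\<forall>x0\<in>states S.
        (\<lambda>t. running_cost S q r \<mu> (trajectory S \<mu> x0 t)) integrable_on {time0 S..}) \<and>
     C2_on (value_fun S q r \<mu>) (states S)"

definition is_FNE ::
  "'s::real_normed_vector dsystem \<Rightarrow> (nat \<Rightarrow> 's \<Rightarrow> real) \<Rightarrow> (nat \<Rightarrow> nat \<Rightarrow> real mat) \<Rightarrow> 's profile \<Rightarrow> bool" where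
  "is_FNE S Q R \<mu> \<longleftrightarrow>
     (\<forall>i<players S. admissible S (Q i) (R i) i \<mu>) \<and>
     (\<forall>i<players S. \<forall>\<nu>. admissible S (Q i) (R i) i (\<mu>(i := \<nu>)) \<longrightarrow>
        (\<forall>x\<in>states S. value_fun S (Q i) (R i) \<mu> x \<le> value_fun S (Q i) (R i) (\<mu>(i := \<nu>)) x))"

definition is_unique_FNE ::
  "'s::real_normed_vector dsystem \<Rightarrow> (nat \<Rightarrow> 's \<Rightarrow> real) \<Rightarrow> (nat \<Rightarrow> nat \<Rightarrow> real mat) \<Rightarrow> 's profile \<Rightarrow> bool" where
  "is_unique_FNE S Q R \<mu> \<longleftrightarrow> is_FNE S Q R \<mu> \<and>
     (\<forall>\<nu>. is_FNE S Q R \<nu> \<longrightarrow> (\<forall>i<players S. \<forall>x\<in>states S. \<nu> i x = \<mu> i x))"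

definition HJB_eq ::
  "'s::real_normed_vector dsystem \<Rightarrow> ('s \<Rightarrow> real) \<Rightarrow> (nat \<Rightarrow> real mat) \<Rightarrow> 's profile \<Rightarrow> ('s \<Rightarrow> real) \<Rightarrow> bool" where
  "HJB_eq S q r \<mu> V \<longleftrightarrow>
     (\<forall>x\<in>states S. 0 = frechet_derivative V (at x) (closed_loop S \<mu> x)
        + (\<Sum>j<players S. \<mu> j x \<bullet> (r j *\<^sub>v \<mu> j x)) + q x)"

definition coupled_HJB ::
  "'s::real_normed_vector dsystem \<Rightarrow> (nat \<Rightarrow> 's \<Rightarrow> real) \<Rightarrow> (nat \<Rightarrow> nat \<Rightarrow> real mat) \<Rightarrow>
     's profile \<Rightarrow> (nat \<Rightarrow> 's \<Rightarrow> real) \<Rightarrow> bool" where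
  "coupled_HJB S Q R \<mu> V \<longleftrightarrow> (\<forall>i<players S.
     HJB_eq S (Q i) (R i) \<mu> (V i) \<and>
     (\<forall>x\<in>states S.
        \<mu> i x = (-1/2) \<cdot>\<^sub>v (the (mat_inverse (R i i)) *\<^sub>v input_grad S i (V i) x)))"

text \<open>
  Without admissibility of the strategies sufficiency would be inconsistent: already the scalar
  Riccati equation has a second, destabilising solution.
\<close>

definition coupled_HJB_nec_suff ::
  "'s::real_normed_vector dsystem \<Rightarrow> (nat \<Rightarrow> 's \<Rightarrow> real) \<Rightarrow> (nat \<Rightarrow> nat \<Rightarrow> real mat) \<Rightarrow> bool" where
  "coupled_HJB_nec_suff S Q R \<longleftrightarrow>
     (\<forall>\<mu> V. (\<forall>i<players S. admissible S (Q i) (R i) i \<mu>) \<longrightarrow>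
        (\<forall>i<players S. C2_on (V i) (states S) \<and> V i 0 = 0) \<longrightarrow>
        (coupled_HJB S Q R \<mu> V \<longleftrightarrow>
           is_FNE S Q R \<mu> \<and>
           (\<forall>i<players S. \<forall>x\<in>states S. V i x = value_fun S (Q i) (R i) \<mu> x)))"

definition differential_game ::
  "'s::real_normed_vector dsystem \<Rightarrow> (nat \<Rightarrow> 's \<Rightarrow> real) \<Rightarrow> (nat \<Rightarrow> nat \<Rightarrow> real mat) \<Rightarrow> bool" where
  "differential_game S Q R \<longleftrightarrow>
     1 \<le> players S \<and> (\<forall>i<players S. 1 \<le> udim S i) \<and>
     open (states S) \<and> 0 \<in> states S \<and>
     C1_on (drift S) (states S) \<and> drift S 0 = 0 \<and>
     (\<forall>i<players S. \<forall>k<udim S i. C1_on (\<lambda>x. input_col S i x k) (states S)) \<and>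
     (\<forall>i<players S. C1_on (Q i) (states S) \<and> Q i 0 = 0 \<and>
        (\<forall>x\<in>states S. x \<noteq> 0 \<longrightarrow> 0 < Q i x)) \<and>
     (\<forall>i<players S. \<forall>j<players S. i \<noteq> j \<longrightarrow> pos_semidef_mat (udim S j) (R i j)) \<and>
     (\<forall>i<players S. pos_def_mat (udim S i) (R i i))"


section \<open>Single-player optimal control with the other strategies fixed\<close>

definition is_optimal ::
  "'s::real_normed_vector dsystem \<Rightarrow> ('s \<Rightarrow> real) \<Rightarrow> (nat \<Rightarrow> real mat) \<Rightarrow> nat \<Rightarrow> 's profile \<Rightarrow> bool" where
  "is_optimal S q r i \<mu> \<longleftrightarrow> admissible S q r i \<mu> \<and>
     (\<forall>\<nu>. admissible S q r i (\<mu>(i := \<nu>)) \<longrightarrow>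
        (\<forall>x\<in>states S. value_fun S q r \<mu> x \<le> value_fun S q r (\<mu>(i := \<nu>)) x))"

definition is_unique_optimal ::
  "'s::real_normed_vector dsystem \<Rightarrow> ('s \<Rightarrow> real) \<Rightarrow> (nat \<Rightarrow> real mat) \<Rightarrow> nat \<Rightarrow> 's profile \<Rightarrow> bool" where
  "is_unique_optimal S q r i \<mu> \<longleftrightarrow> is_optimal S q r i \<mu> \<and>
     (\<forall>\<nu>. is_optimal S q r i (\<mu>(i := \<nu>)) \<longrightarrow> (\<forall>x\<in>states S. \<nu> x = \<mu> i x))"

text \<open>
  In the decoupled HJB equation the strategies of all players, including player \<open>i\<close>, are those
  of the profile \<open>\<mu>\<close>; it is an equation for \<open>V\<close> alone.
\<close>

definition decoupled_HJB_nec_suff ::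
  "'s::real_normed_vector dsystem \<Rightarrow> ('s \<Rightarrow> real) \<Rightarrow> (nat \<Rightarrow> real mat) \<Rightarrow> nat \<Rightarrow> 's profile \<Rightarrow> bool" where
  "decoupled_HJB_nec_suff S q r i \<mu> \<longleftrightarrow>
     (\<forall>V. C2_on V (states S) \<and> V 0 = 0 \<longrightarrow>
        (HJB_eq S q r \<mu> V \<longleftrightarrow>
           is_unique_optimal S q r i \<mu> \<and> (\<forall>x\<in>states S. V x = value_fun S q r \<mu> x)))"


section \<open>Identification data\<close>

text \<open>
  The first \<open>hbar i\<close> components of \<open>phi i\<close> form \<open>\<phi>\<^sub>i\<^sup>(\<^sup>r\<^sup>)\<close>, the remaining ones \<open>\<phi>\<^sub>i\<^sup>(\<^sup>-\<^sup>r\<^sup>)\<close>.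
  \<open>udemo d i\<close> is the control of player \<open>i\<close> in demonstration \<open>d\<close>.
\<close>

record 's ident =
  psi :: "nat \<Rightarrow> 's \<Rightarrow> real Matrix.vec"
  phi :: "nat \<Rightarrow> 's \<Rightarrow> real Matrix.vec"
  mdim :: "nat \<Rightarrow> nat"
  hdim :: "nat \<Rightarrow> nat"
  hbar :: "nat \<Rightarrow> nat"
  ndemo :: nat
  xdemo :: "nat \<Rightarrow> real \<Rightarrow> 's"
  udemo :: "nat \<Rightarrow> nat \<Rightarrow> real \<Rightarrow> real Matrix.vec"
  nsample :: nat
  step :: real
  hjb_points :: "'s list"

definition phi_r :: "'s ident \<Rightarrow> nat \<Rightarrow> 's \<Rightarrow> real Matrix.vec" where
  "phi_r E i x = vec_first (phi E i x) (hbar E i)"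

definition phi_nr :: "'s ident \<Rightarrow> nat \<Rightarrow> 's \<Rightarrow> real Matrix.vec" where
  "phi_nr E i x = vec_last (phi E i x) (hdim E i - hbar E i)"

definition Phi_r :: "'s::real_normed_vector dsystem \<Rightarrow> 's ident \<Rightarrow> nat \<Rightarrow> 's \<Rightarrow> real mat" where
  "Phi_r S E i x = Matrix.mat (udim S i) (hbar E i)
     (\<lambda>(k, l). input_grad S i (\<lambda>y. phi_r E i y $ l) x $ k)"

definition Phi_bar :: "'s::real_normed_vector dsystem \<Rightarrow> 's ident \<Rightarrow> nat \<Rightarrow> 's \<Rightarrow> real mat" where
  "Phi_bar S E i x = Matrix.mat (udim S i) (udim S i * hbar E i)
     (\<lambda>(k, c). if c div hbar E i = k then Phi_r S E i x $$ (k, c mod hbar E i) else 0)"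

definition basis_split :: "'s::real_normed_vector dsystem \<Rightarrow> 's ident \<Rightarrow> nat \<Rightarrow> bool" where
  "basis_split S E i \<longleftrightarrow> hbar E i \<le> hdim E i \<and>
     (\<forall>j<hdim E i - hbar E i. \<forall>x\<in>states S.
        input_grad S i (\<lambda>y. phi_nr E i y $ j) x = 0\<^sub>v (udim S i)) \<and>
     (\<forall>j<hbar E i. \<exists>x\<in>states S.
        input_grad S i (\<lambda>y. phi_r E i y $ j) x \<noteq> 0\<^sub>v (udim S i))"

definition sample_times :: "'s dsystem \<Rightarrow> 's ident \<Rightarrow> real list" where
  "sample_times S E = map (\<lambda>k. time0 S + real k * step E) [0..<nsample E]"

definition sample_states :: "'s dsystem \<Rightarrow> 's ident \<Rightarrow> 's list" where
  "sample_states S E = concat (map (\<lambda>d. map (xdemo E d) (sample_times S E)) [0..<ndemo E])"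

definition M_u_of :: "'s::real_normed_vector dsystem \<Rightarrow> 's ident \<Rightarrow> nat \<Rightarrow> 's list \<Rightarrow> real mat" where
  "M_u_of S E i xs = mat_of_rows (udim S i * hbar E i)
     (concat (map (\<lambda>x. Matrix.rows ((-1/2) \<cdot>\<^sub>m Phi_bar S E i x)) xs))"

definition M_u :: "'s::real_normed_vector dsystem \<Rightarrow> 's ident \<Rightarrow> nat \<Rightarrow> real mat" where
  "M_u S E i = M_u_of S E i (sample_states S E)"

definition z_u :: "'s::real_normed_vector dsystem \<Rightarrow> 's ident \<Rightarrow> nat \<Rightarrow> real Matrix.vec" where
  "z_u S E i = vec_of_list (concat (map (\<lambda>d. concat (map (\<lambda>t. list_of_vec (udemo E d i t))
     (sample_times S E))) [0..<ndemo E]))"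

definition theta_bar_hat :: "'s::real_normed_vector dsystem \<Rightarrow> 's ident \<Rightarrow> nat \<Rightarrow> real Matrix.vec" where
  "theta_bar_hat S E i =
     mp_inverse (transpose_mat (M_u S E i) * M_u S E i) *\<^sub>v (transpose_mat (M_u S E i) *\<^sub>v z_u S E i)"

definition mu_hat :: "'s::real_normed_vector dsystem \<Rightarrow> 's ident \<Rightarrow> 's profile" where
  "mu_hat S E i x = (-1/2) \<cdot>\<^sub>v (Phi_bar S E i x *\<^sub>v theta_bar_hat S E i)"

definition block_sel :: "nat \<Rightarrow> nat \<Rightarrow> nat \<Rightarrow> real mat" where
  "block_sel p h j = Matrix.mat h (p * h) (\<lambda>(r, c). if c = j * h + r then 1 else 0)"

definition theta_r_hat :: "'s::real_normed_vector dsystem \<Rightarrow> 's ident \<Rightarrow> nat \<Rightarrow> real Matrix.vec" where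
  "theta_r_hat S E i =
     (let P = (\<lambda>j. block_sel (udim S i) (hbar E i) j *\<^sub>v theta_bar_hat S E i) in
      Matrix.vec (hbar E i)
        (\<lambda>l. 1 / real (udim S i) * (\<Sum>j<udim S i. P j $ l / vec_norm2 (P j))))"

definition full_rank_u :: "'s::real_normed_vector dsystem \<Rightarrow> 's ident \<Rightarrow> nat \<Rightarrow> bool" where
  "full_rank_u S E i \<longleftrightarrow> mat_rank (M_u S E i) = udim S i * hbar E i"

definition squared_controls :: "'s dsystem \<Rightarrow> 's profile \<Rightarrow> 's \<Rightarrow> real Matrix.vec" where
  "squared_controls S \<mu> x =
     vec_of_list (concat (map (\<lambda>j. map (\<lambda>k. \<mu> j x $ k * \<mu> j x $ k) [0..<udim S j]) [0..<players S]))"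

definition M_hjb_r_of :: "'s::real_normed_vector dsystem \<Rightarrow> 's ident \<Rightarrow> nat \<Rightarrow> 's list \<Rightarrow> real mat" where
  "M_hjb_r_of S E i xs = mat_of_rows (total_udim S + mdim E i + (hdim E i - hbar E i))
     (map (\<lambda>x. (squared_controls S (mu_hat S E) x @\<^sub>v psi E i x) @\<^sub>v
        jac_apply (hdim E i - hbar E i) (phi_nr E i) x (closed_loop S (mu_hat S E) x)) xs)"

definition z_hjb_r :: "'s::real_normed_vector dsystem \<Rightarrow> 's ident \<Rightarrow> nat \<Rightarrow> real Matrix.vec" where
  "z_hjb_r S E i = vec_of_list
     (map (\<lambda>x. - (theta_r_hat S E i \<bullet>
        jac_apply (hbar E i) (phi_r E i) x (closed_loop S (mu_hat S E) x))) (hjb_points E))"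

definition M_hjb_of :: "'s::real_normed_vector dsystem \<Rightarrow> 's ident \<Rightarrow> nat \<Rightarrow> 's list \<Rightarrow> real mat" where
  "M_hjb_of S E i xs = mat_of_rows (total_udim S + mdim E i + hdim E i)
     (map (\<lambda>x. (squared_controls S (mu_hat S E) x @\<^sub>v psi E i x) @\<^sub>v
        jac_apply (hdim E i) (phi E i) x (closed_loop S (mu_hat S E) x)) xs)"

definition M_hjb_r :: "'s::real_normed_vector dsystem \<Rightarrow> 's ident \<Rightarrow> nat \<Rightarrow> real mat" where
  "M_hjb_r S E i = M_hjb_r_of S E i (hjb_points E)"

definition M_hjb :: "'s::real_normed_vector dsystem \<Rightarrow> 's ident \<Rightarrow> nat \<Rightarrow> real mat" where
  "M_hjb S E i = M_hjb_of S E i (hjb_points E)"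

definition z_hjb :: "'s ident \<Rightarrow> real Matrix.vec" where
  "z_hjb E = 0\<^sub>v (length (hjb_points E))"


section \<open>Cost parameters\<close>

definition alpha_of :: "'s dsystem \<Rightarrow> (nat \<Rightarrow> real mat) \<Rightarrow> real Matrix.vec" where
  "alpha_of S r = vec_of_list (concat (map (\<lambda>j. diag_mat (r j)) [0..<players S]))"

definition R_of :: "'s dsystem \<Rightarrow> real Matrix.vec \<Rightarrow> nat \<Rightarrow> real mat" where
  "R_of S \<alpha> j = mat_diag (udim S j) (\<lambda>k. \<alpha> $ ((\<Sum>l<j. udim S l) + k))"

definition Q_of :: "'s ident \<Rightarrow> nat \<Rightarrow> real Matrix.vec \<Rightarrow> 's \<Rightarrow> real" where
  "Q_of E i \<beta> x = \<beta> \<bullet> psi E i x"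

definition params_ok ::
  "'s::real_normed_vector dsystem \<Rightarrow> 's ident \<Rightarrow> nat \<Rightarrow> real Matrix.vec \<times> real Matrix.vec \<Rightarrow> bool" where
  "params_ok S E i = (\<lambda>(\<alpha>, \<beta>).
     decoupled_HJB_nec_suff S (Q_of E i \<beta>) (R_of S \<alpha>) i (mu_hat S E))"

definition L_r :: "'s dsystem \<Rightarrow> 's ident \<Rightarrow> nat \<Rightarrow> real mat" where
  "L_r S E i = left_id_mat (total_udim S + mdim E i) (total_udim S + mdim E i + (hdim E i - hbar E i))"

definition L_full :: "'s dsystem \<Rightarrow> 's ident \<Rightarrow> nat \<Rightarrow> real mat" where
  "L_full S E i = left_id_mat (total_udim S + mdim E i) (total_udim S + mdim E i + hdim E i)"

text \<open>
  The parameters produced by the least-squares formulas with unrestricted free vector \<open>w\<close>;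
  the restriction on \<open>w\<close> is a condition on the resulting parameters, added in \<open>param_set\<close>.
  The two sets have to be distinguished: for \<open>x' = u\<close> with cost integrand \<open>x\<^sup>2 + u\<^sup>2\<close> and
  \<open>\<psi> = \<phi> = x\<^sup>2\<close> the first one is the line \<open>\<alpha> + \<beta> = 2\<close>, but only its point \<open>(1, 1)\<close> makes
  \<open>u = -x\<close> optimal.
\<close>

definition ls_params_r ::
  "'s::real_normed_vector dsystem \<Rightarrow> 's ident \<Rightarrow> nat \<Rightarrow> (real Matrix.vec \<times> real Matrix.vec) set" where
  "ls_params_r S E i = {(\<alpha>, \<beta>). \<alpha> \<in> carrier_vec (total_udim S) \<and> \<beta> \<in> carrier_vec (mdim E i) \<and>
     (\<exists>w \<in> carrier_vec (total_udim S + mdim E i + (hdim E i - hbar E i)).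
        \<alpha> @\<^sub>v \<beta> = ls_point (L_r S E i) (M_hjb_r S E i) (z_hjb_r S E i) w)}"

definition ls_params_full ::
  "'s::real_normed_vector dsystem \<Rightarrow> 's ident \<Rightarrow> nat \<Rightarrow> (real Matrix.vec \<times> real Matrix.vec) set" where
  "ls_params_full S E i = {(\<alpha>, \<beta>). \<alpha> \<in> carrier_vec (total_udim S) \<and> \<beta> \<in> carrier_vec (mdim E i) \<and>
     (\<exists>w \<in> carrier_vec (total_udim S + mdim E i + hdim E i).
        \<alpha> @\<^sub>v \<beta> = ls_point (L_full S E i) (M_hjb S E i) (z_hjb E) w)}"

definition param_set ::
  "'s::real_normed_vector dsystem \<Rightarrow> 's ident \<Rightarrow> nat \<Rightarrow> (real Matrix.vec \<times> real Matrix.vec) set" where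
  "param_set S E i =
     {ab \<in> (if full_rank_u S E i then ls_params_r S E i else ls_params_full S E i). params_ok S E i ab}"


section \<open>The offline inverse differential game problem\<close>

definition reproduces_demos :: "'s::real_normed_vector dsystem \<Rightarrow> 's ident \<Rightarrow> 's profile \<Rightarrow> bool" where
  "reproduces_demos S E \<mu> \<longleftrightarrow> (\<forall>d<ndemo E.
     (\<exists>x. solution S \<mu> (xdemo E d (time0 S)) x) \<and>
     (\<forall>x. solution S \<mu> (xdemo E d (time0 S)) x \<longrightarrow>
        (\<forall>t\<ge>time0 S. x t = xdemo E d t \<and> (\<forall>i<players S. \<mu> i (x t) = udemo E d i t))))"

text \<open>
  An equilibrium of the game with the parameters \<open>\<alpha> i\<close>, \<open>\<beta> i\<close> exists and reproduces the
  demonstrations; if the equilibrium of that game is unique,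
  it is this one.
\<close>

definition solves_inverse_game ::
  "'s::real_normed_vector dsystem \<Rightarrow> 's ident \<Rightarrow> (nat \<Rightarrow> real Matrix.vec) \<Rightarrow> (nat \<Rightarrow> real Matrix.vec) \<Rightarrow> bool" where
  "solves_inverse_game S E \<alpha> \<beta> \<longleftrightarrow>
     (\<exists>\<mu>. is_FNE S (\<lambda>i. Q_of E i (\<beta> i)) (\<lambda>i. R_of S (\<alpha> i)) \<mu> \<and> reproduces_demos S E \<mu>) \<and>
     (\<forall>\<mu>. is_unique_FNE S (\<lambda>i. Q_of E i (\<beta> i)) (\<lambda>i. R_of S (\<alpha> i)) \<mu> \<longrightarrow> reproduces_demos S E \<mu>)"

definition FNE_demonstrations :: "'s::real_normed_vector dsystem \<Rightarrow> 's profile \<Rightarrow> 's ident \<Rightarrow> bool" where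
  "FNE_demonstrations S \<mu> E \<longleftrightarrow> 1 \<le> ndemo E \<and> 1 \<le> nsample E \<and> 0 < step E \<and>
     (\<forall>d<ndemo E. solution S \<mu> (xdemo E d (time0 S)) (xdemo E d) \<and>
        (\<forall>i<players S. \<forall>t\<ge>time0 S. udemo E d i t = \<mu> i (xdemo E d t)))"

definition rank_maximal :: "'s set \<Rightarrow> ('s list \<Rightarrow> real mat) \<Rightarrow> 's list \<Rightarrow> bool" where
  "rank_maximal X M xs \<longleftrightarrow> (\<forall>ys. set ys \<subseteq> X \<longrightarrow> mat_rank (M (xs @ ys)) = mat_rank (M xs))"

end

theory Submission
  imports Defs "Jordan_Normal_Form.Matrix_Kernel"
begin

text \<open>
  The HJB equations give \<open>\<mu>\<^sub>i = -\<Phi>\<^sub>i \<theta>/2\<close> for the stacked vector \<open>\<theta>\<close> of the blocks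
  \<open>\<theta>\<^sub>i\<^sup>(\<^sup>r\<^sup>) / r\<^sub>i\<^sub>i\<^sub>,\<^sub>k\<close>, so the control data are consistent. A data matrix of maximal rank has the same
  kernel as with any further row, hence the least-squares strategy agrees with \<open>\<mu>\<^sub>i\<close> on all of \<open>\<X>\<close>.
  By the same argument every least-squares solution of the HJB data solves the decoupled HJB
  equation on all of \<open>\<X>\<close>; parameters for which that equation is necessary and sufficient therefore
  make \<open>\<mu>\<close> optimal for each player, that is, an equilibrium, and uniqueness of solutions of the
  closed loop reproduces the demonstrations.

  Every positive multiple of the true parameters passes the necessity-and-sufficiency test.
  A solution of the HJB equation is the value function, as one sees by integrating it along the
  closed loop. For a second optimal strategy \<open>\<nu>\<close>, completing the square shows that the derivative of
  the value function along the trajectory of \<open>\<nu>\<close> exceeds minus the running cost by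
  \<open>(\<nu> - \<mu>\<^sub>i)\<^sup>T R\<^sub>i\<^sub>i (\<nu> - \<mu>\<^sub>i)\<close>; equality of the values makes the integral of this term vanish.

  If \<open>M\<^sub>u\<close> does not have full rank, then the HJB data are homogeneous and all positive multiples of
  the true parameters are in the set, so both sides of the claimed equivalence are false.
\<close>

section \<open>Rank, kernel and least squares\<close>

text \<open>\<open>mp_inverse\<close> is a definite description, so existence and uniqueness precede
  any computation; every pseudoinverse that occurs belongs to a Gram matrix, for which the symmetric
  case suffices. All data turn out to be exactly consistent, so least squares never really
  minimises: its formulas parametrise solution sets of linear systems. The recurring obstacle is the
  domain. The identified profile agrees with the true one only on \<open>states S\<close>, and costs
  and values are controlled only there. Solutions are confined to that set, so trajectories and
  values do not notice the difference; derivatives do not either, because the set is open. The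
  normalisation in \<open>theta_r_hat\<close> leaves a positive factor undetermined beforehand,
  hence the treatment of arbitrary positive multiples of the true parameters. In the uniqueness of
  the optimal strategy, convergence of the integral of the square is not presupposed: it appears as
  a limit over growing intervals, on which the integrals are monotone.\<close>

lemma mat_rank_plus_kernel_dim:
  assumes "M \<in> carrier_mat nr nc"
  shows "mat_rank M + kernel.dim nc M = nc"
proof -
  interpret W: vec_space "TYPE(real)" nr .
  interpret V: vec_space "TYPE(real)" nc .
  interpret K: kernel nr nc M by standard (rule assms)
  interpret T: linear_map class_ring "module_vec TYPE(real) nc" "module_vec TYPE(real) nr" "\<lambda>v. M *\<^sub>v v"
    by unfold_locales
      (use assms in \<open>auto simp: module_hom_def mult_add_distrib_mat_vec mult_mat_vec\<close>)
  have im: "T.im = W.span (set (cols M))"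
    using W.col_space_eq[OF assms] assms by (auto simp: T.im_def W.col_space_def)
  have ker: "T.ker = mat_kernel M"
    using assms by (auto simp: T.ker_def mat_kernel_def)
  show ?thesis
    using T.rank_nullity assms im ker by (simp add: mat_rank_def W.rank_def V.dim_is_n)
qed

lemma mat_kernel_full_rank:
  assumes M: "M \<in> carrier_mat nr nc" and rank: "mat_rank M = nc"
    and v: "v \<in> carrier_vec nc" "M *\<^sub>v v = 0\<^sub>v nr"
  shows "v = 0\<^sub>v nc"
proof -
  interpret K: kernel nr nc M by standard (rule M)
  obtain B where B: "finite B" "K.basis B"
    using kernel_basis_exists[OF M] by blast
  have "card B = 0"
    using K.Ker.dim_basis[OF B] mat_rank_plus_kernel_dim[OF M] rank by simp
  with B have "K.basis {}" by simp
  then have "mat_kernel M = {0\<^sub>v nc}"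
    using K.Ker.span_empty by (auto simp: K.Ker.basis_def)
  with mat_kernelI[OF M v] show ?thesis by simp
qed

text \<open>By rank-nullity both kernels have the same dimension, so a basis of the smaller one is
  an independent set of full size in the larger one. The rank conditions enter the proof through
  this fact, with \<open>M'\<close> equal to \<open>M\<close> plus the rows of one further data
  point.\<close>

lemma mat_kernel_eq_of_rank_eq:
  assumes M: "M \<in> carrier_mat nr nc" and M': "M' \<in> carrier_mat nr' nc"
    and sub: "mat_kernel M' \<subseteq> mat_kernel M" and rank: "mat_rank M' = mat_rank M"
  shows "mat_kernel M' = mat_kernel M"
proof -
  interpret K: kernel nr nc M by standard (rule M)
  interpret K': kernel nr' nc M' by standard (rule M')
  obtain B where B: "finite B" "K'.basis B"
    using kernel_basis_exists[OF M'] by blast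
  obtain C where C: "finite C" "K.basis C"
    using kernel_basis_exists[OF M] by blast
  have B': "B \<subseteq> mat_kernel M'" "\<not> K'.Ker.lin_dep B" "K'.span B = mat_kernel M'"
    using B(2) by (auto simp: K'.Ker.basis_def)
  have BM: "B \<subseteq> mat_kernel M" using B'(1) sub by blast
  have "K.Ker.fin_dim"
    using C unfolding K.Ker.fin_dim_def K.Ker.basis_def by blast
  moreover have "\<not> K.Ker.lin_dep B"
    using B'(2) K.lindep_same[OF BM] K'.lindep_same[OF B'(1)] by simp
  \<comment> \<open>Both matrices have \<open>nc\<close> columns, so equal ranks mean equal kernel
    dimensions, and \<open>B\<close> has as many elements as the dimension of the kernel of
    \<open>M'\<close>.\<close>
  moreover have "K.dim \<le> card B"
    using K'.Ker.dim_basis[OF B] mat_rank_plus_kernel_dim[OF M] mat_rank_plus_kernel_dim[OF M'] rank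
    by simp
  ultimately have "K.basis B"
    using B(1) BM by (intro K.Ker.dim_li_is_basis) auto
  then have "K.span B = mat_kernel M" by (simp add: K.Ker.basis_def)
  then show ?thesis
    using B'(3) K.span_same[OF BM] K'.span_same[OF B'(1)] by simp
qed

lemma vec_minus_eq_0:
  fixes u v :: "real Matrix.vec"
  assumes "u \<in> carrier_vec n" "v \<in> carrier_vec n" "u - v = 0\<^sub>v n"
  shows "u = v"
proof (rule eq_vecI)
  fix i assume "i < dim_vec v"
  moreover from this have "(u - v) $ i = 0" unfolding assms(3) using assms(2) by simp
  ultimately show "u $ i = v $ i" by simp
qed (use assms in auto)

lemma mult_mat_zero_vec:
  fixes A :: "real mat"
  shows "A \<in> carrier_mat nr nc \<Longrightarrow> A *\<^sub>v 0\<^sub>v nc = 0\<^sub>v nr"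
  by (intro eq_vecI) auto

lemma scalar_prod_self_eq_0:
  fixes v :: "real Matrix.vec"
  assumes "v \<in> carrier_vec n" "v \<bullet> v = 0"
  shows "v = 0\<^sub>v n"
proof (rule eq_vecI)
  fix i assume i: "i < dim_vec (0\<^sub>v n)"
  have "\<forall>i\<in>{0..<n}. v $ i * v $ i = 0"
    using assms by (subst sum_nonneg_eq_0_iff[symmetric]) (auto simp: scalar_prod_def)
  with i show "v $ i = 0\<^sub>v n $ i" by simp
qed (use assms in auto)

text \<open>The squared length of \<open>M v\<close> is the scalar product of \<open>v\<close> with
  the image of \<open>v\<close> under the Gram matrix. Hence passing to the normal equations does
  not enlarge the kernel.\<close>

lemma transpose_mult_self_eq_0:
  fixes M :: "real mat"
  assumes M: "M \<in> carrier_mat nr nc" and v: "v \<in> carrier_vec nc"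
    and 0: "transpose_mat M *\<^sub>v (M *\<^sub>v v) = 0\<^sub>v nc"
  shows "M *\<^sub>v v = 0\<^sub>v nr"
proof -
  have "(M *\<^sub>v v) \<bullet> (M *\<^sub>v v) = (transpose_mat M *\<^sub>v (M *\<^sub>v v)) \<bullet> v"
    using M v by (intro transpose_vec_mult_scalar[symmetric]) auto
  then show ?thesis using 0 M v by (intro scalar_prod_self_eq_0) auto
qed

text \<open>The four Penrose equations as a predicate, so that the description in
  \<open>mp_inverse\<close> can be resolved with \<open>theI\<close>.\<close>

definition is_mp_inverse :: "real mat \<Rightarrow> real mat \<Rightarrow> bool" where
  "is_mp_inverse A X \<longleftrightarrow> X \<in> carrier_mat (dim_col A) (dim_row A) \<and>
     A * X * A = A \<and> X * A * X = X \<and>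
     transpose_mat (A * X) = A * X \<and> transpose_mat (X * A) = X * A"

text \<open>\<open>A X\<close> and \<open>A Y\<close> are symmetric and each absorbs the other;
  transposing one absorption identity yields \<open>A X = A Y\<close>, and in the same way
  \<open>X A = Y A\<close>. Then \<open>X = X A X = Y A X = Y A Y = Y\<close>.\<close>

lemma is_mp_inverse_unique:
  assumes X: "is_mp_inverse A X" and Y: "is_mp_inverse A Y"
  shows "X = Y"
proof -
  define m n where "m = dim_row A" and "n = dim_col A"
  have c: "A \<in> carrier_mat m n" "X \<in> carrier_mat n m" "Y \<in> carrier_mat n m"
    using X Y by (auto simp: is_mp_inverse_def m_def n_def)
  have X': "A * X * A = A" "X * A * X = X" "transpose_mat (A * X) = A * X" "transpose_mat (X * A) = X * A"
    and Y': "A * Y * A = A" "Y * A * Y = Y" "transpose_mat (A * Y) = A * Y" "transpose_mat (Y * A) = Y * A"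
    using X Y by (auto simp: is_mp_inverse_def)
  have XY: "A * X * (A * Y) = A * Y"
  proof -
    have "A * X * (A * Y) = A * X * A * Y"
      by (rule assoc_mult_mat[symmetric, of _ m m _ n _ m]) (use c in auto)
    then show ?thesis by (simp only: X'(1))
  qed
  have YX: "A * Y * (A * X) = A * X"
  proof -
    have "A * Y * (A * X) = A * Y * A * X"
      by (rule assoc_mult_mat[symmetric, of _ m m _ n _ m]) (use c in auto)
    then show ?thesis by (simp only: Y'(1))
  qed
  have "transpose_mat (A * X * (A * Y)) = A * Y * (A * X)"
    using c X' Y' by (subst transpose_mult[of _ m m _ m]) auto
  then have AX: "A * X = A * Y" using XY YX Y'(3) by simp
  have XY': "X * A * (Y * A) = X * A"
  proof -
    have "X * A * (Y * A) = X * (A * (Y * A))"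
      by (rule assoc_mult_mat[of _ n m _ n _ n]) (use c in auto)
    also have "A * (Y * A) = A * Y * A"
      by (rule assoc_mult_mat[symmetric, of _ m n _ m _ n]) (use c in auto)
    finally show ?thesis by (simp only: Y'(1))
  qed
  have YX': "Y * A * (X * A) = Y * A"
  proof -
    have "Y * A * (X * A) = Y * (A * (X * A))"
      by (rule assoc_mult_mat[of _ n m _ n _ n]) (use c in auto)
    also have "A * (X * A) = A * X * A"
      by (rule assoc_mult_mat[symmetric, of _ m n _ m _ n]) (use c in auto)
    finally show ?thesis by (simp only: X'(1))
  qed
  have "transpose_mat (X * A * (Y * A)) = Y * A * (X * A)"
    using c X' Y' by (subst transpose_mult[of _ n n _ n]) auto
  then have XA: "X * A = Y * A" using XY' YX' X'(4) by simp
  have "X = Y * A * X" using X'(2) XA by simp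
  also have "\<dots> = Y * (A * X)" using c by (intro assoc_mult_mat) auto
  also have "\<dots> = Y * A * Y" using c AX by (subst assoc_mult_mat) auto
  finally show ?thesis using Y'(2) by simp
qed

text \<open>
  If the columns of \<open>N\<close> form a basis of the kernel of the symmetric matrix \<open>A\<close>, then
  \<open>A + N N\<^sup>T\<close> is invertible and commutes with \<open>A\<close>; with its inverse \<open>C\<close>, the Moore--Penrose
  inverse of \<open>A\<close> is \<open>C A C\<close>.
\<close>

lemma symmetric_mp_inverse_exists:
  fixes A :: "real mat"
  assumes A: "A \<in> carrier_mat n n" and sym: "transpose_mat A = A"
  shows "\<exists>X. is_mp_inverse A X"
proof -
  interpret K: kernel n n A by standard (rule A)
  obtain B where B: "finite B" "K.basis B"
    using kernel_basis_exists[OF A] by blast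
  then have B': "B \<subseteq> mat_kernel A" "K.span B = mat_kernel A"
    by (auto simp: K.Ker.basis_def)
  then have Bc: "B \<subseteq> carrier_vec n" using mat_kernel[OF A] by auto
  \<comment> \<open>Repetitions in \<open>bs\<close> would do no harm: only the span of the columns
    of \<open>N\<close> matters.\<close>
  obtain bs where bs: "set bs = B" using finite_list[OF B(1)] by blast
  define N where "N = mat_of_cols n bs"
  define k where "k = length bs"
  have N: "N \<in> carrier_mat n k" by (simp add: N_def k_def)
  have AN: "A * N = 0\<^sub>m n k"
  proof (rule eq_matI)
    fix i j assume ij: "i < dim_row (0\<^sub>m n k)" "j < dim_col (0\<^sub>m n k)"
    then have "bs ! j \<in> mat_kernel A" using bs B' by (auto simp: k_def)
    then have "A *\<^sub>v (bs ! j) = 0\<^sub>v n" "bs ! j \<in> carrier_vec n"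
      using mat_kernelD[OF A] by auto
    moreover from this have "(A * N) $$ (i, j) = Matrix.row A i \<bullet> (bs ! j)"
      using ij A N by (simp add: N_def k_def)
    moreover have "Matrix.row A i \<bullet> (bs ! j) = (A *\<^sub>v (bs ! j)) $ i" using ij A by simp
    ultimately have "(A * N) $$ (i, j) = 0\<^sub>v n $ i" by (simp only:)
    then show "(A * N) $$ (i, j) = 0\<^sub>m n k $$ (i, j)" using ij by simp
  qed (use A N in auto)
  define P where "P = N * transpose_mat N"
  have P: "P \<in> carrier_mat n n" using N by (simp add: P_def)
  have AP: "A * P = 0\<^sub>m n n"
    unfolding P_def using A N AN by (subst assoc_mult_mat[symmetric, of _ n n _ k _ n]) auto
  have Psym: "transpose_mat P = P"
    unfolding P_def using N by (subst transpose_mult[of _ n k _ n]) auto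
  have "transpose_mat (A * P) = P * A"
    using A P sym Psym by (subst transpose_mult) auto
  then have PA: "P * A = 0\<^sub>m n n" using AP by simp
  define D where "D = A + P"
  have D: "D \<in> carrier_mat n n" and Dsym: "transpose_mat D = D"
    using A P sym Psym transpose_add[OF A P] by (auto simp: D_def)
  \<comment> \<open>Applying \<open>A\<close> removes the summand with \<open>P\<close>, so
    \<open>A (A v) = 0\<close> and, by symmetry, \<open>A v = 0\<close>. What remains is
    \<open>N N^T v = 0\<close>, hence \<open>N^T v = 0\<close>; but \<open>v\<close> is in the
    kernel of \<open>A\<close>, so it is itself a combination of the columns of \<open>N\<close> and
    orthogonal to itself.\<close>
  have inj: "v = 0\<^sub>v n" if v: "v \<in> carrier_vec n" "D *\<^sub>v v = 0\<^sub>v n" for v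
  proof -
    have split: "A *\<^sub>v v + P *\<^sub>v v = 0\<^sub>v n"
      using v A P by (simp add: D_def add_mult_distrib_mat_vec)
    have "A *\<^sub>v (A *\<^sub>v v) + A *\<^sub>v (P *\<^sub>v v) = 0\<^sub>v n"
      using arg_cong[OF split, of "\<lambda>u. A *\<^sub>v u"] A P v
      by (subst (asm) mult_add_distrib_mat_vec[of _ n n]) auto
    moreover have "A *\<^sub>v (P *\<^sub>v v) = 0\<^sub>v n"
      using A P v AP by (subst assoc_mult_mat_vec[symmetric, of _ n n _ n]) auto
    ultimately have "transpose_mat A *\<^sub>v (A *\<^sub>v v) = 0\<^sub>v n" using A v sym by simp
    then have Av: "A *\<^sub>v v = 0\<^sub>v n" using transpose_mult_self_eq_0[OF A v(1)] by simp
    then have "P *\<^sub>v v = 0\<^sub>v n" using split P v by simp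
    then have "transpose_mat (transpose_mat N) *\<^sub>v (transpose_mat N *\<^sub>v v) = 0\<^sub>v n"
      using N v by (simp add: P_def assoc_mult_mat_vec[of _ n k _ n])
    then have Nv: "transpose_mat N *\<^sub>v v = 0\<^sub>v k"
      using transpose_mult_self_eq_0[of "transpose_mat N" k n v] N v by simp
    have "v \<in> K.NC.span B"
      using mat_kernelI[OF A v(1) Av] B' K.span_same[OF B'(1)] by simp
    then have "v \<in> K.NC.col_space N"
      using Bc bs by (simp add: K.NC.col_space_def N_def cols_mat_of_cols)
    then obtain u where u: "u \<in> carrier_vec k" "v = N *\<^sub>v u"
      using K.NC.col_space_eq[OF N] N by auto
    have "v \<bullet> v = (transpose_mat N *\<^sub>v v) \<bullet> u"
      using transpose_vec_mult_scalar[OF N u(1) v(1)] u(2) by simp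
    then show ?thesis using Nv u v by (intro scalar_prod_self_eq_0) auto
  qed
  have "det D \<noteq> 0"
    using det_0_iff_vec_prod_zero_field[OF D] inj by blast
  from det_non_zero_imp_unit[OF D this, of "()"]
  obtain C where C: "C \<in> carrier_mat n n" "C * D = 1\<^sub>m n" "D * C = 1\<^sub>m n"
    unfolding Units_def ring_mat_def by auto
  note as = assoc_mult_mat[of _ n n _ n _ n]
  have Cs: "transpose_mat C * D = 1\<^sub>m n"
    using arg_cong[OF C(3), of transpose_mat] C D Dsym
    by (subst (asm) transpose_mult[of _ n n _ n]) auto
  have "transpose_mat C = transpose_mat C * (D * C)" using C by simp
  also have "\<dots> = (transpose_mat C * D) * C" using C D by (intro as[symmetric]) auto
  finally have Csym: "transpose_mat C = C" using Cs C by simp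
  \<comment> \<open>Since \<open>P\<close> and \<open>A\<close> annihilate each other,
    \<open>D\<close> acts on \<open>A\<close> as \<open>A\<close> does. Thus \<open>C\<close>
    cancels one factor of \<open>A A\<close> from either side, which forces \<open>C\<close> and
    \<open>A\<close> to commute and makes the Penrose equations short computations.\<close>
  have DA: "D * A = A * A" and AD: "A * D = A * A"
    using A P PA AP by (auto simp: D_def add_mult_distrib_mat[of _ n n] mult_add_distrib_mat[of _ n n])
  have "C * (A * A) = C * (D * A)" by (simp only: DA)
  also have "\<dots> = (C * D) * A" using A C D by (intro as[symmetric]) auto
  finally have CAA: "C * (A * A) = A" using C A by simp
  have "(A * A) * C = (A * D) * C" by (simp only: AD)
  also have "\<dots> = A * (D * C)" using A C D by (intro as) auto
  finally have AAC: "(A * A) * C = A" using C A by simp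
  have "C * A = C * ((A * A) * C)" using AAC by simp
  also have "\<dots> = (C * (A * A)) * C" using A C by (intro as[symmetric]) auto
  finally have CA: "C * A = A * C" using CAA by simp
  have ACA: "A * (C * A) = A" using CA AAC A C by (simp add: as)
  have ACAC: "A * (C * A * C) = A * C"
  proof -
    have "A * (C * A * C) = A * (C * A) * C" using A C by (intro as[symmetric]) auto
    then show ?thesis using ACA by simp
  qed
  have CACA: "C * A * C * A = C * A"
  proof -
    have "C * A * C * A = C * (A * (C * A))" using A C by (simp add: as)
    then show ?thesis using ACA by simp
  qed
  have 1: "A * (C * A * C) * A = A" using ACAC ACA A C by (simp add: as)
  have "C * A * C * A * (C * A * C) = C * (A * (C * A * C))" using CACA A C by (simp add: as)
  then have 2: "C * A * C * A * (C * A * C) = C * A * C" using ACAC A C by (simp add: as)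
  have 3: "transpose_mat (A * C) = C * A" "transpose_mat (C * A) = A * C"
    using A C sym Csym by (auto simp: transpose_mult[of _ n n _ n])
  have "is_mp_inverse A (C * A * C)"
    unfolding is_mp_inverse_def using 1 2 3 CA ACAC CACA A C by auto
  then show ?thesis by blast
qed

text \<open>Of the four Penrose equations only the first is exported; it is the one that gives a
  solution of the normal equations.\<close>

lemma mp_inverse_gram:
  assumes M: "M \<in> carrier_mat nr nc"
  defines "G \<equiv> transpose_mat M * M"
  shows "mp_inverse G \<in> carrier_mat nc nc" "G * mp_inverse G * G = G"
proof -
  have G: "G \<in> carrier_mat nc nc" using M by (auto simp: G_def)
  have "transpose_mat G = G" using M by (simp add: G_def transpose_mult[of _ nc nr _ nc])
  then obtain X where X: "is_mp_inverse G X" using symmetric_mp_inverse_exists[OF G] by blast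
  have "mp_inverse G = (THE X. is_mp_inverse G X)"
    by (simp add: mp_inverse_def is_mp_inverse_def)
  also have "is_mp_inverse G \<dots>"
    using X by (rule theI) (rule is_mp_inverse_unique[OF _ X])
  finally have "is_mp_inverse G (mp_inverse G)" .
  then show "mp_inverse G \<in> carrier_mat nc nc" "G * mp_inverse G * G = G"
    by (simp_all only: is_mp_inverse_def carrier_matD[OF G])
qed

text \<open>The first Penrose equation turns the formula for \<open>x\<close> into
  \<open>G x = G y\<close>. So \<open>x - y\<close> is in the kernel of the Gram matrix, which is
  the kernel of \<open>M\<close>. The data are reproduced exactly, though \<open>x\<close> and
  \<open>y\<close> may differ.\<close>

lemma least_squares_consistent:
  assumes M: "M \<in> carrier_mat nr nc" and y: "y \<in> carrier_vec nc"
  defines "x \<equiv> mp_inverse (transpose_mat M * M) *\<^sub>v (transpose_mat M *\<^sub>v (M *\<^sub>v y))"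
  shows "x \<in> carrier_vec nc" "M *\<^sub>v x = M *\<^sub>v y"
proof -
  define G where "G = transpose_mat M * M"
  have G: "G \<in> carrier_mat nc nc" using M by (auto simp: G_def)
  have H: "mp_inverse G \<in> carrier_mat nc nc" "G * mp_inverse G * G = G"
    unfolding G_def by (rule mp_inverse_gram[OF M])+
  have Gv: "G *\<^sub>v v = transpose_mat M *\<^sub>v (M *\<^sub>v v)" if "v \<in> carrier_vec nc" for v
    unfolding G_def by (rule assoc_mult_mat_vec[of _ nc nr]) (use M that in auto)
  have x: "x = mp_inverse G *\<^sub>v (G *\<^sub>v y)"
    unfolding x_def Gv[OF y] by (simp only: G_def)
  show xc: "x \<in> carrier_vec nc"
    unfolding x using G H(1) y by (intro mult_mat_vec_carrier)
  have "(G * mp_inverse G * G) *\<^sub>v y = (G * mp_inverse G) *\<^sub>v (G *\<^sub>v y)"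
    by (rule assoc_mult_mat_vec[of _ nc nc _ nc]) (use G H(1) y in simp_all)
  also have "\<dots> = G *\<^sub>v x"
    unfolding x by (rule assoc_mult_mat_vec[of _ nc nc _ nc]) (use G H(1) y in simp_all)
  finally have Gxy: "G *\<^sub>v x = G *\<^sub>v y" by (simp only: H(2))
  have d: "x - y \<in> carrier_vec nc" using xc y by simp
  have "G *\<^sub>v (x - y) = 0\<^sub>v nc"
    unfolding mult_minus_distrib_mat_vec[OF G xc y] Gxy
    by (rule minus_cancel_vec[of _ nc]) (use G y in simp)
  then have "M *\<^sub>v (x - y) = 0\<^sub>v nr"
    unfolding Gv[OF d] by (rule transpose_mult_self_eq_0[OF M d])
  then have "M *\<^sub>v x - M *\<^sub>v y = 0\<^sub>v nr"
    unfolding mult_minus_distrib_mat_vec[OF M xc y] .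
  then show "M *\<^sub>v x = M *\<^sub>v y"
    by (rule vec_minus_eq_0[of _ nr, rotated -1]) (use M xc y in simp_all)
qed

text \<open>\<open>T\<close> projects onto the kernel of \<open>M\<close>: the part that it
  subtracts from \<open>w\<close> is the least-squares solution for the data \<open>M w\<close>,
  which has the same image as \<open>w\<close> and vanishes when \<open>M w\<close> does.\<close>

lemma gram_projection:
  assumes M: "M \<in> carrier_mat nr nc"
  defines "T \<equiv> 1\<^sub>m nc - mp_inverse (transpose_mat M * M) * (transpose_mat M * M)"
  shows "T \<in> carrier_mat nc nc"
    "w \<in> carrier_vec nc \<Longrightarrow> M *\<^sub>v (T *\<^sub>v w) = 0\<^sub>v nr"
    "w \<in> carrier_vec nc \<Longrightarrow> M *\<^sub>v w = 0\<^sub>v nr \<Longrightarrow> T *\<^sub>v w = w"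
proof -
  define G where "G = transpose_mat M * M"
  have G: "G \<in> carrier_mat nc nc" using M by (auto simp: G_def)
  have H: "mp_inverse G \<in> carrier_mat nc nc" "G * mp_inverse G * G = G"
    unfolding G_def by (rule mp_inverse_gram[OF M])+
  have T: "T = 1\<^sub>m nc - mp_inverse G * G" by (simp add: T_def G_def)
  show Tc: "T \<in> carrier_mat nc nc" using G H by (simp add: T minus_carrier_mat)
  have Tw: "T *\<^sub>v w = w - mp_inverse G *\<^sub>v (G *\<^sub>v w)" if "w \<in> carrier_vec nc" for w
    using that G H by (simp add: T minus_mult_distrib_mat_vec[of _ nc nc] assoc_mult_mat_vec[of _ nc nc])
  show "M *\<^sub>v (T *\<^sub>v w) = 0\<^sub>v nr" if w: "w \<in> carrier_vec nc"
  proof -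
    have "G *\<^sub>v w = transpose_mat M *\<^sub>v (M *\<^sub>v w)"
      using M w by (simp add: G_def assoc_mult_mat_vec[of _ nc nr])
    then have "M *\<^sub>v (mp_inverse G *\<^sub>v (G *\<^sub>v w)) = M *\<^sub>v w"
      using least_squares_consistent(2)[OF M w] by (simp add: G_def)
    then show ?thesis
      using M G H w by (simp add: Tw mult_minus_distrib_mat_vec[of _ nr nc] minus_cancel_vec)
  qed
  show "T *\<^sub>v w = w" if w: "w \<in> carrier_vec nc" "M *\<^sub>v w = 0\<^sub>v nr"
  proof -
    have "transpose_mat M *\<^sub>v 0\<^sub>v nr = 0\<^sub>v nc"
      using M by (intro mult_mat_zero_vec) simp
    then have "G *\<^sub>v w = 0\<^sub>v nc"
      using M w by (simp add: G_def assoc_mult_mat_vec[of _ nc nr])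
    then show ?thesis using w H(1) by (simp add: Tw mult_mat_zero_vec[OF H(1)])
  qed
qed

text \<open>While \<open>w\<close> varies, \<open>T w\<close> runs through the kernel of
  \<open>M\<close>, so a particular solution plus \<open>T w\<close> runs through all solutions.
  This removes the pseudoinverse from the parameter sets.\<close>

lemma ls_points_eq:
  assumes M: "M \<in> carrier_mat nr nc" and y0: "y0 \<in> carrier_vec nc" and L: "L \<in> carrier_mat k nc"
  shows "(\<exists>w\<in>carrier_vec nc. u = ls_point L M (M *\<^sub>v y0) w) \<longleftrightarrow>
     (\<exists>y\<in>carrier_vec nc. M *\<^sub>v y = M *\<^sub>v y0 \<and> u = L *\<^sub>v y)"
proof -
  define T where "T = 1\<^sub>m nc - mp_inverse (transpose_mat M * M) * (transpose_mat M * M)"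
  define x where "x = mp_inverse (transpose_mat M * M) *\<^sub>v (transpose_mat M *\<^sub>v (M *\<^sub>v y0))"
  note T = gram_projection[OF M, folded T_def]
  note x = least_squares_consistent[OF M y0, folded x_def]
  have pt: "ls_point L M (M *\<^sub>v y0) w = L *\<^sub>v (x + T *\<^sub>v w)" if "w \<in> carrier_vec nc" for w
    using that M L T(1) x(1)
    by (simp add: ls_point_def Let_def T_def x_def mult_add_distrib_mat_vec[OF L])
  show ?thesis
  proof safe
    fix w :: "real Matrix.vec" assume w: "w \<in> carrier_vec nc"
    have "M *\<^sub>v (x + T *\<^sub>v w) = M *\<^sub>v y0"
      using M x y0 w T by (simp add: mult_add_distrib_mat_vec[OF M])
    then show "\<exists>y\<in>carrier_vec nc. M *\<^sub>v y = M *\<^sub>v y0 \<and> ls_point L M (M *\<^sub>v y0) w = L *\<^sub>v y"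
      using pt[OF w] w x T by (intro bexI[of _ "x + T *\<^sub>v w"]) auto
  next
    fix y assume y: "y \<in> carrier_vec nc" "M *\<^sub>v y = M *\<^sub>v y0"
    have "M *\<^sub>v (y - x) = 0\<^sub>v nr"
      using M x y y0 by (simp add: mult_minus_distrib_mat_vec[OF M])
    then have "T *\<^sub>v (y - x) = y - x" using T(3)[of "y - x"] x y by auto
    moreover have "x + (y - x) = y" using x y by auto
    ultimately show "\<exists>w\<in>carrier_vec nc. L *\<^sub>v y = ls_point L M (M *\<^sub>v y0) w"
      using pt[of "y - x"] x y by (intro bexI[of _ "y - x"]) auto
  qed
qed

lemma mat_eq_0_iff:
  fixes A :: "real mat"
  assumes A: "A \<in> carrier_mat nr nc"
  shows "A = 0\<^sub>m nr nc \<longleftrightarrow> (\<forall>v\<in>carrier_vec nc. A *\<^sub>v v = 0\<^sub>v nr)"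
proof safe
  assume *: "\<forall>v\<in>carrier_vec nc. A *\<^sub>v v = 0\<^sub>v nr"
  show "A = 0\<^sub>m nr nc"
  proof (rule eq_matI)
    fix i j assume ij: "i < dim_row (0\<^sub>m nr nc)" "j < dim_col (0\<^sub>m nr nc)"
    then have "(A *\<^sub>v unit_vec nc j) $ i = A $$ (i, j)" using A by auto
    with * ij show "A $$ (i, j) = 0\<^sub>m nr nc $$ (i, j)" by simp
  qed (use A in auto)
next
  fix v :: "real Matrix.vec" assume "v \<in> carrier_vec nc"
  then show "0\<^sub>m nr nc *\<^sub>v v = 0\<^sub>v nr" by (intro eq_vecI) simp_all
qed

text \<open>The range of \<open>T\<close> is exactly the kernel of \<open>M\<close>, so
  \<open>L T = 0\<close> says that the components selected by \<open>L\<close> are zero on that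
  kernel.\<close>

lemma ls_freedom_eq_0_iff:
  assumes M: "M \<in> carrier_mat nr nc" and L: "L \<in> carrier_mat k nc"
  shows "ls_freedom L M = 0\<^sub>m k nc \<longleftrightarrow>
     (\<forall>v\<in>carrier_vec nc. M *\<^sub>v v = 0\<^sub>v nr \<longrightarrow> L *\<^sub>v v = 0\<^sub>v k)"
proof -
  define T where "T = 1\<^sub>m nc - mp_inverse (transpose_mat M * M) * (transpose_mat M * M)"
  note T = gram_projection[OF M, folded T_def]
  have "ls_freedom L M = L * T" using M by (simp add: ls_freedom_def T_def Let_def)
  moreover have "L * T \<in> carrier_mat k nc" using L T by simp
  ultimately have "ls_freedom L M = 0\<^sub>m k nc \<longleftrightarrow> (\<forall>v\<in>carrier_vec nc. L *\<^sub>v (T *\<^sub>v v) = 0\<^sub>v k)"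
    using mat_eq_0_iff[of "L * T" k nc] L T(1) by (simp add: assoc_mult_mat_vec[of _ k nc])
  also have "\<dots> \<longleftrightarrow> (\<forall>v\<in>carrier_vec nc. M *\<^sub>v v = 0\<^sub>v nr \<longrightarrow> L *\<^sub>v v = 0\<^sub>v k)"
  proof safe
    fix v :: "real Matrix.vec"
    assume "\<forall>v\<in>carrier_vec nc. L *\<^sub>v (T *\<^sub>v v) = 0\<^sub>v k"
      and v: "v \<in> carrier_vec nc" "M *\<^sub>v v = 0\<^sub>v nr"
    then have "L *\<^sub>v (T *\<^sub>v v) = 0\<^sub>v k" by blast
    then show "L *\<^sub>v v = 0\<^sub>v k" by (simp only: T(3)[OF v])
  next
    fix v :: "real Matrix.vec"
    assume *: "\<forall>v\<in>carrier_vec nc. M *\<^sub>v v = 0\<^sub>v nr \<longrightarrow> L *\<^sub>v v = 0\<^sub>v k"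
      and v: "v \<in> carrier_vec nc"
    have "T *\<^sub>v v \<in> carrier_vec nc" using T(1) v by simp
    with * T(2)[OF v] show "L *\<^sub>v (T *\<^sub>v v) = 0\<^sub>v k" by blast
  qed
  finally show ?thesis .
qed

section \<open>Smooth maps and differential equations\<close>

lemma C1_onE:
  assumes "C1_on F X"
  obtains F' where "\<And>x. x \<in> X \<Longrightarrow> (F has_derivative blinfun_apply (F' x)) (at x)" "continuous_on X F'"
  using assms unfolding C1_on_def by blast

lemma C1_on_cong:
  assumes "open X" "\<And>x. x \<in> X \<Longrightarrow> F x = G x" "C1_on F X"
  shows "C1_on G X"
  using assms(3) unfolding C1_on_def
  by (meson assms(1,2) has_derivative_transform_within_open)

lemma C1_on_const: "C1_on (\<lambda>x. c) X"
  unfolding C1_on_def by (rule exI[of _ "\<lambda>x. 0"]) (auto intro!: derivative_eq_intros)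

lemma C1_on_add:
  assumes "C1_on F X" "C1_on G X"
  shows "C1_on (\<lambda>x. F x + G x) X"
proof -
  obtain F' where F': "\<And>x. x \<in> X \<Longrightarrow> (F has_derivative blinfun_apply (F' x)) (at x)" "continuous_on X F'"
    using assms(1) by (rule C1_onE) blast
  obtain G' where G': "\<And>x. x \<in> X \<Longrightarrow> (G has_derivative blinfun_apply (G' x)) (at x)" "continuous_on X G'"
    using assms(2) by (rule C1_onE) blast
  show ?thesis
    unfolding C1_on_def
    by (rule exI[of _ "\<lambda>x. F' x + G' x"])
      (use F' G' in \<open>auto intro!: has_derivative_add continuous_intros simp: plus_blinfun.rep_eq\<close>)
qed

lemma C1_on_scaleR_const:
  assumes "C1_on F X"
  shows "C1_on (\<lambda>x. c *\<^sub>R F x) X"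
proof -
  obtain F' where F': "\<And>x. x \<in> X \<Longrightarrow> (F has_derivative blinfun_apply (F' x)) (at x)" "continuous_on X F'"
    using assms by (rule C1_onE) blast
  show ?thesis
    unfolding C1_on_def
    by (rule exI[of _ "\<lambda>x. c *\<^sub>R F' x"])
      (use F' in \<open>auto intro!: has_derivative_scaleR_right continuous_intros simp: scaleR_blinfun.rep_eq\<close>)
qed

lemma C1_on_imp_continuous_on: "C1_on F X \<Longrightarrow> continuous_on X F"
  unfolding C1_on_def
  by (meson continuous_at_imp_continuous_on has_derivative_continuous)

lemma C2_onE:
  assumes "C2_on F X"
  obtains F' where "\<And>x. x \<in> X \<Longrightarrow> (F has_derivative blinfun_apply (F' x)) (at x)" "C1_on F' X"
  using assms unfolding C2_on_def by blast

lemma C2_on_const: "C2_on (\<lambda>x. c) X"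
  unfolding C2_on_def
  by (rule exI[of _ "\<lambda>x. 0"]) (auto intro!: derivative_eq_intros C1_on_const)

lemma C2_on_add:
  assumes "C2_on F X" "C2_on G X"
  shows "C2_on (\<lambda>x. F x + G x) X"
proof -
  obtain F' where F': "\<And>x. x \<in> X \<Longrightarrow> (F has_derivative blinfun_apply (F' x)) (at x)" "C1_on F' X"
    using assms(1) by (rule C2_onE) blast
  obtain G' where G': "\<And>x. x \<in> X \<Longrightarrow> (G has_derivative blinfun_apply (G' x)) (at x)" "C1_on G' X"
    using assms(2) by (rule C2_onE) blast
  show ?thesis
    unfolding C2_on_def
    by (rule exI[of _ "\<lambda>x. F' x + G' x"])
      (use F' G' in \<open>auto intro!: has_derivative_add C1_on_add simp: plus_blinfun.rep_eq\<close>)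
qed

lemma C2_on_scaleR_const:
  assumes "C2_on F X"
  shows "C2_on (\<lambda>x. c *\<^sub>R F x) X"
proof -
  obtain F' where F': "\<And>x. x \<in> X \<Longrightarrow> (F has_derivative blinfun_apply (F' x)) (at x)" "C1_on F' X"
    using assms by (rule C2_onE) blast
  show ?thesis
    unfolding C2_on_def
    by (rule exI[of _ "\<lambda>x. c *\<^sub>R F' x"])
      (use F' in \<open>auto intro!: has_derivative_scaleR_right C1_on_scaleR_const simp: scaleR_blinfun.rep_eq\<close>)
qed

lemma C2_on_sum:
  assumes "\<And>i. i \<in> I \<Longrightarrow> C2_on (F i) X"
  shows "C2_on (\<lambda>x. \<Sum>i\<in>I. F i x) X"
  using assms
  by (induction I rule: infinite_finite_induct) (auto intro!: C2_on_const C2_on_add)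

lemma C2_on_cong:
  assumes "open X" "\<And>x. x \<in> X \<Longrightarrow> F x = G x" "C2_on F X"
  shows "C2_on G X"
  using assms(3) unfolding C2_on_def
  by (meson assms(1,2) has_derivative_transform_within_open)

lemma C2_on_differentiable: "C2_on F X \<Longrightarrow> x \<in> X \<Longrightarrow> F differentiable (at x)"
  unfolding C2_on_def differentiable_def by blast

text \<open>The derivative \<open>at x\<close> sees a full neighbourhood, which openness supplies.
  It allows \<open>value_fun\<close> to be differentiated through the representation by
  \<open>phi\<close>, which holds on the state set alone.\<close>

lemma frechet_derivative_cong_open:
  assumes "open X" "x \<in> X" "\<And>y. y \<in> X \<Longrightarrow> F y = G y"
  shows "frechet_derivative F (at x) = frechet_derivative G (at x)"
proof -
  have "(F has_derivative D) (at x) \<longleftrightarrow> (G has_derivative D) (at x)" for D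
    using assms by (metis has_derivative_transform_within_open)
  then show ?thesis by (simp add: frechet_derivative_def)
qed

text \<open>The regularity needed for uniqueness of trajectories. Unlike \<open>C1_on\<close>, it
  passes to products by an elementary estimate, without a product rule for operator-valued
  derivatives.\<close>

definition locally_lipschitz :: "('a::real_normed_vector \<Rightarrow> 'b::real_normed_vector) \<Rightarrow> 'a set \<Rightarrow> bool" where
  "locally_lipschitz F X \<longleftrightarrow>
     (\<forall>p\<in>X. \<exists>d>0. \<exists>L\<ge>0. \<forall>y\<in>ball p d. \<forall>z\<in>ball p d. norm (F y - F z) \<le> L * norm (y - z))"

lemma locally_lipschitzE:
  assumes "locally_lipschitz F X" "p \<in> X"
  obtains d L where "d > 0" "L \<ge> 0"
    "\<And>y z. y \<in> ball p d \<Longrightarrow> z \<in> ball p d \<Longrightarrow> norm (F y - F z) \<le> L * norm (y - z)"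
  using assms unfolding locally_lipschitz_def by blast

text \<open>The mean value inequality on a ball, which is convex; by continuity the operator norm of
  the derivative exceeds its value at \<open>p\<close> by at most 1 on a small one.\<close>

lemma C1_on_imp_locally_lipschitz:
  assumes "open X" "C1_on F X"
  shows "locally_lipschitz F X"
  unfolding locally_lipschitz_def
proof
  fix p assume p: "p \<in> X"
  obtain F' where F': "\<And>x. x \<in> X \<Longrightarrow> (F has_derivative blinfun_apply (F' x)) (at x)" "continuous_on X F'"
    using assms(2) by (rule C1_onE) blast
  obtain e where e: "e > 0" "ball p e \<subseteq> X" using assms(1) p openE by blast
  obtain d where d: "d > 0" "\<And>x. x \<in> X \<Longrightarrow> dist x p < d \<Longrightarrow> dist (F' x) (F' p) < 1"
    using p continuous_on_iff[THEN iffD1, OF F'(2), rule_format, of p 1] by auto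
  define r where "r = min d e"
  have "norm (F y - F z) \<le> (norm (F' p) + 1) * norm (y - z)" if "y \<in> ball p r" "z \<in> ball p r" for y z
  proof (rule differentiable_bound[of "ball p r" F "\<lambda>x. blinfun_apply (F' x)"])
    fix x assume x: "x \<in> ball p r"
    then have xX: "x \<in> X" and "dist x p < d" using e by (auto simp: r_def dist_commute)
    then show "(F has_derivative blinfun_apply (F' x)) (at x within ball p r)"
      using F'(1) has_derivative_at_withinI by blast
    have "dist (F' x) (F' p) < 1" using d xX \<open>dist x p < d\<close> by blast
    then have "norm (F' x) \<le> norm (F' p) + 1"
      using norm_triangle_sub[of "F' x" "F' p"] by (simp add: dist_norm)
    then show "onorm (blinfun_apply (F' x)) \<le> norm (F' p) + 1" by (simp add: norm_blinfun.rep_eq)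
  qed (use that in auto)
  moreover have "r > 0" using d e by (simp add: r_def)
  ultimately show "\<exists>d>0. \<exists>L\<ge>0. \<forall>y\<in>ball p d. \<forall>z\<in>ball p d. norm (F y - F z) \<le> L * norm (y - z)"
    by (intro exI[of _ r] conjI exI[of _ "norm (F' p) + 1"]) auto
qed

lemma locally_lipschitz_const: "locally_lipschitz (\<lambda>x. c) X"
  unfolding locally_lipschitz_def
  by (rule ballI, rule exI[of _ 1], simp, rule exI[of _ 0], simp)

lemma locally_lipschitz_add:
  assumes "locally_lipschitz F X" "locally_lipschitz G X"
  shows "locally_lipschitz (\<lambda>x. F x + G x) X"
  unfolding locally_lipschitz_def
proof
  fix p assume p: "p \<in> X"
  obtain d L where F: "d > 0" "L \<ge> 0"
    "\<And>y z. y \<in> ball p d \<Longrightarrow> z \<in> ball p d \<Longrightarrow> norm (F y - F z) \<le> L * norm (y - z)"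
    using assms(1) p by (rule locally_lipschitzE) blast
  obtain e K where G: "e > 0" "K \<ge> 0"
    "\<And>y z. y \<in> ball p e \<Longrightarrow> z \<in> ball p e \<Longrightarrow> norm (G y - G z) \<le> K * norm (y - z)"
    using assms(2) p by (rule locally_lipschitzE) blast
  have "norm (F y + G y - (F z + G z)) \<le> (L + K) * norm (y - z)"
    if "y \<in> ball p (min d e)" "z \<in> ball p (min d e)" for y z
  proof -
    have "norm (F y + G y - (F z + G z)) \<le> norm (F y - F z) + norm (G y - G z)"
      by (metis add_diff_add norm_triangle_ineq)
    also have "\<dots> \<le> L * norm (y - z) + K * norm (y - z)"
      using that by (intro add_mono F(3) G(3)) auto
    finally show ?thesis by (simp add: distrib_right)
  qed
  then show "\<exists>d>0. \<exists>L\<ge>0. \<forall>y\<in>ball p d. \<forall>z\<in>ball p d.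
      norm (F y + G y - (F z + G z)) \<le> L * norm (y - z)"
    using F(1,2) G(1,2) by (intro exI[of _ "min d e"] conjI exI[of _ "L + K"]) auto
qed

lemma locally_lipschitz_sum:
  assumes "\<And>i. i \<in> I \<Longrightarrow> locally_lipschitz (F i) X"
  shows "locally_lipschitz (\<lambda>x. \<Sum>i\<in>I. F i x) X"
  using assms
  by (induction I rule: infinite_finite_induct)
    (auto intro!: locally_lipschitz_const locally_lipschitz_add)

lemma locally_lipschitz_scaleR:
  fixes f :: "'a::real_normed_vector \<Rightarrow> real"
  assumes "locally_lipschitz f X" "locally_lipschitz G X"
  shows "locally_lipschitz (\<lambda>x. f x *\<^sub>R G x) X"
  unfolding locally_lipschitz_def
proof
  fix p assume p: "p \<in> X"
  obtain d L where F: "d > 0" "L \<ge> 0"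
    "\<And>y z. y \<in> ball p d \<Longrightarrow> z \<in> ball p d \<Longrightarrow> norm (f y - f z) \<le> L * norm (y - z)"
    using assms(1) p by (rule locally_lipschitzE) blast
  obtain e K where G: "e > 0" "K \<ge> 0"
    "\<And>y z. y \<in> ball p e \<Longrightarrow> z \<in> ball p e \<Longrightarrow> norm (G y - G z) \<le> K * norm (y - z)"
    using assms(2) p by (rule locally_lipschitzE) blast
  \<comment> \<open>Bounds for the two factors on the ball: the norm at the centre plus Lipschitz
    constant times radius. They control the usual splitting of a difference of products.\<close>
  define A B where "A = norm (f p) + L * d" and "B = norm (G p) + K * e"
  have AB: "A \<ge> 0" "B \<ge> 0" using F G by (auto simp: A_def B_def)
  have "norm (f y *\<^sub>R G y - f z *\<^sub>R G z) \<le> (A * K + L * B) * norm (y - z)"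
    if "y \<in> ball p (min d e)" "z \<in> ball p (min d e)" for y z
  proof -
    have "norm (f y) \<le> norm (f p) + norm (f y - f p)" by (rule norm_triangle_sub)
    also have "norm (f y - f p) \<le> L * norm (y - p)" using that F by auto
    also have "\<dots> \<le> L * d"
      using that F by (intro mult_left_mono) (auto simp: dist_norm norm_minus_commute)
    finally have fy: "norm (f y) \<le> A" by (simp add: A_def)
    have "norm (G z) \<le> norm (G p) + norm (G z - G p)" by (rule norm_triangle_sub)
    also have "norm (G z - G p) \<le> K * norm (z - p)" using that G by auto
    also have "\<dots> \<le> K * e"
      using that G by (intro mult_left_mono) (auto simp: dist_norm norm_minus_commute)
    finally have Gz: "norm (G z) \<le> B" by (simp add: B_def)
    have "f y *\<^sub>R G y - f z *\<^sub>R G z = f y *\<^sub>R (G y - G z) + (f y - f z) *\<^sub>R G z"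
      by (simp add: algebra_simps)
    also have "norm \<dots> \<le> norm (f y) * norm (G y - G z) + norm (f y - f z) * norm (G z)"
      by (metis norm_scaleR norm_triangle_ineq real_norm_def)
    also have "\<dots> \<le> A * (K * norm (y - z)) + (L * norm (y - z)) * B"
      using that fy Gz AB F(2) by (intro add_mono mult_mono F(3) G(3)) auto
    finally show ?thesis by (simp add: algebra_simps)
  qed
  then show "\<exists>d>0. \<exists>L\<ge>0. \<forall>y\<in>ball p d. \<forall>z\<in>ball p d.
      norm (f y *\<^sub>R G y - f z *\<^sub>R G z) \<le> L * norm (y - z)"
    using F G AB by (intro exI[of _ "min d e"] conjI exI[of _ "A * K + L * B"]) auto
qed

text \<open>A Gronwall argument started at the last time of agreement. Shortly afterwards both
  solutions are still in one Lipschitz ball, where a suitably weighted squared distance cannot grow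
  from 0.\<close>

lemma ode_solution_unique:
  fixes F :: "'a::real_inner \<Rightarrow> 'a"
  assumes F: "locally_lipschitz F X"
    and x: "\<And>t. t \<ge> t0 \<Longrightarrow> x t \<in> X \<and> (x has_vector_derivative F (x t)) (at t within {t0..})"
    and y: "\<And>t. t \<ge> t0 \<Longrightarrow> y t \<in> X \<and> (y has_vector_derivative F (y t)) (at t within {t0..})"
    and init: "x t0 = y t0" and t: "t \<ge> t0"
  shows "x t = y t"
proof (rule ccontr)
  assume neq: "x t \<noteq> y t"
  have contx: "continuous_on {t0..} x" and conty: "continuous_on {t0..} y"
    using x y by (auto simp: continuous_on_eq_continuous_within intro: has_vector_derivative_continuous)
  \<comment> \<open>All times of agreement, not just an initial interval of them: the set is closed,
    so its supremum \<open>s\<close> is again a time of agreement, and nothing after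
    \<open>s\<close> is.\<close>
  define A where "A = {s \<in> {t0..t}. x s - y s = 0}"
  have "closed A"
    unfolding A_def
    by (intro continuous_closed_preimage_constant continuous_on_diff
        continuous_on_subset[OF contx] continuous_on_subset[OF conty]) auto
  moreover have "t0 \<in> A" "bdd_above A" using init t by (auto simp: A_def)
  ultimately have "Sup A \<in> A" using closed_contains_Sup by blast
  define s where "s = Sup A"
  have s: "t0 \<le> s" "s \<le> t" "x s = y s" using \<open>Sup A \<in> A\<close> by (auto simp: A_def s_def)
  then have "s < t" using neq by (cases "s = t") auto
  have upper: "r \<le> s" if "r \<in> A" for r
    unfolding s_def using that \<open>bdd_above A\<close> by (rule cSup_upper)
  obtain d L where d: "d > 0" "L \<ge> 0"
    "\<And>u v. u \<in> ball (x s) d \<Longrightarrow> v \<in> ball (x s) d \<Longrightarrow> norm (F u - F v) \<le> L * norm (u - v)"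
    using F x[OF s(1)] by (elim locally_lipschitzE[of F X "x s"]) auto
  obtain e1 where e1: "e1 > 0" "\<And>r. r \<ge> t0 \<Longrightarrow> dist r s < e1 \<Longrightarrow> dist (x r) (x s) < d"
    using s(1) d(1) continuous_on_iff[THEN iffD1, OF contx, rule_format, of s d] by auto
  obtain e2 where e2: "e2 > 0" "\<And>r. r \<ge> t0 \<Longrightarrow> dist r s < e2 \<Longrightarrow> dist (y r) (y s) < d"
    using s(1) d(1) continuous_on_iff[THEN iffD1, OF conty, rule_format, of s d] by auto
  \<comment> \<open>The half keeps \<open>b\<close> strictly inside both continuity radii.\<close>
  define b where "b = min t (s + min e1 e2 / 2)"
  have b: "s < b" "b \<le> t" "b - s < e1" "b - s < e2"
    using \<open>s < t\<close> e1(1) e2(1) by (auto simp: b_def min_def)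
  \<comment> \<open>The derivative of the squared distance is at most \<open>2 * L\<close> times
    itself; the exponential weight cancels exactly this growth.\<close>
  define g where "g r = exp (- 2 * L * r) * inner (x r - y r) (x r - y r)" for r
  have "g b \<le> g s"
  proof (rule DERIV_nonpos_imp_decreasing_open[OF less_imp_le[OF b(1)]])
    fix r assume r: "s < r" "r < b"
    then have rt: "r > t0" using s by simp
    then have at: "at r within {t0..} = at r" by (intro at_within_interior) simp
    have dx: "(x has_vector_derivative F (x r)) (at r)" and dy: "(y has_vector_derivative F (y r)) (at r)"
      using x[of r] y[of r] rt at by auto
    have in_ball: "x r \<in> ball (x s) d" "y r \<in> ball (x s) d"
      using e1(2)[of r] e2(2)[of r] r rt b s(3) by (auto simp: dist_commute dist_real_def)
    define w where "w = x r - y r"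
    define f where "f = F (x r) - F (y r)"
    have dw: "((\<lambda>r. x r - y r) has_vector_derivative f) (at r)"
      unfolding f_def by (intro has_vector_derivative_diff dx dy)
    have "((\<lambda>r. inner (x r - y r) (x r - y r)) has_real_derivative inner w f + inner f w) (at r)"
      using bounded_bilinear.has_vector_derivative[OF bounded_bilinear_inner dw dw]
      by (simp add: w_def has_real_derivative_iff_has_vector_derivative)
    then have "(g has_real_derivative
        exp (- 2 * L * r) * (inner w f + inner f w) + (exp (- 2 * L * r) * (- 2 * L)) * inner w w) (at r)"
      unfolding g_def by (auto intro!: derivative_eq_intros simp: w_def)
    moreover have "inner w f + inner f w \<le> 2 * L * inner w w"
    proof -
      have "inner w f \<le> norm w * norm f" by (rule norm_cauchy_schwarz)
      also have "\<dots> \<le> norm w * (L * norm w)"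
        using d(3)[OF in_ball] by (intro mult_left_mono) (auto simp: w_def f_def)
      finally show ?thesis
        by (simp add: inner_commute dot_square_norm power2_eq_square algebra_simps)
    qed
    then have "exp (- 2 * L * r) * (inner w f + inner f w) \<le> exp (- 2 * L * r) * (2 * L * inner w w)"
      by (intro mult_left_mono) auto
    ultimately show "\<exists>D. (g has_real_derivative D) (at r) \<and> D \<le> 0"
      by (intro exI conjI) (assumption, simp)
  next
    show "continuous_on {s..b} g"
      unfolding g_def using s
      by (intro continuous_intros continuous_on_subset[OF contx] continuous_on_subset[OF conty]) auto
  qed
  also have "g s = 0" using s by (simp add: g_def)
  finally have "inner (x b - y b) (x b - y b) \<le> 0"
    by (simp add: g_def mult_le_0_iff)
  then have "x b - y b = 0" by (metis inner_eq_zero_iff inner_ge_zero order_antisym)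
  then have "b \<in> A" using b s by (simp add: A_def)
  then show False using upper b by fastforce
qed

text \<open>The gauge integral over an unbounded set is a limit over large boxes, with no absolute
  integrability involved. A box that starts at or below \<open>a\<close> meets the half-line in an
  interval from \<open>a\<close> to \<open>T\<close>.\<close>

lemma integral_at_top_tendsto:
  fixes f :: "real \<Rightarrow> real"
  assumes "f integrable_on {a..}"
  shows "((\<lambda>T. integral {a..T} f) \<longlongrightarrow> integral {a..} f) at_top"
proof (rule tendstoI)
  fix e :: real assume e: "e > 0"
  have "(f has_integral integral {a..} f) {a..}" using assms by blast
  then obtain B where B: "B > 0" "\<And>c d. ball 0 B \<subseteq> cbox c d \<Longrightarrow>
      \<exists>z. ((\<lambda>x. if x \<in> {a..} then f x else 0) has_integral z) (cbox c d) \<and> norm (z - integral {a..} f) < e"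
    using e unfolding has_integral'[of f] by metis
  have "dist (integral {a..T} f) (integral {a..} f) < e" if T: "T \<ge> max a B" for T
  proof -
    \<comment> \<open>Low enough for the box to contain the ball of radius \<open>B\<close>, and not
      above \<open>a\<close>, so that nothing of the interval from \<open>a\<close> to
      \<open>T\<close> is cut off.\<close>
    define c where "c = min a (- B)"
    have "ball 0 B \<subseteq> cbox c T" using T by (auto simp: c_def dist_real_def)
    from B(2)[OF this] obtain z where
      z: "((\<lambda>x. if x \<in> {a..} then f x else 0) has_integral z) (cbox c T)" "norm (z - integral {a..} f) < e"
      by blast
    have "((\<lambda>x. if x \<in> {a..T} then f x else 0) has_integral z) (cbox c T)"
      by (rule has_integral_eq[OF _ z(1)]) auto
    then have "(f has_integral z) {a..T}"
      by (subst (asm) has_integral_restrict) (auto simp: c_def)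
    then have "integral {a..T} f = z" by (rule integral_unique)
    then show ?thesis using z(2) by (simp add: dist_norm)
  qed
  then show "\<forall>\<^sub>F T in at_top. dist (integral {a..T} f) (integral {a..} f) < e"
    using eventually_at_top_linorder by blast
qed

section \<open>Values, the HJB equation and optimality\<close>

lemma closed_loop_cong:
  "(\<And>j. j < players S \<Longrightarrow> \<mu> j x = \<nu> j x) \<Longrightarrow> closed_loop S \<mu> x = closed_loop S \<nu> x"
  by (simp add: closed_loop_def)

text \<open>Solutions never leave \<open>states S\<close>, so what the strategies do elsewhere does
  not reach the differential equation.\<close>

lemma solution_cong:
  assumes "\<And>j x. j < players S \<Longrightarrow> x \<in> states S \<Longrightarrow> \<mu> j x = \<nu> j x"
  shows "solution S \<mu> = solution S \<nu>"
  using closed_loop_cong[of S \<mu> _ \<nu>] assms by (fastforce simp: solution_def fun_eq_iff)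

text \<open>Both choices are made from the same predicate, so the very same trajectory is selected;
  uniqueness of solutions is not involved.\<close>

lemma trajectory_cong:
  assumes "\<And>j x. j < players S \<Longrightarrow> x \<in> states S \<Longrightarrow> \<mu> j x = \<nu> j x"
  shows "trajectory S \<mu> = trajectory S \<nu>"
  by (simp add: trajectory_def fun_eq_iff solution_cong[OF assms])

lemma stabilizing_cong:
  assumes "\<And>j x. j < players S \<Longrightarrow> x \<in> states S \<Longrightarrow> \<mu> j x = \<nu> j x"
  shows "stabilizing S \<mu> = stabilizing S \<nu>"
  by (simp add: stabilizing_def solution_cong[OF assms])

lemma solution_trajectory:
  "stabilizing S \<mu> \<Longrightarrow> x0 \<in> states S \<Longrightarrow> solution S \<mu> x0 (trajectory S \<mu> x0)"
  unfolding stabilizing_def trajectory_def by (metis someI_ex)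

lemma trajectory_in_states:
  "stabilizing S \<mu> \<Longrightarrow> x0 \<in> states S \<Longrightarrow> time0 S \<le> t \<Longrightarrow> trajectory S \<mu> x0 t \<in> states S"
  using solution_trajectory by (auto simp: solution_def)

lemma trajectory_tendsto_0:
  "stabilizing S \<mu> \<Longrightarrow> x0 \<in> states S \<Longrightarrow> (trajectory S \<mu> x0 \<longlongrightarrow> 0) at_top"
  using solution_trajectory[of S \<mu> x0] unfolding stabilizing_def by blast

text \<open>Changing the profile off the state set and rescaling the cost are treated together,
  because the identified profile always meets scaled parameters. The transfer is used in both
  directions, with factors \<open>c\<close> and \<open>1 / c\<close>.\<close>

context
  fixes S :: "'s::real_normed_vector dsystem" and \<mu> \<nu> :: "'s profile" and c :: real
    and q q' :: "'s \<Rightarrow> real" and r r' :: "nat \<Rightarrow> real mat"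
  assumes agree: "\<And>j x. j < players S \<Longrightarrow> x \<in> states S \<Longrightarrow> \<mu> j x = \<nu> j x"
    and cost: "\<And>x. x \<in> states S \<Longrightarrow> running_cost S q' r' \<nu> x = c * running_cost S q r \<mu> x"
begin

lemma trajectory_agree: "trajectory S \<nu> = trajectory S \<mu>"
  by (rule trajectory_cong[symmetric]) (rule agree)

lemma stabilizing_agree: "stabilizing S \<nu> = stabilizing S \<mu>"
  by (rule stabilizing_cong[symmetric]) (rule agree)

lemma value_fun_scale:
  assumes "stabilizing S \<mu>" "x0 \<in> states S"
  shows "value_fun S q' r' \<nu> x0 = c * value_fun S q r \<mu> x0"
proof -
  have "value_fun S q' r' \<nu> x0 =
      integral {time0 S..} (\<lambda>t. c * running_cost S q r \<mu> (trajectory S \<mu> x0 t))"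
    unfolding value_fun_def trajectory_agree
    by (intro integral_cong cost) (use trajectory_in_states[OF assms] in auto)
  then show ?thesis by (simp add: value_fun_def)
qed

text \<open>Admissibility prescribes the dimension of the controls at every \<open>x\<close>, on
  which agreement on the state set is silent; therefore \<open>carrier\<close> is a separate
  assumption.\<close>

lemma admissible_scale:
  assumes "i < players S" "open (states S)" "0 \<in> states S"
    and carrier: "\<And>x. \<nu> i x \<in> carrier_vec (udim S i)"
    and adm: "admissible S q r i \<mu>"
  shows "admissible S q' r' i \<nu>"
proof -
  have st: "stabilizing S \<mu>" using adm by (simp add: admissible_def)
  have "C1_on (\<lambda>x. \<nu> i x $ k) (states S)" if "k < udim S i" for k
    by (rule C1_on_cong[of _ "\<lambda>x. \<mu> i x $ k"]) (use assms that agree in \<open>auto simp: admissible_def\<close>)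
  moreover have "(\<lambda>t. running_cost S q' r' \<nu> (trajectory S \<nu> x0 t)) integrable_on {time0 S..}"
    if x0: "x0 \<in> states S" for x0
  proof (rule integrable_eq[of "\<lambda>t. c * running_cost S q r \<mu> (trajectory S \<mu> x0 t)"])
    show "(\<lambda>t. c * running_cost S q r \<mu> (trajectory S \<mu> x0 t)) integrable_on {time0 S..}"
      using adm x0 by (intro integrable_on_mult_right) (auto simp: admissible_def)
  qed (use trajectory_in_states[OF st x0] in \<open>auto simp: cost trajectory_agree\<close>)
  moreover have "C2_on (\<lambda>x. c *\<^sub>R value_fun S q r \<mu> x) (states S)"
    using adm by (intro C2_on_scaleR_const) (simp add: admissible_def)
  then have "C2_on (value_fun S q' r' \<nu>) (states S)"
    by (rule C2_on_cong[rotated -1]) (use assms value_fun_scale[OF st] in auto)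
  moreover have "\<nu> i 0 = 0\<^sub>v (udim S i)"
    using agree[OF assms(1,3)] adm by (simp add: admissible_def)
  ultimately show ?thesis
    using carrier st stabilizing_agree by (simp add: admissible_def)
qed

end

text \<open>Stability keeps the trajectory that starts at the origin there: a nonzero norm reached
  at some time could be taken as \<epsilon>, and the initial state 0 is within every
  \<delta>.\<close>

lemma value_fun_0:
  assumes "stabilizing S \<mu>" "0 \<in> states S" "running_cost S q r \<mu> 0 = 0"
  shows "value_fun S q r \<mu> 0 = 0"
proof -
  have "trajectory S \<mu> 0 t = 0" if t: "t \<ge> time0 S" for t
  proof (rule ccontr)
    assume "trajectory S \<mu> 0 t \<noteq> 0"
    then have "norm (trajectory S \<mu> 0 t) > 0" by simp
    then obtain \<delta> where "\<delta> > 0" "\<forall>x0\<in>states S. \<forall>x. norm x0 < \<delta> \<longrightarrow> solution S \<mu> x0 x \<longrightarrow>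
        (\<forall>s\<ge>time0 S. norm (x s) < norm (trajectory S \<mu> 0 t))"
      using assms(1) unfolding stabilizing_def by meson
    then show False using assms(2) solution_trajectory[OF assms(1,2)] t by fastforce
  qed
  then have "value_fun S q r \<mu> 0 = integral {time0 S..} (\<lambda>t. 0)"
    unfolding value_fun_def using assms(3) by (intro integral_cong) auto
  then show ?thesis by simp
qed

text \<open>The fundamental theorem of calculus along a trajectory. The chain rule is applied within
  the interval, since at \<open>time0 S\<close> only a one-sided derivative is available.\<close>

lemma solution_has_integral:
  fixes V :: "'s::real_normed_vector \<Rightarrow> real"
  assumes sol: "solution S \<mu> x0 x" and V: "\<And>y. y \<in> states S \<Longrightarrow> V differentiable (at y)"
    and T: "T \<ge> time0 S"
  shows "((\<lambda>t. frechet_derivative V (at (x t)) (closed_loop S \<mu> (x t))) has_integral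
     (V (x T) - V x0)) {time0 S..T}"
proof -
  have "((\<lambda>t. V (x t)) has_vector_derivative frechet_derivative V (at (x t)) (closed_loop S \<mu> (x t)))
      (at t within {time0 S..T})" if t: "t \<in> {time0 S..T}" for t
  proof -
    have xt: "x t \<in> states S" "(x has_vector_derivative closed_loop S \<mu> (x t)) (at t within {time0 S..T})"
      using sol t by (auto simp: solution_def intro: has_vector_derivative_within_subset)
    have "(V has_derivative frechet_derivative V (at (x t))) (at (x t) within x ` {time0 S..T})"
      using V[OF xt(1)] frechet_derivative_works has_derivative_at_withinI by blast
    from vector_derivative_diff_chain_within[OF xt(2) this] show ?thesis by (simp add: o_def)
  qed
  from fundamental_theorem_of_calculus[OF T this]
  show ?thesis using sol by (simp add: solution_def)
qed

lemma solution_continuous_on: "solution S \<mu> x0 x \<Longrightarrow> continuous_on {time0 S..} x"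
  by (auto simp: solution_def continuous_on_eq_continuous_within intro: has_vector_derivative_continuous)

lemma HJB_eq_iff:
  "HJB_eq S q r \<mu> V \<longleftrightarrow>
     (\<forall>x\<in>states S. frechet_derivative V (at x) (closed_loop S \<mu> x) = - running_cost S q r \<mu> x)"
  by (auto simp: HJB_eq_def running_cost_def algebra_simps eq_neg_iff_add_eq_0)

text \<open>Here \<open>g\<close> is the residual of the HJB equation for a function
  \<open>V\<close> that need not be the value of \<open>\<mu>\<close>. With \<open>g = 0\<close>
  this identifies \<open>V\<close> as the value; with \<open>\<mu>\<close> a deviating profile and
  \<open>V\<close> the optimal value, \<open>g\<close> is the completed square.\<close>

context
  fixes S :: "'s::real_normed_vector dsystem" and \<mu> :: "'s profile" and V g :: "'s \<Rightarrow> real"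
    and q :: "'s \<Rightarrow> real" and r :: "nat \<Rightarrow> real mat" and x0 :: 's
  assumes st: "stabilizing S \<mu>" and zero: "0 \<in> states S" and x0: "x0 \<in> states S"
    and V: "\<And>y. y \<in> states S \<Longrightarrow> V differentiable (at y)" and V0: "V 0 = 0"
    and int: "(\<lambda>t. running_cost S q r \<mu> (trajectory S \<mu> x0 t)) integrable_on {time0 S..}"
    and res: "\<And>y. y \<in> states S \<Longrightarrow>
      frechet_derivative V (at y) (closed_loop S \<mu> y) + running_cost S q r \<mu> y = g y"
begin

text \<open>Integrated up to time \<open>T\<close>, the residual is the increment of
  \<open>V\<close> plus the accumulated cost. The trajectory tends to the origin, where
  \<open>V\<close> is continuous and zero, and the cost tends to the value. Only a limit is claimed,
  not integrability of \<open>g\<close> on the half-line.\<close>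

lemma residual_integral_tendsto:
  "((\<lambda>T. integral {time0 S..T} (\<lambda>t. g (trajectory S \<mu> x0 t))) \<longlongrightarrow> value_fun S q r \<mu> x0 - V x0) at_top"
proof -
  define x where "x = trajectory S \<mu> x0"
  define t0 where "t0 = time0 S"
  define C where "C t = running_cost S q r \<mu> (x t)" for t
  have sol: "solution S \<mu> x0 x" using solution_trajectory[OF st x0] by (simp add: x_def)
  have xs: "x t \<in> states S" if "t \<ge> t0" for t
    using sol that by (auto simp: solution_def t0_def)
  have Cint: "C integrable_on {t0..T}" for T
    using int unfolding C_def x_def t0_def
    by (rule integrable_on_subinterval) auto
  have eq: "integral {t0..T} (\<lambda>t. g (x t)) = V (x T) - V x0 + integral {t0..T} C" if T: "T \<ge> t0" for T
  proof (rule integral_unique)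
    have "((\<lambda>t. frechet_derivative V (at (x t)) (closed_loop S \<mu> (x t)) + C t) has_integral
        (V (x T) - V x0 + integral {t0..T} C)) {t0..T}"
      using solution_has_integral[OF sol V] Cint T
      by (intro has_integral_add) (auto simp: t0_def)
    then show "((\<lambda>t. g (x t)) has_integral (V (x T) - V x0 + integral {t0..T} C)) {t0..T}"
      by (rule has_integral_eq[rotated]) (auto simp: C_def intro!: res xs)
  qed
  have lim_V: "((\<lambda>T. V (x T)) \<longlongrightarrow> V 0) at_top"
    using trajectory_tendsto_0[OF st x0] differentiable_imp_continuous_within[OF V[OF zero]]
    by (intro isCont_tendsto_compose[of _ V]) (auto simp: x_def)
  have lim_C: "((\<lambda>T. integral {t0..T} C) \<longlongrightarrow> value_fun S q r \<mu> x0) at_top"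
    using integral_at_top_tendsto[OF int] by (simp add: value_fun_def C_def[abs_def] x_def t0_def)
  have "((\<lambda>T. V (x T) - V x0 + integral {t0..T} C) \<longlongrightarrow> V 0 - V x0 + value_fun S q r \<mu> x0) at_top"
    by (intro tendsto_intros lim_V lim_C)
  moreover have "\<forall>\<^sub>F T in at_top. V (x T) - V x0 + integral {t0..T} C = integral {t0..T} (\<lambda>t. g (x t))"
    using eventually_ge_at_top[of t0] by eventually_elim (simp add: eq)
  ultimately have "((\<lambda>T. integral {t0..T} (\<lambda>t. g (x t))) \<longlongrightarrow> V 0 - V x0 + value_fun S q r \<mu> x0) at_top"
    by (rule Lim_transform_eventually)
  then show ?thesis using V0 by (simp add: x_def t0_def)
qed

text \<open>For nonnegative \<open>g\<close> the integrals increase to a limit that is at most 0 by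
  \<open>le\<close>, so already the one over the first unit of time is zero. Continuity then gives
  \<open>g = 0\<close> along that piece of the trajectory, in particular at its start.\<close>

lemma residual_vanishes:
  assumes g: "\<And>y. y \<in> states S \<Longrightarrow> 0 \<le> g y" "continuous_on (states S) g"
    and le: "value_fun S q r \<mu> x0 \<le> V x0"
  shows "g x0 = 0"
proof -
  define x where "x = trajectory S \<mu> x0"
  define t0 where "t0 = time0 S"
  have sol: "solution S \<mu> x0 x" using solution_trajectory[OF st x0] by (simp add: x_def)
  have xs: "x t \<in> states S" if "t \<ge> t0" for t
    using sol that by (auto simp: solution_def t0_def)
  have cont: "continuous_on {t0..T} (\<lambda>t. g (x t))" for T
  proof (rule continuous_on_compose2[OF g(2)])
    show "continuous_on {t0..T} x"
      by (rule continuous_on_subset[OF solution_continuous_on[OF sol]]) (auto simp: t0_def)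
  qed (use xs in auto)
  have mono: "integral {t0..T} (\<lambda>t. g (x t)) \<le> integral {t0..T'} (\<lambda>t. g (x t))" if "T \<le> T'" for T T'
    by (rule integral_subset_le) (use that cont g xs in \<open>auto intro!: integrable_continuous_interval\<close>)
  have ge: "integral {t0..T} (\<lambda>t. g (x t)) \<le> value_fun S q r \<mu> x0 - V x0" for T
  proof (rule tendsto_lowerbound[OF residual_integral_tendsto[folded x_def t0_def]])
    show "\<forall>\<^sub>F T' in at_top. integral {t0..T} (\<lambda>t. g (x t)) \<le> integral {t0..T'} (\<lambda>t. g (x t))"
      using eventually_ge_at_top[of T] by eventually_elim (rule mono)
  qed simp
  have nonneg: "0 \<le> integral {t0..T} (\<lambda>t. g (x t))" for T
    using g xs by (intro integral_nonneg integrable_continuous_interval cont) auto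
  have "integral {t0..t0 + 1} (\<lambda>t. g (x t)) = 0"
    using ge[of "t0 + 1"] nonneg[of "t0 + 1"] le by linarith
  then have "\<forall>t\<in>{t0..t0 + 1}. g (x t) = 0"
    using integral_eq_0_iff[OF cont[of "t0 + 1"]] g xs by auto
  then have "g (x t0) = 0" by auto
  moreover have "x t0 = x0" using sol by (simp add: solution_def t0_def)
  ultimately show "g x0 = 0" by simp
qed

end

lemma HJB_eq_imp_value:
  fixes S :: "'s::real_normed_vector dsystem"
  assumes adm: "admissible S q r i \<mu>" and zero: "0 \<in> states S" and x0: "x0 \<in> states S"
    and V: "\<And>y. y \<in> states S \<Longrightarrow> V differentiable (at y)" and V0: "V 0 = 0"
    and HJB: "HJB_eq S q r \<mu> V"
  shows "V x0 = value_fun S q r \<mu> x0"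
proof -
  have "((\<lambda>T. integral {time0 S..T} (\<lambda>t. 0)) \<longlongrightarrow> value_fun S q r \<mu> x0 - V x0) at_top"
    by (rule residual_integral_tendsto)
      (use adm zero x0 V V0 HJB in \<open>auto simp: admissible_def HJB_eq_iff\<close>)
  then show ?thesis by (simp add: tendsto_const_iff)
qed

section \<open>Unilateral deviations and completing the square\<close>

lemma diagonal_quadratic_form:
  fixes A :: "real mat"
  assumes A: "A \<in> carrier_mat n n" "diagonal_mat A" and v: "v \<in> carrier_vec n"
  shows "v \<bullet> (A *\<^sub>v v) = (\<Sum>k<n. A $$ (k, k) * (v $ k * v $ k))"
proof -
  have "(A *\<^sub>v v) $ k = A $$ (k, k) * v $ k" if k: "k < n" for k
  proof -
    have "(A *\<^sub>v v) $ k = (\<Sum>j<n. A $$ (k, j) * v $ j)"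
      using k A v by (simp add: scalar_prod_def lessThan_atLeast0)
    also have "\<dots> = (\<Sum>j<n. if j = k then A $$ (k, k) * v $ k else 0)"
      using A k by (intro sum.cong) (auto simp: diagonal_mat_def)
    finally show ?thesis using k by simp
  qed
  then show ?thesis
    using A v by (simp add: scalar_prod_def lessThan_atLeast0 mult.left_commute)
qed

lemma closed_loop_update:
  assumes "i < players S"
  shows "closed_loop S (\<mu>(i := \<nu>)) x = closed_loop S \<mu> x
     + (\<Sum>k<udim S i. (\<nu> x $ k - \<mu> i x $ k) *\<^sub>R input_col S i x k)"
proof -
  have "(\<Sum>j<players S. \<Sum>k<udim S j. ((\<mu>(i := \<nu>)) j x $ k) *\<^sub>R input_col S j x k) =
    (\<Sum>j<players S. (\<Sum>k<udim S j. (\<mu> j x $ k) *\<^sub>R input_col S j x k) +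
      (if j = i then \<Sum>k<udim S i. (\<nu> x $ k - \<mu> i x $ k) *\<^sub>R input_col S i x k else 0))"
    by (intro sum.cong) (auto simp: sum.distrib[symmetric] algebra_simps)
  then show ?thesis using assms by (simp add: closed_loop_def sum.distrib)
qed

lemma running_cost_update:
  assumes "i < players S"
  shows "running_cost S q r (\<mu>(i := \<nu>)) x = running_cost S q r \<mu> x
     + (\<nu> x \<bullet> (r i *\<^sub>v \<nu> x) - \<mu> i x \<bullet> (r i *\<^sub>v \<mu> i x))"
proof -
  have "(\<Sum>j<players S. (\<mu>(i := \<nu>)) j x \<bullet> (r j *\<^sub>v (\<mu>(i := \<nu>)) j x)) =
    (\<Sum>j<players S. \<mu> j x \<bullet> (r j *\<^sub>v \<mu> j x) +
      (if j = i then \<nu> x \<bullet> (r i *\<^sub>v \<nu> x) - \<mu> i x \<bullet> (r i *\<^sub>v \<mu> i x) else 0))"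
    by (intro sum.cong) auto
  then show ?thesis using assms by (simp add: running_cost_def sum.distrib)
qed

text \<open>By \<open>grad\<close>, the change of the drift term is linear in the deviation with
  coefficients \<open>- 2 * r * \<mu>\<close>; added to the difference of the quadratic costs it
  leaves \<open>r * (\<nu> - \<mu>)^2\<close> in each component. The \<open>HJB\<close> assumption
  removes the terms that do not depend on \<nu>.\<close>

lemma hamiltonian_residual:
  assumes i: "i < players S" and x: "x \<in> states S" and V: "V differentiable (at x)"
    and HJB: "HJB_eq S q r \<mu> V"
    and r: "r i \<in> carrier_mat (udim S i) (udim S i)" "diagonal_mat (r i)"
    and grad: "\<And>k. k < udim S i \<Longrightarrow> input_grad S i V x $ k = - 2 * (r i $$ (k, k)) * \<mu> i x $ k"
    and \<mu>: "\<mu> i x \<in> carrier_vec (udim S i)" and \<nu>: "\<nu> x \<in> carrier_vec (udim S i)"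
  shows "frechet_derivative V (at x) (closed_loop S (\<mu>(i := \<nu>)) x) + running_cost S q r (\<mu>(i := \<nu>)) x
     = (\<Sum>k<udim S i. r i $$ (k, k) * (\<nu> x $ k - \<mu> i x $ k)\<^sup>2)"
proof -
  let ?D = "frechet_derivative V (at x)"
  have lin: "linear ?D" using V by (rule linear_frechet_derivative)
  have D: "?D (input_col S i x k) = - 2 * (r i $$ (k, k)) * \<mu> i x $ k" if "k < udim S i" for k
    using grad[OF that] that by (simp add: input_grad_def)
  have "?D (closed_loop S (\<mu>(i := \<nu>)) x) = ?D (closed_loop S \<mu> x)
      + (\<Sum>k<udim S i. (\<nu> x $ k - \<mu> i x $ k) * ?D (input_col S i x k))"
    unfolding closed_loop_update[OF i] by (simp add: linear_add[OF lin] linear_sum[OF lin] linear_cmul[OF lin])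
  also have "?D (closed_loop S \<mu> x) = - running_cost S q r \<mu> x"
    using HJB x by (simp add: HJB_eq_iff)
  also have "(\<Sum>k<udim S i. (\<nu> x $ k - \<mu> i x $ k) * ?D (input_col S i x k)) =
      (\<Sum>k<udim S i. (\<nu> x $ k - \<mu> i x $ k) * (- 2 * (r i $$ (k, k)) * \<mu> i x $ k))"
    by (intro sum.cong) (simp_all only: D lessThan_iff)
  finally have "?D (closed_loop S (\<mu>(i := \<nu>)) x) + running_cost S q r (\<mu>(i := \<nu>)) x =
      (\<Sum>k<udim S i. (\<nu> x $ k - \<mu> i x $ k) * (- 2 * (r i $$ (k, k)) * \<mu> i x $ k))
      + ((\<Sum>k<udim S i. r i $$ (k, k) * (\<nu> x $ k * \<nu> x $ k))
      - (\<Sum>k<udim S i. r i $$ (k, k) * (\<mu> i x $ k * \<mu> i x $ k)))"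
    unfolding running_cost_update[OF i] diagonal_quadratic_form[OF r \<mu>]
      diagonal_quadratic_form[OF r \<nu>] by linarith
  also have "\<dots> = (\<Sum>k<udim S i. r i $$ (k, k) * (\<nu> x $ k - \<mu> i x $ k)\<^sup>2)"
    unfolding sum_subtractf[symmetric] sum.distrib[symmetric]
    by (intro sum.cong) (auto simp: power2_eq_square algebra_simps)
  finally show ?thesis .
qed

text \<open>Optimality of \<open>\<mu>\<close> is given, so two uniqueness statements remain: that
  of the optimal strategy, by the completed square, and that of the normalised HJB solution, by
  integration along the closed loop.\<close>

lemma decoupled_HJB_nec_suffI:
  fixes S :: "'s::real_normed_vector dsystem"
  assumes i: "i < players S" and op: "open (states S)" and zero: "0 \<in> states S"
    and opt: "is_optimal S q r i \<mu>"
    and V0: "value_fun S q r \<mu> 0 = 0" and HJB: "HJB_eq S q r \<mu> (value_fun S q r \<mu>)"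
    and r: "r i \<in> carrier_mat (udim S i) (udim S i)" "diagonal_mat (r i)"
      "\<And>k. k < udim S i \<Longrightarrow> 0 < r i $$ (k, k)"
    and grad: "\<And>x k. x \<in> states S \<Longrightarrow> k < udim S i \<Longrightarrow>
      input_grad S i (value_fun S q r \<mu>) x $ k = - 2 * (r i $$ (k, k)) * \<mu> i x $ k"
  shows "decoupled_HJB_nec_suff S q r i \<mu>"
proof -
  let ?V = "value_fun S q r \<mu>"
  have adm: "admissible S q r i \<mu>" using opt by (simp add: is_optimal_def)
  then have V: "?V differentiable (at y)" if "y \<in> states S" for y
    using that C2_on_differentiable by (auto simp: admissible_def)
  have unique: "\<nu> x0 = \<mu> i x0" if \<nu>: "is_optimal S q r i (\<mu>(i := \<nu>))" and x0: "x0 \<in> states S" for \<nu> x0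
  proof -
    have adm': "admissible S q r i (\<mu>(i := \<nu>))" using \<nu> by (simp add: is_optimal_def)
    define g where "g x = (\<Sum>k<udim S i. r i $$ (k, k) * (\<nu> x $ k - \<mu> i x $ k)\<^sup>2)" for x
    have "admissible S q r i ((\<mu>(i := \<nu>))(i := \<mu> i))" using adm by simp
    \<comment> \<open>Seen from the deviating profile, \<open>\<mu> i\<close> is itself an
      admissible deviation, so optimality of \<nu> gives the inequality opposite to the one for
      \<open>\<mu>\<close>.\<close>
    then have le: "value_fun S q r (\<mu>(i := \<nu>)) x0 \<le> ?V x0"
      using \<nu> x0 unfolding is_optimal_def by (metis fun_upd_triv fun_upd_upd)
    \<comment> \<open>The trajectory and the cost are those of the deviating profile, while the
      function tested along them remains the value of the original one.\<close>
    have "g x0 = 0"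
    proof (rule residual_vanishes[where V = ?V and \<mu> = "\<mu>(i := \<nu>)" and q = q and r = r and S = S])
      show "continuous_on (states S) g"
        unfolding g_def using adm adm'
        by (intro continuous_intros C1_on_imp_continuous_on) (auto simp: admissible_def)
      show "frechet_derivative ?V (at y) (closed_loop S (\<mu>(i := \<nu>)) y) +
          running_cost S q r (\<mu>(i := \<nu>)) y = g y" if "y \<in> states S" for y
        unfolding g_def using adm adm' that
        by (intro hamiltonian_residual i V HJB r grad) (auto simp: admissible_def)
      show "0 \<le> g y" for y
        unfolding g_def using r(3) by (intro sum_nonneg mult_nonneg_nonneg) (auto intro: less_imp_le)
    qed (use adm' zero x0 V V0 le in \<open>auto simp: admissible_def\<close>)
    then have "\<forall>k\<in>{..<udim S i}. r i $$ (k, k) * (\<nu> x0 $ k - \<mu> i x0 $ k)\<^sup>2 = 0"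
      unfolding g_def using r(3) by (subst (asm) sum_nonneg_eq_0_iff) (auto simp: less_imp_le)
    then have "r i $$ (k, k) * (\<nu> x0 $ k - \<mu> i x0 $ k)\<^sup>2 = 0" if "k < udim S i" for k
      using that by blast
    then have "\<nu> x0 $ k = \<mu> i x0 $ k" if "k < udim S i" for k
      using r(3)[OF that] that by fastforce
    moreover have "\<nu> x0 \<in> carrier_vec (udim S i)" "\<mu> i x0 \<in> carrier_vec (udim S i)"
      using adm adm' by (simp_all add: admissible_def)
    ultimately show ?thesis by (intro eq_vecI) simp_all
  qed
  then have opt': "is_unique_optimal S q r i \<mu>" using opt by (simp add: is_unique_optimal_def)
  show ?thesis
    unfolding decoupled_HJB_nec_suff_def
  proof safe
    fix W x assume "C2_on W (states S)" "W 0 = 0" "HJB_eq S q r \<mu> W" "x \<in> states S"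
    then show "W x = ?V x"
      by (intro HJB_eq_imp_value[OF adm zero]) (auto intro: C2_on_differentiable)
  next
    fix W assume "\<forall>x\<in>states S. W x = ?V x"
    then have "frechet_derivative W (at x) = frechet_derivative ?V (at x)" if "x \<in> states S" for x
      using that by (intro frechet_derivative_cong_open[OF op]) auto
    then show "HJB_eq S q r \<mu> W" using HJB by (simp add: HJB_eq_iff)
  qed (use opt' in auto)
qed

section \<open>Data matrices\<close>

lemma sum_lessThan_add:
  fixes g :: "nat \<Rightarrow> 'a::comm_monoid_add"
  shows "(\<Sum>c<a + b. g c) = (\<Sum>c<a. g c) + (\<Sum>k<b. g (a + k))"
  by (induction b) (auto simp: add.assoc)

lemma sum_blocks:
  fixes g :: "nat \<Rightarrow> 'a::comm_monoid_add" and d :: "nat \<Rightarrow> nat"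
  shows "(\<Sum>c<(\<Sum>l<n. d l). g c) = (\<Sum>j<n. \<Sum>k<d j. g ((\<Sum>l<j. d l) + k))"
  by (induction n) (auto simp: sum_lessThan_add)

lemma length_concat_blocks:
  assumes "\<And>j. j < n \<Longrightarrow> length (f j) = d j"
  shows "length (concat (map f [0..<n])) = (\<Sum>l<n. d l)"
  using assms by (induction n) auto

lemma nth_concat_blocks:
  assumes "\<And>j. j < n \<Longrightarrow> length (f j) = d j" "j < n" "k < d j"
  shows "concat (map f [0..<n]) ! ((\<Sum>l<j. d l) + k) = f j ! k"
  using assms
proof (induction n)
  case (Suc n)
  have len: "length (concat (map f [0..<n])) = (\<Sum>l<n. d l)"
    using Suc.prems by (intro length_concat_blocks) auto
  show ?case
  proof (cases "j < n")
    case True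
    \<comment> \<open>This places the index inside the first \<open>n\<close> blocks, so that the
      appended last block is not reached.\<close>
    have "(\<Sum>l<Suc j. d l) \<le> (\<Sum>l<n. d l)"
      using True by (intro sum_mono2) auto
    then show ?thesis using Suc True len by (simp add: nth_append)
  next
    case False
    then have "j = n" using Suc.prems by simp
    then show ?thesis using len by (simp add: nth_append)
  qed
qed simp

lemma udim_offset_less:
  assumes "j < players S" "k < udim S j"
  shows "(\<Sum>l<j. udim S l) + k < total_udim S"
proof -
  have "(\<Sum>l<Suc j. udim S l) \<le> total_udim S"
    unfolding total_udim_def using assms by (intro sum_mono2) auto
  then show ?thesis using assms by simp
qed

lemma squared_controls_carrier: "squared_controls S \<mu> x \<in> carrier_vec (total_udim S)"
  unfolding squared_controls_def total_udim_def
  by (intro carrier_vecI) (simp only: dim_vec_of_list, rule length_concat_blocks, simp)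

lemma squared_controls_scalar_prod:
  assumes "\<alpha> \<in> carrier_vec (total_udim S)"
  shows "squared_controls S \<mu> x \<bullet> \<alpha> =
    (\<Sum>j<players S. \<Sum>k<udim S j. \<alpha> $ ((\<Sum>l<j. udim S l) + k) * (\<mu> j x $ k * \<mu> j x $ k))"
proof -
  let ?f = "\<lambda>j. map (\<lambda>k. \<mu> j x $ k * \<mu> j x $ k) [0..<udim S j]"
  have "squared_controls S \<mu> x $ ((\<Sum>l<j. udim S l) + k) = \<mu> j x $ k * \<mu> j x $ k"
    if "j < players S" "k < udim S j" for j k
    using nth_concat_blocks[of "players S" ?f "udim S" j k] that
    by (simp add: squared_controls_def vec_of_list_index)
  moreover have "squared_controls S \<mu> x \<bullet> \<alpha> = (\<Sum>c<(\<Sum>l<players S. udim S l). squared_controls S \<mu> x $ c * \<alpha> $ c)"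
    using assms by (simp add: scalar_prod_def total_udim_def lessThan_atLeast0)
  ultimately show ?thesis by (simp add: sum_blocks mult.commute)
qed

lemma R_of_diagonal:
  "R_of S \<alpha> j \<in> carrier_mat (udim S j) (udim S j)" "diagonal_mat (R_of S \<alpha> j)"
  "k < udim S j \<Longrightarrow> R_of S \<alpha> j $$ (k, k) = \<alpha> $ ((\<Sum>l<j. udim S l) + k)"
  by (auto simp: R_of_def mat_diag_def diagonal_mat_def)

text \<open>For diagonal weights the control cost is linear in the diagonal entries, with the
  squared controls as coefficients. This makes the HJB equation a linear condition on the
  parameters.\<close>

lemma running_cost_R_of:
  assumes "\<alpha> \<in> carrier_vec (total_udim S)" "\<And>j. j < players S \<Longrightarrow> \<mu> j x \<in> carrier_vec (udim S j)"
  shows "running_cost S q (R_of S \<alpha>) \<mu> x = q x + squared_controls S \<mu> x \<bullet> \<alpha>"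
  using assms
  by (simp add: running_cost_def squared_controls_scalar_prod diagonal_quadratic_form[OF R_of_diagonal(1,2)]
      R_of_diagonal(3))

lemma alpha_of_carrier:
  assumes "\<And>j. j < players S \<Longrightarrow> r j \<in> carrier_mat (udim S j) (udim S j)"
  shows "alpha_of S r \<in> carrier_vec (total_udim S)"
  unfolding alpha_of_def total_udim_def
  by (intro carrier_vecI) (simp only: dim_vec_of_list, rule length_concat_blocks,
      use assms in \<open>auto simp: diag_mat_def\<close>)

lemma alpha_of_index:
  assumes "\<And>j. j < players S \<Longrightarrow> r j \<in> carrier_mat (udim S j) (udim S j)"
    and "j < players S" "k < udim S j"
  shows "alpha_of S r $ ((\<Sum>l<j. udim S l) + k) = r j $$ (k, k)"
proof -
  have dim: "dim_row (r j) = udim S j" if "j < players S" for j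
    using assms(1)[OF that] by simp
  then have "concat (map (\<lambda>j. diag_mat (r j)) [0..<players S]) ! ((\<Sum>l<j. udim S l) + k) = diag_mat (r j) ! k"
    using assms(2,3) by (intro nth_concat_blocks) (simp_all add: diag_mat_def)
  then show ?thesis using dim[OF assms(2)] assms(3)
    by (simp add: alpha_of_def vec_of_list_index diag_mat_def)
qed

text \<open>Recording only the diagonal loses nothing, since the other entries are zero.\<close>

lemma R_of_smult_alpha_of:
  assumes r: "\<And>j. j < players S \<Longrightarrow> r j \<in> carrier_mat (udim S j) (udim S j)"
    "\<And>j. j < players S \<Longrightarrow> diagonal_mat (r j)" and j: "j < players S"
  shows "R_of S (c \<cdot>\<^sub>v alpha_of S r) j = c \<cdot>\<^sub>m r j"
proof (rule eq_matI)
  fix k l assume "k < dim_row (c \<cdot>\<^sub>m r j)" "l < dim_col (c \<cdot>\<^sub>m r j)"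
  then have kl: "k < udim S j" "l < udim S j" using r(1)[OF j] by auto
  then show "R_of S (c \<cdot>\<^sub>v alpha_of S r) j $$ (k, l) = (c \<cdot>\<^sub>m r j) $$ (k, l)"
    using r(1)[OF j] r(2)[OF j] alpha_of_index[OF r(1) j kl(1)] udim_offset_less[OF j kl(1)]
      alpha_of_carrier[OF r(1)]
    by (auto simp: R_of_def mat_diag_def diagonal_mat_def)
qed (use r(1)[OF j] in \<open>auto simp: R_of_def mat_diag_def\<close>)

text \<open>\<open>mat_of_rows\<close> reads \<open>n\<close> entries of each row whatever its
  length; the vector on the right is \<open>u\<close> itself as soon as \<open>u\<close> has
  dimension \<open>n\<close>.\<close>

lemma mat_of_rows_mult_eq_0_iff:
  fixes v :: "real Matrix.vec"
  shows "mat_of_rows n rs *\<^sub>v v = 0\<^sub>v (length rs) \<longleftrightarrow> (\<forall>u\<in>set rs. vec n (\<lambda>j. u $ j) \<bullet> v = 0)"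
proof -
  have "mat_of_rows n rs *\<^sub>v v = 0\<^sub>v (length rs) \<longleftrightarrow> (\<forall>i<length rs. (mat_of_rows n rs *\<^sub>v v) $ i = 0)"
    by (auto simp: vec_eq_iff)
  also have "\<dots> \<longleftrightarrow> (\<forall>i<length rs. vec n (\<lambda>j. rs ! i $ j) \<bullet> v = 0)"
  proof (intro all_cong)
    fix i assume i: "i < length rs"
    then have "Matrix.row (mat_of_rows n rs) i = vec n (\<lambda>j. rs ! i $ j)"
      by (intro eq_vecI) (simp_all add: mat_of_rows_index)
    with i show "(mat_of_rows n rs *\<^sub>v v) $ i = 0 \<longleftrightarrow> vec n (\<lambda>j. rs ! i $ j) \<bullet> v = 0"
      by simp
  qed
  finally show ?thesis by (auto simp: set_conv_nth)
qed

text \<open>Appending the rows at \<open>x\<close> does not raise the rank, hence does not shrink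
  the kernel. So a linear relation checked at finitely many data points holds on all of
  \<open>X\<close>. A state contributes a list of rows, because the control data have one row per
  control component.\<close>

lemma rank_maximal_kernel:
  fixes rws :: "'s \<Rightarrow> real Matrix.vec list"
  assumes rws: "\<And>x. set (rws x) \<subseteq> carrier_vec n"
    and max: "rank_maximal X (\<lambda>xs. mat_of_rows n (concat (map rws xs))) xs" and v: "v \<in> carrier_vec n" and x: "x \<in> X"
    and zero: "\<And>y u. y \<in> set xs \<Longrightarrow> u \<in> set (rws y) \<Longrightarrow> u \<bullet> v = 0" and u: "u \<in> set (rws x)"
  shows "u \<bullet> v = 0"
proof -
  define M where "M = (\<lambda>xs. mat_of_rows n (concat (map rws xs)))"
  let ?L = "\<lambda>xs. length (concat (map rws xs))"
  have M: "M xs \<in> carrier_mat (?L xs) n" for xs by (simp add: M_def)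
  have row: "vec n (\<lambda>j. u $ j) = u" if "u \<in> set (rws y)" for u y
    using rws[of y] that by (intro eq_vecI) auto
  have ker: "v \<in> mat_kernel (M ys) \<longleftrightarrow> v \<in> carrier_vec n \<and> (\<forall>y\<in>set ys. \<forall>u\<in>set (rws y). u \<bullet> v = 0)" for ys v
    unfolding mat_kernel[OF M] by (auto simp: M_def mat_of_rows_mult_eq_0_iff row simp del: length_concat)
  have "mat_kernel (M (xs @ [x])) = mat_kernel (M xs)"
  proof (rule mat_kernel_eq_of_rank_eq[OF M M])
    show "mat_kernel (M (xs @ [x])) \<subseteq> mat_kernel (M xs)" using ker by auto
    show "mat_rank (M (xs @ [x])) = mat_rank (M xs)"
      using max[unfolded rank_maximal_def, rule_format, of "[x]"] x by (simp add: M_def)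
  qed
  moreover have "v \<in> mat_kernel (M xs)" using ker v zero by blast
  ultimately have "v \<in> mat_kernel (M (xs @ [x]))" by simp
  then show ?thesis using ker u by auto
qed

lemma mat_of_rows_mult:
  fixes v :: "real Matrix.vec"
  assumes "set rs \<subseteq> carrier_vec n"
  shows "mat_of_rows n rs *\<^sub>v v = vec_of_list (map (\<lambda>u. u \<bullet> v) rs)"
proof (rule eq_vecI)
  fix i assume "i < dim_vec (vec_of_list (map (\<lambda>u. u \<bullet> v) rs))"
  then have i: "i < length rs" by simp
  then have "rs ! i \<in> carrier_vec n" using assms nth_mem by blast
  then have "Matrix.row (mat_of_rows n rs) i = rs ! i"
    using i by (intro eq_vecI) (simp_all add: mat_of_rows_index)
  then show "(mat_of_rows n rs *\<^sub>v v) $ i = vec_of_list (map (\<lambda>u. u \<bullet> v) rs) $ i"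
    using i by (simp add: vec_of_list_index)
qed simp

lemma concat_map_concat: "concat (map f (concat xss)) = concat (map (\<lambda>xs. concat (map f xs)) xss)"
  by (induction xss) auto

lemma map_scalar_prod_rows: "map (\<lambda>u. u \<bullet> v) (Matrix.rows A) = list_of_vec (A *\<^sub>v v)"
  by (intro nth_equalityI) (simp_all add: list_of_vec_index)

lemma left_id_mat_mult:
  assumes "y \<in> carrier_vec (a + b)"
  shows "left_id_mat a (a + b) *\<^sub>v y = vec_first y a"
proof (rule eq_vecI)
  fix k assume "k < dim_vec (vec_first y a)"
  then have k: "k < a" by simp
  have "(left_id_mat a (a + b) *\<^sub>v y) $ k = (\<Sum>c<a + b. (if k = c then 1 else 0) * y $ c)"
    using assms k by (simp add: left_id_mat_def scalar_prod_def lessThan_atLeast0)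
  also have "\<dots> = (\<Sum>c<a + b. if c = k then y $ k else 0)"
    by (intro sum.cong) auto
  finally show "(left_id_mat a (a + b) *\<^sub>v y) $ k = vec_first y a $ k"
    using k by (simp add: vec_first_def)
qed (simp add: left_id_mat_def)

lemma left_id_mat_carrier: "left_id_mat a b \<in> carrier_mat a b"
  by (simp add: left_id_mat_def)

lemma vec_first_append: "u \<in> carrier_vec a \<Longrightarrow> vec_first (u @\<^sub>v v) a = u"
  by (intro eq_vecI) (auto simp: vec_first_def)

text \<open>The candidates are the images under \<open>L\<close> of all solutions, a translate of
  the image of the kernel of \<open>M\<close>; it is a single point exactly if \<open>L\<close> is
  zero on that kernel. The coefficients \<open>\<gamma>\<close> may stay undetermined.\<close>

lemma ls_params_singleton_iff:
  fixes M :: "real mat"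
  assumes M: "M \<in> carrier_mat nr (a + b + d)"
    and \<alpha>: "\<alpha> \<in> carrier_vec a" and \<beta>: "\<beta> \<in> carrier_vec b" and \<gamma>: "\<gamma> \<in> carrier_vec d"
    and z: "M *\<^sub>v ((\<alpha> @\<^sub>v \<beta>) @\<^sub>v \<gamma>) = z"
  defines "L \<equiv> left_id_mat (a + b) (a + b + d)"
  shows "{(\<alpha>', \<beta>'). \<alpha>' \<in> carrier_vec a \<and> \<beta>' \<in> carrier_vec b \<and>
      (\<exists>w\<in>carrier_vec (a + b + d). \<alpha>' @\<^sub>v \<beta>' = ls_point L M z w)} = {(\<alpha>, \<beta>)} \<longleftrightarrow>
    ls_freedom L M = 0\<^sub>m (a + b) (a + b + d)" (is "?A = _ \<longleftrightarrow> _")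
proof -
  define y0 where "y0 = (\<alpha> @\<^sub>v \<beta>) @\<^sub>v \<gamma>"
  have y0: "y0 \<in> carrier_vec (a + b + d)" using \<alpha> \<beta> \<gamma> by (simp add: y0_def)
  have L: "L \<in> carrier_mat (a + b) (a + b + d)" by (simp add: L_def left_id_mat_carrier)
  have Ly: "L *\<^sub>v y = vec_first y (a + b)" if "y \<in> carrier_vec (a + b + d)" for y
    using left_id_mat_mult[OF that] by (simp add: L_def)
  have Ly0: "L *\<^sub>v y0 = \<alpha> @\<^sub>v \<beta>"
    using Ly[OF y0] \<alpha> \<beta> by (simp add: y0_def vec_first_append)
  have mem: "(\<alpha>', \<beta>') \<in> ?A \<longleftrightarrow> \<alpha>' \<in> carrier_vec a \<and> \<beta>' \<in> carrier_vec b \<and>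
      (\<exists>y\<in>carrier_vec (a + b + d). M *\<^sub>v y = M *\<^sub>v y0 \<and> \<alpha>' @\<^sub>v \<beta>' = L *\<^sub>v y)" for \<alpha>' \<beta>'
    using ls_points_eq[OF M y0 L] z by (simp add: y0_def)
  show ?thesis
    unfolding ls_freedom_eq_0_iff[OF M L]
  proof safe
    fix v :: "real Matrix.vec"
    assume A: "?A = {(\<alpha>, \<beta>)}" and v: "v \<in> carrier_vec (a + b + d)" "M *\<^sub>v v = 0\<^sub>v nr"
    \<comment> \<open>A kernel vector added to the true solution gives another solution, whose
      leading part again belongs to the set and so must be the old one.\<close>
    define u where "u = L *\<^sub>v (y0 + v)"
    have u: "u \<in> carrier_vec (a + b)"
      unfolding u_def using L y0 v by (intro mult_mat_vec_carrier[OF L]) simp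
    have "M *\<^sub>v (y0 + v) = M *\<^sub>v y0"
      using M y0 v by (simp add: mult_add_distrib_mat_vec[OF M])
    then have "(vec_first u a, vec_last u b) \<in> ?A"
      unfolding mem using u y0 v by (auto simp: u_def intro!: bexI[of _ "y0 + v"])
    then have "vec_first u a = \<alpha>" "vec_last u b = \<beta>" using A by auto
    then have "u = \<alpha> @\<^sub>v \<beta>" using vec_first_last_append[OF u] by simp
    then have "L *\<^sub>v y0 + L *\<^sub>v v = L *\<^sub>v y0"
      using Ly0 y0 v by (simp add: u_def mult_add_distrib_mat_vec[OF L])
    then have "(L *\<^sub>v y0 + L *\<^sub>v v) - L *\<^sub>v y0 = 0\<^sub>v (a + b)"
      using mult_mat_vec_carrier[OF L y0] by simp
    moreover have "(L *\<^sub>v y0 + L *\<^sub>v v) - L *\<^sub>v y0 = L *\<^sub>v v"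
      using L by (intro eq_vecI) auto
    ultimately show "L *\<^sub>v v = 0\<^sub>v (a + b)" by simp
  next
    fix \<alpha>' \<beta>' w
    assume ker: "\<forall>v\<in>carrier_vec (a + b + d). M *\<^sub>v v = 0\<^sub>v nr \<longrightarrow> L *\<^sub>v v = 0\<^sub>v (a + b)"
      and c: "\<alpha>' \<in> carrier_vec a" "\<beta>' \<in> carrier_vec b"
      and w: "w \<in> carrier_vec (a + b + d)" "\<alpha>' @\<^sub>v \<beta>' = ls_point L M z w"
    then have "(\<alpha>', \<beta>') \<in> ?A" by blast
    then obtain y where y: "y \<in> carrier_vec (a + b + d)" "M *\<^sub>v y = M *\<^sub>v y0" "\<alpha>' @\<^sub>v \<beta>' = L *\<^sub>v y"
      unfolding mem by blast
    have "M *\<^sub>v (y - y0) = 0\<^sub>v nr"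
      using M y y0 by (simp add: mult_minus_distrib_mat_vec[OF M])
    moreover have "y - y0 \<in> carrier_vec (a + b + d)" using y y0 by simp
    ultimately have "L *\<^sub>v (y - y0) = 0\<^sub>v (a + b)" using ker by blast
    then have "L *\<^sub>v y - L *\<^sub>v y0 = 0\<^sub>v (a + b)"
      using y y0 by (simp add: mult_minus_distrib_mat_vec[OF L])
    then have "L *\<^sub>v y = L *\<^sub>v y0"
      by (rule vec_minus_eq_0[OF mult_mat_vec_carrier[OF L y(1)] mult_mat_vec_carrier[OF L y0]])
    then have "\<alpha>' @\<^sub>v \<beta>' = \<alpha> @\<^sub>v \<beta>" using y Ly0 by simp
    then show "\<alpha>' = \<alpha>" "\<beta>' = \<beta>" using append_vec_eq[OF c(1) \<alpha>] by auto
  next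
    show "\<exists>w\<in>carrier_vec (a + b + d). \<alpha> @\<^sub>v \<beta> = ls_point L M z w"
    proof -
      have "(\<alpha>, \<beta>) \<in> ?A" unfolding mem using \<alpha> \<beta> y0 Ly0 by auto
      then show ?thesis by blast
    qed
  qed (use \<alpha> \<beta> in auto)
qed

section \<open>Derivatives, block indices and diagonal inverses in coordinates\<close>

lemma frechet_derivative_scalar_prod:
  fixes F :: "'s::real_normed_vector \<Rightarrow> real Matrix.vec"
  assumes F: "\<And>y. F y \<in> carrier_vec d" and \<gamma>: "\<gamma> \<in> carrier_vec d"
    and diff: "\<And>k. k < d \<Longrightarrow> (\<lambda>y. F y $ k) differentiable (at x)"
  shows "frechet_derivative (\<lambda>y. \<gamma> \<bullet> F y) (at x) = (\<lambda>v. \<Sum>k<d. \<gamma> $ k * frechet_derivative (\<lambda>y. F y $ k) (at x) v)"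
proof -
  have eq: "(\<lambda>y. \<gamma> \<bullet> F y) = (\<lambda>y. \<Sum>k<d. \<gamma> $ k * F y $ k)"
    by (simp add: scalar_prod_def lessThan_atLeast0 carrier_vecD[OF F])
  have "((\<lambda>y. \<Sum>k<d. \<gamma> $ k * F y $ k) has_derivative
      (\<lambda>v. \<Sum>k<d. \<gamma> $ k * frechet_derivative (\<lambda>y. F y $ k) (at x) v)) (at x)"
    by (intro has_derivative_sum has_derivative_mult_right)
      (use diff frechet_derivative_works in blast)
  then show ?thesis unfolding eq by (rule frechet_derivative_at[symmetric])
qed

lemma frechet_derivative_scalar_prod_jac:
  fixes F :: "'s::real_normed_vector \<Rightarrow> real Matrix.vec"
  assumes "\<And>y. F y \<in> carrier_vec d" and "\<gamma> \<in> carrier_vec d"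
    and "\<And>k. k < d \<Longrightarrow> (\<lambda>y. F y $ k) differentiable (at x)"
  shows "frechet_derivative (\<lambda>y. \<gamma> \<bullet> F y) (at x) v = \<gamma> \<bullet> jac_apply d F x v"
  by (subst frechet_derivative_scalar_prod[OF assms]; simp add: jac_apply_def scalar_prod_def lessThan_atLeast0)

lemma sum_div_mod:
  fixes g :: "nat \<Rightarrow> nat \<Rightarrow> 'a::comm_monoid_add"
  shows "(\<Sum>c<p * h. g (c div h) (c mod h)) = (\<Sum>k<p. \<Sum>l<h. g k l)"
proof -
  have "(\<Sum>c<(\<Sum>l<p. h). g (c div h) (c mod h)) = (\<Sum>j<p. \<Sum>k<h. g ((j * h + k) div h) ((j * h + k) mod h))"
    unfolding sum_blocks by simp
  also have "\<dots> = (\<Sum>k<p. \<Sum>l<h. g k l)" by (intro sum.cong) auto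
  finally show ?thesis by simp
qed

text \<open>The inverse is never computed. It exists because the determinant is the product of the
  positive diagonal entries, and component \<open>k\<close> of \<open>A B g = g\<close> involves
  only component \<open>k\<close> of \<open>B g\<close>.\<close>

lemma mat_inverse_diagonal_mult:
  fixes A :: "real mat"
  assumes A: "A \<in> carrier_mat n n" "diagonal_mat A" and pos: "\<And>k. k < n \<Longrightarrow> 0 < A $$ (k, k)"
    and g: "g \<in> carrier_vec n" and k: "k < n"
  shows "(the (mat_inverse A) *\<^sub>v g) $ k = g $ k / A $$ (k, k)"
proof -
  have entry: "(A *\<^sub>v v) $ k = A $$ (k, k) * v $ k" if v: "v \<in> carrier_vec n" for v
  proof -
    have "(A *\<^sub>v v) $ k = (\<Sum>j<n. A $$ (k, j) * v $ j)"
      using k A v by (simp add: scalar_prod_def lessThan_atLeast0)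
    also have "\<dots> = (\<Sum>j<n. if j = k then A $$ (k, k) * v $ k else 0)"
      using A k by (intro sum.cong) (auto simp: diagonal_mat_def)
    finally show ?thesis using k by simp
  qed
  have ut: "upper_triangular A" using A by (auto simp: diagonal_mat_def upper_triangular_def)
  have "det A = prod_list (diag_mat A)" by (rule det_upper_triangular[OF ut A(1)])
  moreover have "0 \<notin> set (diag_mat A)" using pos A(1) by (force simp: diag_mat_def)
  ultimately have "det A \<noteq> 0" by (simp add: prod_list_zero_iff)
  then have "A \<in> Units (ring_mat TYPE(real) n ())" by (rule det_non_zero_imp_unit[OF A(1)])
  then obtain B where "mat_inverse A = Some B"
    using mat_inverse(1)[OF A(1), of "()"] by (cases "mat_inverse A") auto
  with mat_inverse(2)[OF A(1) this] have B: "the (mat_inverse A) = B" "A * B = 1\<^sub>m n" "B \<in> carrier_mat n n"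
    by auto
  have "A *\<^sub>v (B *\<^sub>v g) = A * B *\<^sub>v g"
    by (rule assoc_mult_mat_vec[symmetric, of _ n n _ n]) (use A B g in auto)
  then have "(A *\<^sub>v (B *\<^sub>v g)) $ k = g $ k" using B(2) g by simp
  then have "A $$ (k, k) * (B *\<^sub>v g) $ k = g $ k" using entry[of "B *\<^sub>v g"] B g by simp
  then show ?thesis using B(1) pos[OF k] by (simp add: field_simps)
qed

section \<open>The identified parameters\<close>

text \<open>The state enters only through directional derivatives along the input columns and
  through the inner product used for uniqueness of trajectories; hence the abstract state
  space.\<close>

locale identification =
  fixes S :: "'s::real_inner dsystem"
    and Q :: "nat \<Rightarrow> 's \<Rightarrow> real" and R :: "nat \<Rightarrow> nat \<Rightarrow> real mat"
    and \<mu> :: "'s profile" and E :: "'s ident"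
    and \<beta> \<theta> :: "nat \<Rightarrow> real Matrix.vec"
  assumes game: "differential_game S Q R"
    and FNE: "is_unique_FNE S Q R \<mu>"
    and HJB: "coupled_HJB_nec_suff S Q R"
    and demos: "FNE_demonstrations S \<mu> E"
    and split: "\<forall>i<players S. basis_split S E i"
    and psi: "\<forall>i<players S. \<beta> i \<in> carrier_vec (mdim E i) \<and>
        (\<forall>x. psi E i x \<in> carrier_vec (mdim E i)) \<and>
        (\<forall>k<mdim E i. C1_on (\<lambda>x. psi E i x $ k) (states S)) \<and>
        (\<forall>x\<in>states S. Q i x = \<beta> i \<bullet> psi E i x)"
    and diag: "\<forall>i<players S. \<forall>j<players S. diagonal_mat (R i j)"
    and phi: "\<forall>i<players S. \<theta> i \<in> carrier_vec (hdim E i) \<and>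
        (\<forall>x. phi E i x \<in> carrier_vec (hdim E i)) \<and>
        (\<forall>k<hdim E i. C2_on (\<lambda>x. phi E i x $ k) (states S)) \<and>
        (\<forall>x\<in>states S. value_fun S (Q i) (R i) \<mu> x = \<theta> i \<bullet> phi E i x)"
    and rank_u: "\<forall>i<players S. rank_maximal (states S) (M_u_of S E i) (sample_states S E)"
    and points: "set (hjb_points E) \<subseteq> states S"
    and rank_hjb: "\<forall>i<players S.
        (full_rank_u S E i \<longrightarrow> rank_maximal (states S) (M_hjb_r_of S E i) (hjb_points E)) \<and>
        (\<not> full_rank_u S E i \<longrightarrow> rank_maximal (states S) (M_hjb_of S E i) (hjb_points E))"
begin

section \<open>Consequences of the equilibrium and of the coupled HJB equations\<close>

lemma open_states: "open (states S)" and zero_in_states: "0 \<in> states S"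
  using game by (auto simp: differential_game_def)

lemma admissible_\<mu>: "i < players S \<Longrightarrow> admissible S (Q i) (R i) i \<mu>"
  using FNE by (auto simp: is_unique_FNE_def is_FNE_def)

lemma \<mu>_carrier: "i < players S \<Longrightarrow> \<mu> i x \<in> carrier_vec (udim S i)"
  using admissible_\<mu> by (auto simp: admissible_def)

lemma \<mu>_0: "i < players S \<Longrightarrow> \<mu> i 0 = 0\<^sub>v (udim S i)"
  using admissible_\<mu> by (auto simp: admissible_def)

lemma R_carrier:
  "i < players S \<Longrightarrow> j < players S \<Longrightarrow> R i j \<in> carrier_mat (udim S j) (udim S j)"
  using game by (cases "i = j") (auto simp: differential_game_def pos_def_mat_def pos_semidef_mat_def)

lemma R_diag: "i < players S \<Longrightarrow> j < players S \<Longrightarrow> diagonal_mat (R i j)"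
  using diag by blast

lemma R_pos:
  assumes i: "i < players S" and k: "k < udim S i"
  shows "0 < R i i $$ (k, k)"
proof -
  let ?e = "unit_vec (udim S i) k :: real Matrix.vec"
  have "?e $ k \<noteq> 0\<^sub>v (udim S i) $ k" using k by simp
  then have "?e \<noteq> 0\<^sub>v (udim S i)" by metis
  then have "0 < ?e \<bullet> (R i i *\<^sub>v ?e)"
    using game i unfolding differential_game_def pos_def_mat_def by (meson unit_vec_carrier)
  also have "\<dots> = (\<Sum>l<udim S i. if l = k then R i i $$ (k, k) else 0)"
    unfolding diagonal_quadratic_form[OF R_carrier[OF i i] R_diag[OF i i] unit_vec_carrier]
    using k by (intro sum.cong) auto
  finally show ?thesis using k by simp
qed

text \<open>\<open>coupled_HJB_nec_suff\<close> speaks about functions that vanish at the origin, so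
  the values have to be shown to be of this kind before it applies.\<close>

lemma value_at_0:
  assumes i: "i < players S"
  shows "value_fun S (Q i) (R i) \<mu> 0 = 0"
proof (rule value_fun_0[OF _ zero_in_states])
  show "stabilizing S \<mu>" using admissible_\<mu>[OF i] by (simp add: admissible_def)
  have "\<mu> j 0 \<bullet> (R i j *\<^sub>v \<mu> j 0) = 0" if j: "j < players S" for j
    unfolding \<mu>_0[OF j] diagonal_quadratic_form[OF R_carrier[OF i j] R_diag[OF i j] zero_carrier_vec]
    by simp
  moreover have "Q i 0 = 0" using game i by (auto simp: differential_game_def)
  ultimately show "running_cost S (Q i) (R i) \<mu> 0 = 0" by (simp add: running_cost_def)
qed

lemma C2_value: "i < players S \<Longrightarrow> C2_on (value_fun S (Q i) (R i) \<mu>) (states S)"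
  using admissible_\<mu> by (auto simp: admissible_def)

text \<open>Necessity is instantiated with the value functions themselves, which makes the clause
  identifying the functions with the values trivial.\<close>

lemma coupled_HJB_\<mu>: "coupled_HJB S Q R \<mu> (\<lambda>i. value_fun S (Q i) (R i) \<mu>)"
proof -
  let ?V = "\<lambda>i. value_fun S (Q i) (R i) \<mu>"
  have "(\<forall>i<players S. admissible S (Q i) (R i) i \<mu>) \<longrightarrow>
      (\<forall>i<players S. C2_on (?V i) (states S) \<and> ?V i 0 = 0) \<longrightarrow>
      (coupled_HJB S Q R \<mu> ?V \<longleftrightarrow> is_FNE S Q R \<mu> \<and> (\<forall>i<players S. \<forall>x\<in>states S. ?V i x = ?V i x))"
    using HJB[unfolded coupled_HJB_nec_suff_def, THEN spec, of \<mu>] by (rule spec)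
  moreover have "is_FNE S Q R \<mu>" using FNE by (simp add: is_unique_FNE_def)
  ultimately show ?thesis using admissible_\<mu> C2_value value_at_0 by simp
qed

lemma input_grad_value:
  assumes i: "i < players S" and x: "x \<in> states S" and k: "k < udim S i"
  shows "input_grad S i (value_fun S (Q i) (R i) \<mu>) x $ k = - 2 * (R i i $$ (k, k)) * \<mu> i x $ k"
proof -
  let ?g = "input_grad S i (value_fun S (Q i) (R i) \<mu>) x"
  have g: "?g \<in> carrier_vec (udim S i)" by (simp add: input_grad_def)
  let ?w = "the (mat_inverse (R i i)) *\<^sub>v ?g"
  have eq: "\<mu> i x = (- 1 / 2) \<cdot>\<^sub>v ?w"
    using coupled_HJB_\<mu> i x unfolding coupled_HJB_def by blast
  \<comment> \<open>The dimension of a product with \<open>the (mat_inverse ...)\<close> is not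
    visible from its form; it is read off from that of \<open>\<mu> i x\<close>.\<close>
  have "dim_vec ?w = dim_vec (\<mu> i x)" unfolding eq by simp
  then have "dim_vec ?w = udim S i" using carrier_vecD[OF \<mu>_carrier[OF i]] by simp
  then have "\<mu> i x $ k = - 1 / 2 * ?w $ k"
    unfolding eq using k by simp
  also have "\<dots> = - 1 / 2 * (?g $ k / R i i $$ (k, k))"
    using mat_inverse_diagonal_mult[OF R_carrier[OF i i] R_diag[OF i i] R_pos[OF i] g k] by simp
  finally show ?thesis using R_pos[OF i k] by (simp add: field_simps)
qed

section \<open>The control law in the basis of the value function\<close>

lemma \<theta>_carrier: "i < players S \<Longrightarrow> \<theta> i \<in> carrier_vec (hdim E i)"
  and phi_carrier: "i < players S \<Longrightarrow> phi E i x \<in> carrier_vec (hdim E i)"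
  and hbar_le: "i < players S \<Longrightarrow> hbar E i \<le> hdim E i"
  using phi split by (auto simp: basis_split_def)

lemma phi_differentiable:
  "i < players S \<Longrightarrow> k < hdim E i \<Longrightarrow> x \<in> states S \<Longrightarrow> (\<lambda>y. phi E i y $ k) differentiable (at x)"
  using phi C2_on_differentiable by blast

lemma phi_r_index: "l < hbar E i \<Longrightarrow> phi_r E i y $ l = phi E i y $ l"
  by (simp add: phi_r_def vec_first_def)

lemma phi_nr_index:
  "i < players S \<Longrightarrow> l < hdim E i - hbar E i \<Longrightarrow> phi_nr E i y $ l = phi E i y $ (hbar E i + l)"
  using hbar_le[of i] phi_carrier[of i y] by (simp add: phi_nr_def vec_last_def)

lemma frechet_value:
  assumes i: "i < players S" and x: "x \<in> states S"
  shows "frechet_derivative (value_fun S (Q i) (R i) \<mu>) (at x) =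
    frechet_derivative (\<lambda>y. \<theta> i \<bullet> phi E i y) (at x)"
  by (rule frechet_derivative_cong_open[OF open_states x]) (use phi i in blast)

text \<open>The gradients of the remaining basis functions are orthogonal to all input columns by
  \<open>basis_split\<close>, so the controls carry no information about their coefficients.\<close>

lemma input_grad_value_Phi_r:
  assumes i: "i < players S" and x: "x \<in> states S" and k: "k < udim S i"
  shows "input_grad S i (value_fun S (Q i) (R i) \<mu>) x $ k =
    (\<Sum>l<hbar E i. Phi_r S E i x $$ (k, l) * \<theta> i $ l)"
proof -
  let ?D = "\<lambda>l. frechet_derivative (\<lambda>y. phi E i y $ l) (at x) (input_col S i x k)"
  have h: "hdim E i = hbar E i + (hdim E i - hbar E i)" using hbar_le[OF i] by simp
  have "input_grad S i (value_fun S (Q i) (R i) \<mu>) x $ k = (\<Sum>l<hdim E i. \<theta> i $ l * ?D l)"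
    using k frechet_derivative_scalar_prod[OF phi_carrier[OF i] \<theta>_carrier[OF i] phi_differentiable[OF i _ x]]
    by (simp add: input_grad_def frechet_value[OF i x])
  also have "\<dots> = (\<Sum>l<hbar E i. \<theta> i $ l * ?D l) +
      (\<Sum>l<hdim E i - hbar E i. \<theta> i $ (hbar E i + l) * ?D (hbar E i + l))"
    by (subst h) (rule sum_lessThan_add)
  also have "(\<Sum>l<hdim E i - hbar E i. \<theta> i $ (hbar E i + l) * ?D (hbar E i + l)) = 0"
  proof (intro sum.neutral ballI)
    fix l assume "l \<in> {..<hdim E i - hbar E i}"
    then have l: "l < hdim E i - hbar E i" by simp
    have "input_grad S i (\<lambda>y. phi_nr E i y $ l) x $ k = 0"
      using split i x l k by (simp add: basis_split_def)
    then have "?D (hbar E i + l) = 0"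
      using k by (simp add: input_grad_def phi_nr_index[OF i l])
    then show "\<theta> i $ (hbar E i + l) * ?D (hbar E i + l) = 0" by simp
  qed
  finally show ?thesis
    using k by (simp add: Phi_r_def input_grad_def phi_r_index mult.commute)
qed

definition theta_star :: "nat \<Rightarrow> real Matrix.vec" where
  "theta_star i = Matrix.vec (udim S i * hbar E i)
     (\<lambda>c. \<theta> i $ (c mod hbar E i) / R i i $$ (c div hbar E i, c div hbar E i))"

lemma theta_star_carrier: "theta_star i \<in> carrier_vec (udim S i * hbar E i)"
  by (simp add: theta_star_def)

lemma block_index_less: "k < p \<Longrightarrow> l < h \<Longrightarrow> k * h + l < p * (h::nat)"
proof -
  assume "k < p" "l < h"
  then have "k * h + l < Suc k * h" by simp
  also have "\<dots> \<le> p * h" using \<open>k < p\<close> by (intro mult_le_mono1) simp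
  finally show ?thesis .
qed

lemma theta_star_index:
  "k < udim S i \<Longrightarrow> l < hbar E i \<Longrightarrow> theta_star i $ (k * hbar E i + l) = \<theta> i $ l / R i i $$ (k, k)"
  by (simp add: theta_star_def block_index_less)

lemma Phi_bar_carrier: "Phi_bar S E i x \<in> carrier_mat (udim S i) (udim S i * hbar E i)"
  by (simp add: Phi_bar_def)

lemma Phi_bar_mult:
  assumes v: "v \<in> carrier_vec (udim S i * hbar E i)" and k: "k < udim S i"
  shows "(Phi_bar S E i x *\<^sub>v v) $ k = (\<Sum>l<hbar E i. Phi_r S E i x $$ (k, l) * v $ (k * hbar E i + l))"
proof -
  let ?h = "hbar E i"
  \<comment> \<open>With separate indices for block and place the sum over the columns becomes a
    double sum, of which only the block \<open>k\<close> survives.\<close>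
  define g where "g k' l = (if k' = k then Phi_r S E i x $$ (k, l) else 0) * v $ (k' * ?h + l)" for k' l
  have "(Phi_bar S E i x *\<^sub>v v) $ k = (\<Sum>c<udim S i * ?h. Phi_bar S E i x $$ (k, c) * v $ c)"
    using v k Phi_bar_carrier[of i x] by (simp add: scalar_prod_def lessThan_atLeast0)
  also have "\<dots> = (\<Sum>c<udim S i * ?h. g (c div ?h) (c mod ?h))"
    using k by (intro sum.cong) (auto simp: Phi_bar_def g_def div_mult_mod_eq)
  also have "\<dots> = (\<Sum>k'<udim S i. \<Sum>l<?h. g k' l)" by (rule sum_div_mod)
  also have "\<dots> = (\<Sum>k'<udim S i. if k' = k then \<Sum>l<?h. g k l else 0)"
    by (intro sum.cong) (auto simp: g_def)
  finally show ?thesis using k by (simp add: g_def)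
qed

lemma \<mu>_Phi_bar:
  assumes i: "i < players S" and x: "x \<in> states S"
  shows "\<mu> i x = (- 1 / 2) \<cdot>\<^sub>v (Phi_bar S E i x *\<^sub>v theta_star i)"
proof (rule eq_vecI)
  fix k assume "k < dim_vec ((- 1 / 2) \<cdot>\<^sub>v (Phi_bar S E i x *\<^sub>v theta_star i))"
  then have k: "k < udim S i" using Phi_bar_carrier[of i x] by simp
  have "(Phi_bar S E i x *\<^sub>v theta_star i) $ k =
      (\<Sum>l<hbar E i. Phi_r S E i x $$ (k, l) * \<theta> i $ l) / R i i $$ (k, k)"
    using k by (simp add: Phi_bar_mult[OF theta_star_carrier k] theta_star_index sum_divide_distrib)
  also have "\<dots> = - 2 * \<mu> i x $ k"
    using input_grad_value[OF i x k] R_pos[OF i k]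
    by (simp add: input_grad_value_Phi_r[OF i x k, symmetric])
  finally show "\<mu> i x $ k = ((- 1 / 2) \<cdot>\<^sub>v (Phi_bar S E i x *\<^sub>v theta_star i)) $ k"
    using k Phi_bar_carrier[of i x] by simp
qed (use \<mu>_carrier[OF i] Phi_bar_carrier[of i x] in simp)

text \<open>The rows that one state contributes, so that \<open>M_u_of\<close> takes the form
  required by \<open>rank_maximal_kernel\<close>.\<close>

definition u_rows :: "nat \<Rightarrow> 's \<Rightarrow> real Matrix.vec list" where
  "u_rows i x = Matrix.rows ((-1/2) \<cdot>\<^sub>m Phi_bar S E i x)"

lemma u_rows_carrier: "set (u_rows i x) \<subseteq> carrier_vec (udim S i * hbar E i)"
  using Phi_bar_carrier[of i x] rows_carrier[of "(-1/2) \<cdot>\<^sub>m Phi_bar S E i x"] by (simp add: u_rows_def)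

lemma M_u_of_eq: "M_u_of S E i xs = mat_of_rows (udim S i * hbar E i) (concat (map (u_rows i) xs))"
  by (simp add: M_u_of_def u_rows_def[abs_def])

lemma map_u_rows:
  assumes v: "v \<in> carrier_vec (udim S i * hbar E i)"
  shows "map (\<lambda>u. u \<bullet> v) (u_rows i x) = list_of_vec ((- 1 / 2) \<cdot>\<^sub>v (Phi_bar S E i x *\<^sub>v v))"
proof -
  have "((-1/2) \<cdot>\<^sub>m Phi_bar S E i x) *\<^sub>v v = (- 1 / 2) \<cdot>\<^sub>v (Phi_bar S E i x *\<^sub>v v)"
    using Phi_bar_carrier[of i x] v by (intro eq_vecI) (auto simp: row_smult)
  then show ?thesis by (simp add: u_rows_def map_scalar_prod_rows)
qed

text \<open>The step is positive, so no sample time precedes \<open>time0 S\<close>, from which on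
  the demonstrations are constrained.\<close>

lemma demo_in_states: "d < ndemo E \<Longrightarrow> t \<in> set (sample_times S E) \<Longrightarrow> xdemo E d t \<in> states S"
  and demo_control: "d < ndemo E \<Longrightarrow> t \<in> set (sample_times S E) \<Longrightarrow> i < players S \<Longrightarrow>
    udemo E d i t = \<mu> i (xdemo E d t)"
  using demos by (auto simp: FNE_demonstrations_def solution_def sample_times_def)

lemma M_u_carrier: "M_u S E i \<in> carrier_mat (length (concat (map (u_rows i) (sample_states S E)))) (udim S i * hbar E i)"
  unfolding M_u_def M_u_of_eq by (rule mat_of_rows_carrier(1))

text \<open>Both stacks run over demonstrations, then sample times, then control components, so
  consistency at each single sample suffices.\<close>

lemma z_u_eq:
  assumes i: "i < players S"
  shows "z_u S E i = M_u S E i *\<^sub>v theta_star i"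
proof -
  let ?n = "udim S i * hbar E i"
  have rows: "set (concat (map (u_rows i) xs)) \<subseteq> carrier_vec ?n" for xs
    using u_rows_carrier by auto
  have ctrl: "map (\<lambda>u. u \<bullet> theta_star i) (u_rows i (xdemo E d t)) = list_of_vec (udemo E d i t)"
    if "d < ndemo E" "t \<in> set (sample_times S E)" for d t
    using \<mu>_Phi_bar[OF i demo_in_states[OF that]] demo_control[OF that i]
    by (simp add: map_u_rows[OF theta_star_carrier])
  have "M_u S E i *\<^sub>v theta_star i =
      vec_of_list (concat (map (\<lambda>x. map (\<lambda>u. u \<bullet> theta_star i) (u_rows i x)) (sample_states S E)))"
    unfolding M_u_def M_u_of_eq mat_of_rows_mult[OF rows] by (simp add: map_concat o_def)
  also have "concat (map (\<lambda>x. map (\<lambda>u. u \<bullet> theta_star i) (u_rows i x)) (sample_states S E)) =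
      concat (map (\<lambda>d. concat (map (\<lambda>t. list_of_vec (udemo E d i t)) (sample_times S E))) [0..<ndemo E])"
    unfolding sample_states_def concat_map_concat
    by (auto simp: o_def ctrl intro!: arg_cong[of _ _ concat] map_cong)
  finally show ?thesis by (simp add: z_u_def)
qed

lemma theta_bar_hat_carrier: "i < players S \<Longrightarrow> theta_bar_hat S E i \<in> carrier_vec (udim S i * hbar E i)"
  and M_u_theta_bar_hat: "i < players S \<Longrightarrow> M_u S E i *\<^sub>v theta_bar_hat S E i = M_u S E i *\<^sub>v theta_star i"
  using least_squares_consistent[OF M_u_carrier theta_star_carrier]
  by (simp_all only: theta_bar_hat_def z_u_eq)

lemma theta_bar_hat_diff:
  assumes i: "i < players S"
  defines "v \<equiv> theta_bar_hat S E i - theta_star i"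
  shows "v \<in> carrier_vec (udim S i * hbar E i)"
    "M_u S E i *\<^sub>v v = 0\<^sub>v (length (concat (map (u_rows i) (sample_states S E))))"
proof -
  show "v \<in> carrier_vec (udim S i * hbar E i)"
    using theta_bar_hat_carrier[OF i] theta_star_carrier by (simp add: v_def)
  have "M_u S E i *\<^sub>v v = M_u S E i *\<^sub>v theta_star i - M_u S E i *\<^sub>v theta_star i"
    unfolding v_def mult_minus_distrib_mat_vec[OF M_u_carrier theta_bar_hat_carrier[OF i] theta_star_carrier]
      M_u_theta_bar_hat[OF i] ..
  also have "\<dots> = 0\<^sub>v (length (concat (map (u_rows i) (sample_states S E))))"
    by (rule minus_cancel_vec) (rule mult_mat_vec_carrier[OF M_u_carrier theta_star_carrier])
  finally show "M_u S E i *\<^sub>v v = 0\<^sub>v (length (concat (map (u_rows i) (sample_states S E))))" .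
qed

text \<open>\<open>theta_bar_hat\<close> may differ from \<open>theta_star\<close>, but the
  difference is in the kernel of \<open>M_u\<close> and therefore invisible to
  \<open>Phi_bar\<close> at every state.\<close>

lemma mu_hat_eq:
  assumes i: "i < players S" and x: "x \<in> states S"
  shows "mu_hat S E i x = \<mu> i x"
proof -
  let ?n = "udim S i * hbar E i"
  define v where "v = theta_bar_hat S E i - theta_star i"
  note v = theta_bar_hat_diff[OF i, folded v_def]
  have row: "vec ?n (\<lambda>j. u $ j) = u" if "u \<in> set (u_rows i y)" for u y
    using u_rows_carrier[of i y] that by (intro eq_vecI) auto
  have zero: "u \<bullet> v = 0" if "y \<in> set (sample_states S E)" "u \<in> set (u_rows i y)" for u y
  proof -
    have "u \<in> set (concat (map (u_rows i) (sample_states S E)))" using that by auto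
    then have "vec ?n (\<lambda>j. u $ j) \<bullet> v = 0"
      using v(2)[unfolded M_u_def M_u_of_eq mat_of_rows_mult_eq_0_iff] by blast
    then show ?thesis unfolding row[OF that(2)] .
  qed
  have "u \<bullet> v = 0" if u: "u \<in> set (u_rows i x)" for u
  proof (rule rank_maximal_kernel[of "u_rows i"])
    show "rank_maximal (states S) (\<lambda>xs. mat_of_rows ?n (concat (map (u_rows i) xs))) (sample_states S E)"
      using rank_u i by (simp add: M_u_of_eq[abs_def])
  qed (use u_rows_carrier v(1) x zero u in auto)
  then have zeros: "\<forall>a\<in>set (map (\<lambda>u. u \<bullet> v) (u_rows i x)). a = 0" by simp
  have zero': "((- 1 / 2) \<cdot>\<^sub>v (Phi_bar S E i x *\<^sub>v v)) $ k = 0" if "k < udim S i" for k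
  proof -
    let ?w = "(- 1 / 2) \<cdot>\<^sub>v (Phi_bar S E i x *\<^sub>v v)"
    have "k < length (list_of_vec ?w)" using that carrier_matD[OF Phi_bar_carrier[of i x]] by simp
    then have "list_of_vec ?w ! k \<in> set (list_of_vec ?w)" by (rule nth_mem)
    with zeros show ?thesis unfolding map_u_rows[OF v(1)] list_of_vec_index by blast
  qed
  have split: "Phi_bar S E i x *\<^sub>v v = Phi_bar S E i x *\<^sub>v theta_bar_hat S E i - Phi_bar S E i x *\<^sub>v theta_star i"
    unfolding v_def
    by (rule mult_minus_distrib_mat_vec[OF Phi_bar_carrier theta_bar_hat_carrier[OF i] theta_star_carrier])
  show ?thesis
    unfolding \<mu>_Phi_bar[OF i x] mu_hat_def
  proof (rule eq_vecI)
    fix k assume "k < dim_vec ((- 1 / 2) \<cdot>\<^sub>v (Phi_bar S E i x *\<^sub>v theta_star i))"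
    then have "k < udim S i" using Phi_bar_carrier[of i x] by simp
    then show "((- 1 / 2) \<cdot>\<^sub>v (Phi_bar S E i x *\<^sub>v theta_bar_hat S E i)) $ k =
        ((- 1 / 2) \<cdot>\<^sub>v (Phi_bar S E i x *\<^sub>v theta_star i)) $ k"
      using zero'[of k] Phi_bar_carrier[of i x] unfolding split by simp
  qed simp
qed

lemma mu_hat_carrier: "mu_hat S E i x \<in> carrier_vec (udim S i)"
  using Phi_bar_carrier[of i x] by (simp add: mu_hat_def carrier_vecI)

text \<open>With trivial kernel the stacked vector itself is recovered. Its blocks are positive
  multiples of one vector, so normalising each of them removes the unknown weights and the average
  is taken over equal vectors.\<close>

lemma theta_r_hat_eq:
  assumes i: "i < players S" and full: "full_rank_u S E i"
  shows "\<exists>c>0. theta_r_hat S E i = c \<cdot>\<^sub>v vec_first (\<theta> i) (hbar E i)"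
proof -
  let ?h = "hbar E i" and ?p = "udim S i" and ?\<theta> = "vec_first (\<theta> i) (hbar E i)"
  have "mat_rank (M_u S E i) = ?p * ?h" using full by (simp add: full_rank_u_def)
  from mat_kernel_full_rank[OF M_u_carrier this theta_bar_hat_diff[OF i]]
  have hat: "theta_bar_hat S E i = theta_star i"
    by (rule vec_minus_eq_0[OF theta_bar_hat_carrier[OF i] theta_star_carrier])
  define n where "n = vec_norm2 ?\<theta>"
  have P: "block_sel ?p ?h j *\<^sub>v theta_star i = (1 / R i i $$ (j, j)) \<cdot>\<^sub>v ?\<theta>" if j: "j < ?p" for j
  proof (rule eq_vecI)
    fix l assume "l < dim_vec ((1 / R i i $$ (j, j)) \<cdot>\<^sub>v ?\<theta>)"
    then have l: "l < ?h" by simp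
    have "(block_sel ?p ?h j *\<^sub>v theta_star i) $ l =
        (\<Sum>c<?p * ?h. (if c = j * ?h + l then 1 else 0) * theta_star i $ c)"
      using l theta_star_carrier[of i] by (simp add: block_sel_def scalar_prod_def lessThan_atLeast0)
    also have "\<dots> = (\<Sum>c<?p * ?h. if c = j * ?h + l then theta_star i $ (j * ?h + l) else 0)"
      by (intro sum.cong) auto
    also have "\<dots> = \<theta> i $ l / R i i $$ (j, j)"
      using block_index_less[OF j l] theta_star_index[OF j l] by simp
    finally show "(block_sel ?p ?h j *\<^sub>v theta_star i) $ l = ((1 / R i i $$ (j, j)) \<cdot>\<^sub>v ?\<theta>) $ l"
      using l by (simp add: vec_first_def)
  qed (simp add: block_sel_def)
  have norm: "vec_norm2 (a \<cdot>\<^sub>v ?\<theta>) = a * n" if "a > 0" for a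
  proof -
    have "(a \<cdot>\<^sub>v ?\<theta>) \<bullet> (a \<cdot>\<^sub>v ?\<theta>) = a\<^sup>2 * (?\<theta> \<bullet> ?\<theta>)" by (simp add: power2_eq_square)
    then show ?thesis using that by (simp add: vec_norm2_def n_def real_sqrt_mult)
  qed
  have p: "?p \<ge> 1" using game i by (auto simp: differential_game_def)
  have eq: "theta_r_hat S E i $ l = \<theta> i $ l / n" if l: "l < ?h" for l
  proof -
    have "(\<Sum>j<?p. (block_sel ?p ?h j *\<^sub>v theta_star i) $ l / vec_norm2 (block_sel ?p ?h j *\<^sub>v theta_star i))
       = (\<Sum>j<?p. \<theta> i $ l / n)"
    proof (intro sum.cong refl)
      fix j assume "j \<in> {..<?p}"
      then have j: "j < ?p" by simp
      then show "(block_sel ?p ?h j *\<^sub>v theta_star i) $ l / vec_norm2 (block_sel ?p ?h j *\<^sub>v theta_star i) = \<theta> i $ l / n"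
        using R_pos[OF i j] l by (simp add: P[OF j] norm) (simp add: vec_first_def)
    qed
    then show ?thesis using l p by (simp add: theta_r_hat_def hat Let_def)
  qed
  have dim: "dim_vec (theta_r_hat S E i) = ?h" by (simp add: theta_r_hat_def Let_def)
  show ?thesis
  \<comment> \<open>If the leading coefficients are all zero, the division by \<open>n = 0\<close>
    returns 0, and any factor would serve; 1 is taken.\<close>
  proof (cases "n = 0")
    case True
    then have "?\<theta> \<bullet> ?\<theta> = 0" by (simp add: n_def vec_norm2_def)
    then have "?\<theta> = 0\<^sub>v ?h" by (rule scalar_prod_self_eq_0[OF vec_first_carrier])
    moreover have "theta_r_hat S E i = 0\<^sub>v ?h" using eq True dim by (intro eq_vecI) auto
    ultimately show ?thesis by (intro exI[of _ 1]) simp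
  next
    case False
    have "0 \<le> n"
      by (auto simp: n_def vec_norm2_def scalar_prod_def intro!: real_sqrt_ge_zero sum_nonneg)
    with False have "1 / n > 0" by simp
    moreover have "theta_r_hat S E i = (1 / n) \<cdot>\<^sub>v ?\<theta>"
      using eq dim by (intro eq_vecI) (auto simp: vec_first_def)
    ultimately show ?thesis by blast
  qed
qed

section \<open>Positive multiples of the true parameters\<close>

lemma Q_of_scale: "i < players S \<Longrightarrow> x \<in> states S \<Longrightarrow> Q_of E i (c \<cdot>\<^sub>v \<beta> i) x = c * Q i x"
proof -
  assume i: "i < players S" and x: "x \<in> states S"
  have "(c \<cdot>\<^sub>v \<beta> i) \<bullet> psi E i x = c * (\<beta> i \<bullet> psi E i x)"
    using psi i by (intro smult_scalar_prod_distrib[of _ "mdim E i"]) auto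
  then show ?thesis using psi i x by (simp add: Q_of_def)
qed

lemma R_of_scale: "i < players S \<Longrightarrow> j < players S \<Longrightarrow> R_of S (c \<cdot>\<^sub>v alpha_of S (R i)) j = c \<cdot>\<^sub>m R i j"
  by (rule R_of_smult_alpha_of) (use R_carrier R_diag in auto)

lemma alpha_carrier: "i < players S \<Longrightarrow> alpha_of S (R i) \<in> carrier_vec (total_udim S)"
  by (rule alpha_of_carrier) (rule R_carrier)

lemma running_cost_scale:
  assumes i: "i < players S" and x: "x \<in> states S"
    and agree: "\<And>j. j < players S \<Longrightarrow> \<nu>' j x = \<nu> j x"
    and carrier: "\<And>j. j < players S \<Longrightarrow> \<nu> j x \<in> carrier_vec (udim S j)"
  shows "running_cost S (Q_of E i (c \<cdot>\<^sub>v \<beta> i)) (R_of S (c \<cdot>\<^sub>v alpha_of S (R i))) \<nu>' x =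
    c * running_cost S (Q i) (R i) \<nu> x"
proof -
  have "\<nu>' j x \<bullet> (R_of S (c \<cdot>\<^sub>v alpha_of S (R i)) j *\<^sub>v \<nu>' j x) = c * (\<nu> j x \<bullet> (R i j *\<^sub>v \<nu> j x))"
    if j: "j < players S" for j
    unfolding agree[OF j] diagonal_quadratic_form[OF R_of_diagonal(1,2) carrier[OF j]]
      diagonal_quadratic_form[OF R_carrier[OF i j] R_diag[OF i j] carrier[OF j]]
    using R_carrier[OF i j] by (simp add: R_of_scale[OF i j] sum_distrib_left mult.assoc)
  then show ?thesis
    by (simp add: running_cost_def Q_of_scale[OF i x] sum_distrib_left distrib_left)
qed

text \<open>A positive factor does not change which strategy is best. The equilibrium property
  supplies optimality and the coupled HJB equations the gradient condition, both in scaled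
  form.\<close>

lemma params_ok_scale:
  assumes i: "i < players S" and c: "c > 0"
  shows "params_ok S E i (c \<cdot>\<^sub>v alpha_of S (R i), c \<cdot>\<^sub>v \<beta> i)"
proof -
  let ?\<nu> = "mu_hat S E"
  define q where "q = Q_of E i (c \<cdot>\<^sub>v \<beta> i)"
  define r where "r = R_of S (c \<cdot>\<^sub>v alpha_of S (R i))"
  let ?V = "value_fun S (Q i) (R i) \<mu>" and ?W = "value_fun S q r ?\<nu>"
  have st: "stabilizing S \<mu>" using admissible_\<mu>[OF i] by (simp add: admissible_def)
  have agree: "\<And>j x. j < players S \<Longrightarrow> x \<in> states S \<Longrightarrow> \<mu> j x = ?\<nu> j x"
    by (simp add: mu_hat_eq)
  have cost: "running_cost S q r ?\<nu> x = c * running_cost S (Q i) (R i) \<mu> x" if "x \<in> states S" for x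
    unfolding q_def r_def by (rule running_cost_scale[OF i that]) (use mu_hat_eq \<mu>_carrier that in auto)
  have W: "?W x = c * ?V x" if "x \<in> states S" for x
    by (rule value_fun_scale[OF agree cost st that])
  have adm: "admissible S q r i ?\<nu>"
    by (rule admissible_scale[OF agree cost i open_states zero_in_states mu_hat_carrier admissible_\<mu>[OF i]])
  have opt: "is_optimal S q r i ?\<nu>"
    unfolding is_optimal_def
  proof (intro conjI adm allI impI ballI)
    fix \<nu> x assume \<nu>: "admissible S q r i (?\<nu>(i := \<nu>))" and x: "x \<in> states S"
    have \<nu>c: "\<nu> y \<in> carrier_vec (udim S i)" for y using \<nu> by (simp add: admissible_def)
    \<comment> \<open>A deviation is carried from the identified to the true profile, where the
      equilibrium inequality is available; the roles are reversed here, hence the factor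
      \<open>1 / c\<close>.\<close>
    have agree': "\<And>j y. j < players S \<Longrightarrow> y \<in> states S \<Longrightarrow> (?\<nu>(i := \<nu>)) j y = (\<mu>(i := \<nu>)) j y"
      by (simp add: mu_hat_eq)
    have cost': "running_cost S (Q i) (R i) (\<mu>(i := \<nu>)) y = (1 / c) * running_cost S q r (?\<nu>(i := \<nu>)) y"
      if y: "y \<in> states S" for y
    proof -
      have "running_cost S q r (?\<nu>(i := \<nu>)) y = c * running_cost S (Q i) (R i) (\<mu>(i := \<nu>)) y"
        unfolding q_def r_def
        by (rule running_cost_scale[OF i y]) (use agree'[OF _ y] \<nu>c \<mu>_carrier in auto)
      then show ?thesis using c by simp
    qed
    have "admissible S (Q i) (R i) i (\<mu>(i := \<nu>))"
      by (rule admissible_scale[OF agree' cost' i open_states zero_in_states _ \<nu>]) (use \<nu>c in auto)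
    then have "?V x \<le> value_fun S (Q i) (R i) (\<mu>(i := \<nu>)) x"
      using FNE i x unfolding is_unique_FNE_def is_FNE_def by blast
    also have "\<dots> = (1 / c) * value_fun S q r (?\<nu>(i := \<nu>)) x"
      by (rule value_fun_scale[OF agree' cost' _ x]) (use \<nu> in \<open>simp_all add: admissible_def\<close>)
    finally show "?W x \<le> value_fun S q r (?\<nu>(i := \<nu>)) x"
      using c W[OF x] by (simp add: field_simps)
  qed
  have DW: "frechet_derivative ?W (at x) v = c * frechet_derivative ?V (at x) v" if x: "x \<in> states S" for x v
  proof -
    have "frechet_derivative ?W (at x) = frechet_derivative (\<lambda>y. c * ?V y) (at x)"
      by (rule frechet_derivative_cong_open[OF open_states x W])
    also have "\<dots> = (\<lambda>v. c * frechet_derivative ?V (at x) v)"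
      by (rule frechet_derivative_at[symmetric], rule has_derivative_mult_right)
        (use C2_on_differentiable[OF C2_value[OF i] x] frechet_derivative_works in blast)
    finally show ?thesis by simp
  qed
  have "decoupled_HJB_nec_suff S q r i ?\<nu>"
  proof (rule decoupled_HJB_nec_suffI[OF i open_states zero_in_states opt])
    show "?W 0 = 0" using W[OF zero_in_states] value_at_0[OF i] by simp
    have "HJB_eq S (Q i) (R i) \<mu> ?V" using coupled_HJB_\<mu> i unfolding coupled_HJB_def by blast
    then show "HJB_eq S q r ?\<nu> ?W"
      unfolding HJB_eq_iff using DW cost closed_loop_cong[of S ?\<nu> _ \<mu>] mu_hat_eq by simp
    show "r i \<in> carrier_mat (udim S i) (udim S i)" "diagonal_mat (r i)"
      by (simp_all add: r_def R_of_diagonal)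
    fix k assume k: "k < udim S i"
    have rk: "r i $$ (k, k) = c * R i i $$ (k, k)"
      using R_carrier[OF i i] k by (simp add: r_def R_of_scale[OF i i])
    then show "0 < r i $$ (k, k)" using c R_pos[OF i k] by simp
    fix x assume x: "x \<in> states S"
    have "input_grad S i ?W x $ k = c * input_grad S i ?V x $ k"
      using k DW[OF x] by (simp add: input_grad_def)
    then show "input_grad S i ?W x $ k = - 2 * (r i $$ (k, k)) * ?\<nu> i x $ k"
      using input_grad_value[OF i x k] rk mu_hat_eq[OF i x] by simp
  qed
  then show ?thesis by (simp add: params_ok_def q_def r_def)
qed

section \<open>The HJB data as residuals of the decoupled HJB equation\<close>

definition hjb_row :: "nat \<Rightarrow> 's \<Rightarrow> real Matrix.vec" where
  "hjb_row i x = (squared_controls S (mu_hat S E) x @\<^sub>v psi E i x) @\<^sub>v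
     jac_apply (hdim E i) (phi E i) x (closed_loop S (mu_hat S E) x)"

definition hjb_row_r :: "nat \<Rightarrow> 's \<Rightarrow> real Matrix.vec" where
  "hjb_row_r i x = (squared_controls S (mu_hat S E) x @\<^sub>v psi E i x) @\<^sub>v
     jac_apply (hdim E i - hbar E i) (phi_nr E i) x (closed_loop S (mu_hat S E) x)"

lemma jac_apply_carrier: "jac_apply d F x v \<in> carrier_vec d"
  by (simp add: jac_apply_def)

lemma psi_carrier: "i < players S \<Longrightarrow> psi E i x \<in> carrier_vec (mdim E i)"
  and \<beta>_carrier: "i < players S \<Longrightarrow> \<beta> i \<in> carrier_vec (mdim E i)"
  using psi by auto

lemma squared_psi_carrier:
  "i < players S \<Longrightarrow> squared_controls S (mu_hat S E) x @\<^sub>v psi E i x \<in> carrier_vec (total_udim S + mdim E i)"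
  by (intro append_carrier_vec squared_controls_carrier psi_carrier)

lemma squared_psi_scalar_prod:
  assumes i: "i < players S"
    and \<alpha>': "\<alpha>' \<in> carrier_vec (total_udim S)" and \<beta>': "\<beta>' \<in> carrier_vec (mdim E i)"
    and u: "u \<in> carrier_vec d" and \<gamma>: "\<gamma> \<in> carrier_vec d"
  shows "((squared_controls S (mu_hat S E) x @\<^sub>v psi E i x) @\<^sub>v u) \<bullet> ((\<alpha>' @\<^sub>v \<beta>') @\<^sub>v \<gamma>) =
    running_cost S (Q_of E i \<beta>') (R_of S \<alpha>') (mu_hat S E) x + \<gamma> \<bullet> u"
proof -
  have "((squared_controls S (mu_hat S E) x @\<^sub>v psi E i x) @\<^sub>v u) \<bullet> ((\<alpha>' @\<^sub>v \<beta>') @\<^sub>v \<gamma>) =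
      (squared_controls S (mu_hat S E) x @\<^sub>v psi E i x) \<bullet> (\<alpha>' @\<^sub>v \<beta>') + u \<bullet> \<gamma>"
    by (rule scalar_prod_append[of _ "total_udim S + mdim E i" _ d])
      (use squared_psi_carrier[OF i] append_carrier_vec[OF \<alpha>' \<beta>'] u \<gamma> in auto)
  also have "(squared_controls S (mu_hat S E) x @\<^sub>v psi E i x) \<bullet> (\<alpha>' @\<^sub>v \<beta>') =
      squared_controls S (mu_hat S E) x \<bullet> \<alpha>' + psi E i x \<bullet> \<beta>'"
    by (rule scalar_prod_append[OF squared_controls_carrier psi_carrier[OF i] \<alpha>' \<beta>'])
  also have "psi E i x \<bullet> \<beta>' = \<beta>' \<bullet> psi E i x"
    by (rule comm_scalar_prod[OF psi_carrier[OF i] \<beta>'])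
  also have "u \<bullet> \<gamma> = \<gamma> \<bullet> u" by (rule comm_scalar_prod[OF u \<gamma>])
  finally show ?thesis
    by (simp add: running_cost_R_of[OF \<alpha>' mu_hat_carrier] Q_of_def)
qed

lemma jac_phi_split:
  assumes i: "i < players S"
  shows "jac_apply (hdim E i) (phi E i) x v =
    jac_apply (hbar E i) (phi_r E i) x v @\<^sub>v jac_apply (hdim E i - hbar E i) (phi_nr E i) x v"
proof (rule eq_vecI)
  fix k assume "k < dim_vec (jac_apply (hbar E i) (phi_r E i) x v @\<^sub>v
      jac_apply (hdim E i - hbar E i) (phi_nr E i) x v)"
  then have k: "k < hdim E i" using hbar_le[OF i] by (simp add: jac_apply_def)
  show "jac_apply (hdim E i) (phi E i) x v $ k = (jac_apply (hbar E i) (phi_r E i) x v @\<^sub>v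
      jac_apply (hdim E i - hbar E i) (phi_nr E i) x v) $ k"
  proof (cases "k < hbar E i")
    case True
    then show ?thesis using k by (simp add: jac_apply_def phi_r_index)
  next
    case False
    then have "k - hbar E i < hdim E i - hbar E i" using k by simp
    then have "(\<lambda>y. phi_nr E i y $ (k - hbar E i)) = (\<lambda>y. phi E i y $ k)"
      using False by (simp add: phi_nr_index[OF i])
    from arg_cong[OF this, of "\<lambda>F. frechet_derivative F (at x) v"]
    show ?thesis using k False by (simp add: jac_apply_def)
  qed
qed (use hbar_le[OF i] in \<open>simp add: jac_apply_def\<close>)

text \<open>The decoupled HJB expression for the candidate value with coefficients
  \<open>\<gamma>\<close>. It is linear in the three parameter vectors jointly, and a data row is
  its coefficient vector.\<close>

abbreviation residual :: "nat \<Rightarrow> real Matrix.vec \<Rightarrow> real Matrix.vec \<Rightarrow> real Matrix.vec \<Rightarrow> 's \<Rightarrow> real" where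
  "residual i \<alpha>' \<beta>' \<gamma> x \<equiv> running_cost S (Q_of E i \<beta>') (R_of S \<alpha>') (mu_hat S E) x
     + \<gamma> \<bullet> jac_apply (hdim E i) (phi E i) x (closed_loop S (mu_hat S E) x)"

text \<open>The HJB equation is homogeneous in costs and value together, so a common factor
  \<open>c\<close> comes out; on the state set \<open>mu_hat\<close> can be replaced by
  \<open>\<mu>\<close>.\<close>

lemma residual_true:
  assumes i: "i < players S" and x: "x \<in> states S"
  shows "residual i (c \<cdot>\<^sub>v alpha_of S (R i)) (c \<cdot>\<^sub>v \<beta> i) (c \<cdot>\<^sub>v \<theta> i) x = 0"
proof -
  let ?J = "jac_apply (hdim E i) (phi E i) x (closed_loop S (mu_hat S E) x)"
  have jac: "frechet_derivative (\<lambda>y. \<theta> i \<bullet> phi E i y) (at x) v = \<theta> i \<bullet> jac_apply (hdim E i) (phi E i) x v" for v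
    by (rule frechet_derivative_scalar_prod_jac[OF phi_carrier[OF i] \<theta>_carrier[OF i]])
      (rule phi_differentiable[OF i _ x])
  have cl: "closed_loop S (mu_hat S E) x = closed_loop S \<mu> x"
    by (rule closed_loop_cong) (rule mu_hat_eq[OF _ x])
  have "running_cost S (Q_of E i (c \<cdot>\<^sub>v \<beta> i)) (R_of S (c \<cdot>\<^sub>v alpha_of S (R i))) (mu_hat S E) x =
      c * running_cost S (Q i) (R i) \<mu> x"
    by (rule running_cost_scale[OF i x]) (use mu_hat_eq[OF _ x] \<mu>_carrier in auto)
  moreover have "(c \<cdot>\<^sub>v \<theta> i) \<bullet> ?J = c * (\<theta> i \<bullet> ?J)"
    by (rule smult_scalar_prod_distrib[OF \<theta>_carrier[OF i] jac_apply_carrier])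
  moreover have "HJB_eq S (Q i) (R i) \<mu> (value_fun S (Q i) (R i) \<mu>)"
    using coupled_HJB_\<mu> i unfolding coupled_HJB_def by blast
  then have "frechet_derivative (value_fun S (Q i) (R i) \<mu>) (at x) (closed_loop S \<mu> x) =
      - running_cost S (Q i) (R i) \<mu> x"
    using x unfolding HJB_eq_iff by blast
  then have "\<theta> i \<bullet> ?J = - running_cost S (Q i) (R i) \<mu> x"
    unfolding frechet_value[OF i x] jac cl .
  ultimately show ?thesis by (simp add: cl)
qed

lemma hjb_row_carrier: "i < players S \<Longrightarrow> hjb_row i x \<in> carrier_vec (total_udim S + mdim E i + hdim E i)"
  unfolding hjb_row_def by (intro append_carrier_vec squared_psi_carrier jac_apply_carrier)

lemma hjb_row_r_carrier:
  "i < players S \<Longrightarrow> hjb_row_r i x \<in> carrier_vec (total_udim S + mdim E i + (hdim E i - hbar E i))"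
  unfolding hjb_row_r_def by (intro append_carrier_vec squared_psi_carrier jac_apply_carrier)

lemma hjb_row_scalar_prod:
  assumes "i < players S" "\<alpha>' \<in> carrier_vec (total_udim S)" "\<beta>' \<in> carrier_vec (mdim E i)"
    "\<gamma> \<in> carrier_vec (hdim E i)"
  shows "hjb_row i x \<bullet> ((\<alpha>' @\<^sub>v \<beta>') @\<^sub>v \<gamma>) = residual i \<alpha>' \<beta>' \<gamma> x"
  unfolding hjb_row_def by (rule squared_psi_scalar_prod[OF assms(1-3) jac_apply_carrier assms(4)])

text \<open>The reduced row lacks the columns of the leading basis functions; with their
  coefficients fixed as \<open>\<theta>'\<close>, that contribution moves to the data side.\<close>

lemma hjb_row_r_scalar_prod:
  assumes i: "i < players S" and \<alpha>': "\<alpha>' \<in> carrier_vec (total_udim S)" "\<beta>' \<in> carrier_vec (mdim E i)"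
    and \<gamma>: "\<gamma> \<in> carrier_vec (hdim E i - hbar E i)" and \<theta>': "\<theta>' \<in> carrier_vec (hbar E i)"
  shows "hjb_row_r i x \<bullet> ((\<alpha>' @\<^sub>v \<beta>') @\<^sub>v \<gamma>) = residual i \<alpha>' \<beta>' (\<theta>' @\<^sub>v \<gamma>) x
    - \<theta>' \<bullet> jac_apply (hbar E i) (phi_r E i) x (closed_loop S (mu_hat S E) x)"
  unfolding hjb_row_r_def squared_psi_scalar_prod[OF i \<alpha>' jac_apply_carrier \<gamma>] jac_phi_split[OF i]
    scalar_prod_append[OF \<theta>' \<gamma> jac_apply_carrier jac_apply_carrier]
  by simp

lemma M_hjb_of_eq: "M_hjb_of S E i xs = mat_of_rows (total_udim S + mdim E i + hdim E i) (map (hjb_row i) xs)"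
  by (simp add: M_hjb_of_def hjb_row_def[abs_def])

lemma M_hjb_r_of_eq:
  "M_hjb_r_of S E i xs = mat_of_rows (total_udim S + mdim E i + (hdim E i - hbar E i)) (map (hjb_row_r i) xs)"
  by (simp add: M_hjb_r_of_def hjb_row_r_def[abs_def])

lemma M_hjb_carrier: "M_hjb S E i \<in> carrier_mat (length (hjb_points E)) (total_udim S + mdim E i + hdim E i)"
  by (simp add: M_hjb_def M_hjb_of_eq carrier_matI)

lemma M_hjb_r_carrier:
  "M_hjb_r S E i \<in> carrier_mat (length (hjb_points E)) (total_udim S + mdim E i + (hdim E i - hbar E i))"
  by (simp add: M_hjb_r_def M_hjb_r_of_eq carrier_matI)

lemma M_hjb_mult:
  "i < players S \<Longrightarrow> M_hjb S E i *\<^sub>v y = vec_of_list (map (\<lambda>x. hjb_row i x \<bullet> y) (hjb_points E))"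
  unfolding M_hjb_def M_hjb_of_eq
  by (subst mat_of_rows_mult) (use hjb_row_carrier in \<open>auto simp: o_def\<close>)

lemma M_hjb_r_mult:
  "i < players S \<Longrightarrow> M_hjb_r S E i *\<^sub>v y = vec_of_list (map (\<lambda>x. hjb_row_r i x \<bullet> y) (hjb_points E))"
  unfolding M_hjb_r_def M_hjb_r_of_eq
  by (subst mat_of_rows_mult) (use hjb_row_r_carrier in \<open>auto simp: o_def\<close>)

lemma vec_of_list_map_eq_iff: "vec_of_list (map f xs) = vec_of_list (map g xs) \<longleftrightarrow> (\<forall>x\<in>set xs. f x = g x)"
proof
  assume "vec_of_list (map f xs) = vec_of_list (map g xs)"
  from arg_cong[OF this, of list_of_vec] show "\<forall>x\<in>set xs. f x = g x"
    unfolding list_vec map_eq_conv .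
qed (simp cong: map_cong)

lemma z_hjb_eq: "z_hjb E = vec_of_list (map (\<lambda>x. 0) (hjb_points E))"
  by (intro eq_vecI) (simp_all add: z_hjb_def vec_of_list_index)

lemma hjb_row_extends:
  assumes i: "i < players S" and full: "\<not> full_rank_u S E i" and x: "x \<in> states S"
    and v: "v \<in> carrier_vec (total_udim S + mdim E i + hdim E i)"
    and zero: "\<And>y. y \<in> set (hjb_points E) \<Longrightarrow> hjb_row i y \<bullet> v = 0"
  shows "hjb_row i x \<bullet> v = 0"
proof (rule rank_maximal_kernel[where rws = "\<lambda>x. [hjb_row i x]" and x = x and xs = "hjb_points E"])
  show "rank_maximal (states S) (\<lambda>xs. mat_of_rows (total_udim S + mdim E i + hdim E i)
      (concat (map (\<lambda>x. [hjb_row i x]) xs))) (hjb_points E)"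
    using rank_hjb i full by (simp add: M_hjb_of_eq[abs_def])
qed (use hjb_row_carrier[OF i] v x zero in auto)

lemma hjb_row_r_extends:
  assumes i: "i < players S" and full: "full_rank_u S E i" and x: "x \<in> states S"
    and v: "v \<in> carrier_vec (total_udim S + mdim E i + (hdim E i - hbar E i))"
    and zero: "\<And>y. y \<in> set (hjb_points E) \<Longrightarrow> hjb_row_r i y \<bullet> v = 0"
  shows "hjb_row_r i x \<bullet> v = 0"
proof (rule rank_maximal_kernel[where rws = "\<lambda>x. [hjb_row_r i x]" and x = x and xs = "hjb_points E"])
  show "rank_maximal (states S) (\<lambda>xs. mat_of_rows (total_udim S + mdim E i + (hdim E i - hbar E i))
      (concat (map (\<lambda>x. [hjb_row_r i x]) xs))) (hjb_points E)"
    using rank_hjb i full by (simp add: M_hjb_r_of_eq[abs_def])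
qed (use hjb_row_r_carrier[OF i] v x zero in auto)

lemma \<theta>_split:
  assumes i: "i < players S"
  shows "c \<cdot>\<^sub>v \<theta> i = (c \<cdot>\<^sub>v vec_first (\<theta> i) (hbar E i)) @\<^sub>v (c \<cdot>\<^sub>v vec_last (\<theta> i) (hdim E i - hbar E i))"
proof (rule eq_vecI)
  fix k assume "k < dim_vec ((c \<cdot>\<^sub>v vec_first (\<theta> i) (hbar E i)) @\<^sub>v (c \<cdot>\<^sub>v vec_last (\<theta> i) (hdim E i - hbar E i)))"
  then have "k < hdim E i" using hbar_le[OF i] by simp
  then show "(c \<cdot>\<^sub>v \<theta> i) $ k =
      ((c \<cdot>\<^sub>v vec_first (\<theta> i) (hbar E i)) @\<^sub>v (c \<cdot>\<^sub>v vec_last (\<theta> i) (hdim E i - hbar E i))) $ k"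
    using carrier_vecD[OF \<theta>_carrier[OF i]] hbar_le[OF i] by (auto simp: vec_first_def vec_last_def)
qed (use carrier_vecD[OF \<theta>_carrier[OF i]] hbar_le[OF i] in simp)

lemma M_hjb_true:
  assumes i: "i < players S"
  shows "M_hjb S E i *\<^sub>v (((c \<cdot>\<^sub>v alpha_of S (R i)) @\<^sub>v (c \<cdot>\<^sub>v \<beta> i)) @\<^sub>v (c \<cdot>\<^sub>v \<theta> i)) = z_hjb E"
proof -
  have "hjb_row i x \<bullet> (((c \<cdot>\<^sub>v alpha_of S (R i)) @\<^sub>v (c \<cdot>\<^sub>v \<beta> i)) @\<^sub>v (c \<cdot>\<^sub>v \<theta> i)) = 0"
    if "x \<in> set (hjb_points E)" for x
    using hjb_row_scalar_prod[OF i, of "c \<cdot>\<^sub>v alpha_of S (R i)" "c \<cdot>\<^sub>v \<beta> i" "c \<cdot>\<^sub>v \<theta> i" x]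
      alpha_carrier[OF i] \<beta>_carrier[OF i] \<theta>_carrier[OF i] residual_true[OF i, of x c] points that by auto
  then show ?thesis
    unfolding M_hjb_mult[OF i] z_hjb_eq vec_of_list_map_eq_iff by blast
qed

text \<open>The scale \<open>c\<close> of \<open>theta_r_hat\<close> is imposed on all other
  parameters, and with it the inhomogeneous system has an exact solution.\<close>

lemma z_hjb_r_eq:
  assumes i: "i < players S" and c: "theta_r_hat S E i = c \<cdot>\<^sub>v vec_first (\<theta> i) (hbar E i)"
  shows "M_hjb_r S E i *\<^sub>v (((c \<cdot>\<^sub>v alpha_of S (R i)) @\<^sub>v (c \<cdot>\<^sub>v \<beta> i)) @\<^sub>v
      (c \<cdot>\<^sub>v vec_last (\<theta> i) (hdim E i - hbar E i))) = z_hjb_r S E i"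
  unfolding M_hjb_r_mult[OF i] z_hjb_r_def vec_of_list_map_eq_iff
proof
  fix x assume "x \<in> set (hjb_points E)"
  then have x: "x \<in> states S" using points by blast
  have t: "theta_r_hat S E i \<in> carrier_vec (hbar E i)" unfolding c by simp
  show "hjb_row_r i x \<bullet> (((c \<cdot>\<^sub>v alpha_of S (R i)) @\<^sub>v (c \<cdot>\<^sub>v \<beta> i)) @\<^sub>v
      (c \<cdot>\<^sub>v vec_last (\<theta> i) (hdim E i - hbar E i))) =
    - (theta_r_hat S E i \<bullet> jac_apply (hbar E i) (phi_r E i) x (closed_loop S (mu_hat S E) x))"
    by (subst hjb_row_r_scalar_prod[OF i _ _ _ t])
      (use alpha_carrier[OF i] \<beta>_carrier[OF i] residual_true[OF i x, of c, unfolded \<theta>_split[OF i], folded c] in auto)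
qed

lemma ls_params_r_iff:
  assumes i: "i < players S" and c: "theta_r_hat S E i = c \<cdot>\<^sub>v vec_first (\<theta> i) (hbar E i)"
  shows "ls_params_r S E i = {(c \<cdot>\<^sub>v alpha_of S (R i), c \<cdot>\<^sub>v \<beta> i)} \<longleftrightarrow>
    ls_freedom (L_r S E i) (M_hjb_r S E i) =
      0\<^sub>m (total_udim S + mdim E i) (total_udim S + mdim E i + (hdim E i - hbar E i))"
  unfolding ls_params_r_def L_r_def
  by (rule ls_params_singleton_iff[OF M_hjb_r_carrier _ _ _ z_hjb_r_eq[OF i c]])
    (use alpha_carrier[OF i] \<beta>_carrier[OF i] in auto)

lemma L_full_carrier:
  "L_full S E i \<in> carrier_mat (total_udim S + mdim E i) (total_udim S + mdim E i + hdim E i)"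
  by (simp add: L_full_def left_id_mat_carrier)

lemma L_r_carrier:
  "L_r S E i \<in> carrier_mat (total_udim S + mdim E i) (total_udim S + mdim E i + (hdim E i - hbar E i))"
  by (simp add: L_r_def left_id_mat_carrier)

lemma true_params_full:
  assumes i: "i < players S" and full: "\<not> full_rank_u S E i" and c: "c > 0"
  shows "(c \<cdot>\<^sub>v alpha_of S (R i), c \<cdot>\<^sub>v \<beta> i) \<in> param_set S E i"
proof -
  let ?y = "((c \<cdot>\<^sub>v alpha_of S (R i)) @\<^sub>v (c \<cdot>\<^sub>v \<beta> i)) @\<^sub>v (c \<cdot>\<^sub>v \<theta> i)"
  let ?n = "total_udim S + mdim E i + hdim E i"
  have y: "?y \<in> carrier_vec ?n"
    using alpha_carrier[OF i] \<beta>_carrier[OF i] \<theta>_carrier[OF i] by auto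
  have "L_full S E i *\<^sub>v ?y = (c \<cdot>\<^sub>v alpha_of S (R i)) @\<^sub>v (c \<cdot>\<^sub>v \<beta> i)"
    unfolding L_full_def left_id_mat_mult[OF y]
    by (rule vec_first_append) (use alpha_carrier[OF i] \<beta>_carrier[OF i] in auto)
  then have "\<exists>w\<in>carrier_vec ?n. (c \<cdot>\<^sub>v alpha_of S (R i)) @\<^sub>v (c \<cdot>\<^sub>v \<beta> i) =
      ls_point (L_full S E i) (M_hjb S E i) (M_hjb S E i *\<^sub>v ?y) w"
    unfolding ls_points_eq[OF M_hjb_carrier y L_full_carrier] using y
    by (intro bexI[of _ ?y] conjI) simp_all
  then show ?thesis
    using full params_ok_scale[OF i c] alpha_carrier[OF i] \<beta>_carrier[OF i]
    by (simp add: param_set_def ls_params_full_def M_hjb_true[OF i])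
qed

text \<open>The witness is the first diagonal entry of \<open>R i i\<close>, found at the start of
  block \<open>i\<close>; it exists because each player has at least one input.\<close>

lemma alpha_of_nonzero:
  assumes i: "i < players S"
  obtains k where "k < total_udim S" "0 < alpha_of S (R i) $ k"
proof -
  have "0 < udim S i" using game i by (auto simp: differential_game_def Suc_le_eq)
  then show ?thesis
    using that[of "(\<Sum>l<i. udim S l) + 0"] udim_offset_less[of i S 0] i R_pos[OF i, of 0]
      alpha_of_index[of S "R i" i 0] R_carrier[OF i] by simp
qed

text \<open>The true parameters form a kernel vector of \<open>M_hjb\<close> on which
  \<open>L_full\<close> is not zero.\<close>

lemma full_freedom_nonzero:
  assumes i: "i < players S"
  shows "ls_freedom (L_full S E i) (M_hjb S E i) \<noteq>
    0\<^sub>m (total_udim S + mdim E i) (total_udim S + mdim E i + hdim E i)"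
proof
  assume *: "ls_freedom (L_full S E i) (M_hjb S E i) =
    0\<^sub>m (total_udim S + mdim E i) (total_udim S + mdim E i + hdim E i)"
  let ?y = "((1 \<cdot>\<^sub>v alpha_of S (R i)) @\<^sub>v (1 \<cdot>\<^sub>v \<beta> i)) @\<^sub>v (1 \<cdot>\<^sub>v \<theta> i)"
  have y: "?y \<in> carrier_vec (total_udim S + mdim E i + hdim E i)"
    using alpha_carrier[OF i] \<beta>_carrier[OF i] \<theta>_carrier[OF i] by auto
  have "L_full S E i *\<^sub>v ?y = 0\<^sub>v (total_udim S + mdim E i)"
    using *[unfolded ls_freedom_eq_0_iff[OF M_hjb_carrier L_full_carrier]] y M_hjb_true[OF i, of 1]
    unfolding z_hjb_def by blast
  moreover have "L_full S E i *\<^sub>v ?y = (1 \<cdot>\<^sub>v alpha_of S (R i)) @\<^sub>v (1 \<cdot>\<^sub>v \<beta> i)"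
    unfolding L_full_def left_id_mat_mult[OF y]
    by (rule vec_first_append) (use alpha_carrier[OF i] \<beta>_carrier[OF i] in auto)
  ultimately have eq: "(1 \<cdot>\<^sub>v alpha_of S (R i)) @\<^sub>v (1 \<cdot>\<^sub>v \<beta> i) = 0\<^sub>v (total_udim S + mdim E i)" by simp
  obtain k where k: "k < total_udim S" "0 < alpha_of S (R i) $ k" by (rule alpha_of_nonzero[OF i])
  then show False
    using arg_cong[OF eq, of "\<lambda>u. u $ k"] carrier_vecD[OF alpha_carrier[OF i]] by simp
qed

text \<open>The trailing part of a least-squares solution supplies \<open>\<gamma>\<close>; in the
  full-rank case \<open>theta_r_hat\<close> is put in front. The equation holds at the data points
  by consistency and elsewhere by maximality of the rank.\<close>

lemma param_set_residual:
  assumes i: "i < players S" and mem: "(\<alpha>', \<beta>') \<in> param_set S E i"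
  shows "\<exists>\<gamma>\<in>carrier_vec (hdim E i). \<forall>x\<in>states S. residual i \<alpha>' \<beta>' \<gamma> x = 0"
proof (cases "full_rank_u S E i")
  case False
  let ?n = "total_udim S + mdim E i + hdim E i"
  \<comment> \<open>The factors 1 only bring the true parameters into the form of
    \<open>M_hjb_true\<close>.\<close>
  let ?y0 = "((1 \<cdot>\<^sub>v alpha_of S (R i)) @\<^sub>v (1 \<cdot>\<^sub>v \<beta> i)) @\<^sub>v (1 \<cdot>\<^sub>v \<theta> i)"
  have y0: "?y0 \<in> carrier_vec ?n"
    using alpha_carrier[OF i] \<beta>_carrier[OF i] \<theta>_carrier[OF i] by auto
  have c: "\<alpha>' \<in> carrier_vec (total_udim S)" "\<beta>' \<in> carrier_vec (mdim E i)"
    and "\<exists>w\<in>carrier_vec ?n. \<alpha>' @\<^sub>v \<beta>' = ls_point (L_full S E i) (M_hjb S E i) (z_hjb E) w"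
    using mem False by (auto simp: param_set_def ls_params_full_def)
  then obtain y where y: "y \<in> carrier_vec ?n" "M_hjb S E i *\<^sub>v y = z_hjb E" "\<alpha>' @\<^sub>v \<beta>' = L_full S E i *\<^sub>v y"
    using ls_points_eq[OF M_hjb_carrier y0 L_full_carrier, unfolded M_hjb_true[OF i]] by blast
  let ?\<gamma> = "vec_last y (hdim E i)"
  have "\<alpha>' @\<^sub>v \<beta>' = vec_first y (total_udim S + mdim E i)"
    using y(3) left_id_mat_mult[OF y(1)] by (simp add: L_full_def)
  then have y_eq: "y = (\<alpha>' @\<^sub>v \<beta>') @\<^sub>v ?\<gamma>" using vec_first_last_append[OF y(1)] by simp
  have "hjb_row i x \<bullet> y = 0" if "x \<in> set (hjb_points E)" for x
    using y(2) that unfolding M_hjb_mult[OF i] z_hjb_eq vec_of_list_map_eq_iff by blast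
  then have "residual i \<alpha>' \<beta>' ?\<gamma> x = 0" if "x \<in> states S" for x
    using hjb_row_extends[OF i False that y(1)] hjb_row_scalar_prod[OF i c, of ?\<gamma> x] y_eq by simp
  then show ?thesis by (intro bexI[of _ ?\<gamma>]) auto
next
  case True
  let ?d = "hdim E i - hbar E i"
  let ?n = "total_udim S + mdim E i + ?d"
  obtain c0 where c0: "theta_r_hat S E i = c0 \<cdot>\<^sub>v vec_first (\<theta> i) (hbar E i)"
    using theta_r_hat_eq[OF i True] by blast
  define y0 where "y0 = ((c0 \<cdot>\<^sub>v alpha_of S (R i)) @\<^sub>v (c0 \<cdot>\<^sub>v \<beta> i)) @\<^sub>v (c0 \<cdot>\<^sub>v vec_last (\<theta> i) ?d)"
  note z = z_hjb_r_eq[OF i c0, folded y0_def]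
  have y0: "y0 \<in> carrier_vec ?n"
    using alpha_carrier[OF i] \<beta>_carrier[OF i] by (auto simp: y0_def)
  have t: "theta_r_hat S E i \<in> carrier_vec (hbar E i)" unfolding c0 by simp
  have row0: "hjb_row_r i x \<bullet> y0 =
      - (theta_r_hat S E i \<bullet> jac_apply (hbar E i) (phi_r E i) x (closed_loop S (mu_hat S E) x))"
    if x: "x \<in> states S" for x
    unfolding y0_def
    by (subst hjb_row_r_scalar_prod[OF i _ _ _ t])
      (use alpha_carrier[OF i] \<beta>_carrier[OF i] residual_true[OF i x, of c0, unfolded \<theta>_split[OF i], folded c0] in auto)
  have c: "\<alpha>' \<in> carrier_vec (total_udim S)" "\<beta>' \<in> carrier_vec (mdim E i)"
    and "\<exists>w\<in>carrier_vec ?n. \<alpha>' @\<^sub>v \<beta>' = ls_point (L_r S E i) (M_hjb_r S E i) (z_hjb_r S E i) w"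
    using mem True by (auto simp: param_set_def ls_params_r_def)
  then obtain y where y: "y \<in> carrier_vec ?n" "M_hjb_r S E i *\<^sub>v y = M_hjb_r S E i *\<^sub>v y0"
      "\<alpha>' @\<^sub>v \<beta>' = L_r S E i *\<^sub>v y"
    using ls_points_eq[OF M_hjb_r_carrier y0 L_r_carrier, unfolded z] z by auto
  let ?\<gamma> = "vec_last y ?d"
  have "\<alpha>' @\<^sub>v \<beta>' = vec_first y (total_udim S + mdim E i)"
    using y(3) left_id_mat_mult[OF y(1)] by (simp add: L_r_def)
  then have y_eq: "y = (\<alpha>' @\<^sub>v \<beta>') @\<^sub>v ?\<gamma>" using vec_first_last_append[OF y(1)] by simp
  \<comment> \<open>The rank argument extends homogeneous relations. It is therefore applied to the
    difference from the known solution \<open>y0\<close>, which satisfies the equation on the whole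
    state set.\<close>
  have diff: "hjb_row_r i x \<bullet> (y - y0) = hjb_row_r i x \<bullet> y - hjb_row_r i x \<bullet> y0" for x
    by (rule scalar_prod_minus_distrib[OF hjb_row_r_carrier[OF i] y(1) y0])
  have zero: "hjb_row_r i x \<bullet> (y - y0) = 0" if "x \<in> set (hjb_points E)" for x
    using y(2) that unfolding M_hjb_r_mult[OF i] vec_of_list_map_eq_iff diff by simp
  have "y - y0 \<in> carrier_vec ?n" using y(1) y0 by simp
  then have ext: "hjb_row_r i x \<bullet> (y - y0) = 0" if "x \<in> states S" for x
    using hjb_row_r_extends[OF i True that _ zero] by blast
  have "residual i \<alpha>' \<beta>' (theta_r_hat S E i @\<^sub>v ?\<gamma>) x = 0" if x: "x \<in> states S" for x
  proof -
    have "hjb_row_r i x \<bullet> y = residual i \<alpha>' \<beta>' (theta_r_hat S E i @\<^sub>v ?\<gamma>) x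
      - theta_r_hat S E i \<bullet> jac_apply (hbar E i) (phi_r E i) x (closed_loop S (mu_hat S E) x)"
      by (subst y_eq) (rule hjb_row_r_scalar_prod[OF i c vec_last_carrier t])
    then show ?thesis using ext[OF x] row0[OF x] unfolding diff by simp
  qed
  moreover have "theta_r_hat S E i @\<^sub>v ?\<gamma> \<in> carrier_vec (hdim E i)"
    using append_carrier_vec[OF t vec_last_carrier[of y ?d]] hbar_le[OF i] by simp
  ultimately show ?thesis by blast
qed

lemma param_set_optimal:
  assumes i: "i < players S" and mem: "(\<alpha>', \<beta>') \<in> param_set S E i"
  shows "is_optimal S (Q_of E i \<beta>') (R_of S \<alpha>') i (mu_hat S E)"
proof -
  obtain \<gamma> where \<gamma>: "\<gamma> \<in> carrier_vec (hdim E i)" "\<And>x. x \<in> states S \<Longrightarrow> residual i \<alpha>' \<beta>' \<gamma> x = 0"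
    using param_set_residual[OF assms] by blast
  \<comment> \<open>Basis functions need not vanish at the origin; subtracting a constant normalises
    the candidate without changing its derivative.\<close>
  define W where "W y = \<gamma> \<bullet> phi E i y + - (\<gamma> \<bullet> phi E i 0)" for y
  have "(\<lambda>y. \<gamma> \<bullet> phi E i y) = (\<lambda>y. \<Sum>k<hdim E i. \<gamma> $ k *\<^sub>R phi E i y $ k)"
    by (simp add: scalar_prod_def lessThan_atLeast0 carrier_vecD[OF phi_carrier[OF i]])
  moreover have "C2_on (\<lambda>y. \<Sum>k<hdim E i. \<gamma> $ k *\<^sub>R phi E i y $ k) (states S)"
    using phi i by (intro C2_on_sum C2_on_scaleR_const) auto
  ultimately have "C2_on (\<lambda>y. \<gamma> \<bullet> phi E i y) (states S)" by simp
  then have C2: "C2_on W (states S)" unfolding W_def by (intro C2_on_add C2_on_const)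
  have "frechet_derivative W (at x) v = \<gamma> \<bullet> jac_apply (hdim E i) (phi E i) x v"
    if x: "x \<in> states S" for x v
  proof -
    have "((\<lambda>y. \<gamma> \<bullet> phi E i y) has_derivative frechet_derivative (\<lambda>y. \<gamma> \<bullet> phi E i y) (at x)) (at x)"
      using C2_on_differentiable[OF \<open>C2_on (\<lambda>y. \<gamma> \<bullet> phi E i y) (states S)\<close> x] frechet_derivative_works by blast
    then have "(W has_derivative (\<lambda>h. frechet_derivative (\<lambda>y. \<gamma> \<bullet> phi E i y) (at x) h + 0)) (at x)"
      unfolding W_def by (intro has_derivative_add has_derivative_const)
    from frechet_derivative_at[OF this]
    have "frechet_derivative W (at x) v = frechet_derivative (\<lambda>y. \<gamma> \<bullet> phi E i y) (at x) v" by simp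
    also have "\<dots> = \<gamma> \<bullet> jac_apply (hdim E i) (phi E i) x v"
      by (rule frechet_derivative_scalar_prod_jac[OF phi_carrier[OF i] \<gamma>(1)])
        (rule phi_differentiable[OF i _ x])
    finally show ?thesis .
  qed
  then have "HJB_eq S (Q_of E i \<beta>') (R_of S \<alpha>') (mu_hat S E) W"
    unfolding HJB_eq_iff using \<gamma>(2) by (simp add: eq_neg_iff_add_eq_0 add.commute)
  moreover have "W 0 = 0" by (simp add: W_def)
  moreover have "decoupled_HJB_nec_suff S (Q_of E i \<beta>') (R_of S \<alpha>') i (mu_hat S E)"
    using mem by (simp add: param_set_def params_ok_def)
  ultimately have "is_unique_optimal S (Q_of E i \<beta>') (R_of S \<alpha>') i (mu_hat S E)"
    using C2 unfolding decoupled_HJB_nec_suff_def by blast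
  then show ?thesis by (simp add: is_unique_optimal_def)
qed

section \<open>Reproduction of the demonstrations\<close>

lemma closed_loop_lipschitz: "locally_lipschitz (closed_loop S \<mu>) (states S)"
proof -
  have "locally_lipschitz (\<lambda>x. drift S x + (\<Sum>j<players S. \<Sum>k<udim S j. (\<mu> j x $ k) *\<^sub>R input_col S j x k)) (states S)"
    using game admissible_\<mu>
    by (intro locally_lipschitz_add locally_lipschitz_sum locally_lipschitz_scaleR
        C1_on_imp_locally_lipschitz[OF open_states])
      (auto simp: differential_game_def admissible_def)
  then show ?thesis by (simp add: closed_loop_def[abs_def])
qed

lemma reproduces:
  assumes agree: "\<And>j x. j < players S \<Longrightarrow> x \<in> states S \<Longrightarrow> \<nu> j x = \<mu> j x"
  shows "reproduces_demos S E \<nu>"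
  unfolding reproduces_demos_def
proof (intro allI impI conjI)
  have sol: "solution S \<nu> = solution S \<mu>" by (rule solution_cong) (rule agree)
  fix d assume d: "d < ndemo E"
  then have demo: "solution S \<mu> (xdemo E d (time0 S)) (xdemo E d)"
    using demos by (simp add: FNE_demonstrations_def)
  then show "\<exists>x. solution S \<nu> (xdemo E d (time0 S)) x" unfolding sol by blast
  fix x t assume x: "solution S \<nu> (xdemo E d (time0 S)) x" and t: "time0 S \<le> t"
  show eq: "x t = xdemo E d t"
    by (rule ode_solution_unique[OF closed_loop_lipschitz, of "time0 S"])
      (use x demo t in \<open>auto simp: sol solution_def\<close>)
  fix i assume i: "i < players S"
  have "xdemo E d t \<in> states S" using demo t by (simp add: solution_def)
  then show "\<nu> i (x t) = udemo E d i t"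
    using demos d i t agree by (simp add: FNE_demonstrations_def eq)
qed

text \<open>Every player is optimal against the same profile \<open>mu_hat\<close>, which is what an
  equilibrium requires. Any unique equilibrium of the new game then coincides with it on the state
  set.\<close>

lemma param_sets_solve:
  assumes mem: "\<And>i. i < players S \<Longrightarrow> (\<alpha>' i, \<beta>' i) \<in> param_set S E i"
  shows "solves_inverse_game S E \<alpha>' \<beta>'"
proof -
  let ?Q = "\<lambda>i. Q_of E i (\<beta>' i)" and ?R = "\<lambda>i. R_of S (\<alpha>' i)"
  have fne: "is_FNE S ?Q ?R (mu_hat S E)"
    using param_set_optimal[OF _ mem] unfolding is_FNE_def is_optimal_def by blast
  moreover have "reproduces_demos S E (mu_hat S E)" by (rule reproduces) (rule mu_hat_eq)
  moreover have "reproduces_demos S E \<nu>" if "is_unique_FNE S ?Q ?R \<nu>" for \<nu>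
  proof (rule reproduces)
    fix j x assume "j < players S" "x \<in> states S"
    then show "\<nu> j x = \<mu> j x"
      using that fne mu_hat_eq unfolding is_unique_FNE_def by metis
  qed
  ultimately show ?thesis unfolding solves_inverse_game_def by blast
qed

text \<open>The test \<open>params_ok\<close> can only remove points, and the one point present
  passes it.\<close>

lemma param_set_singleton:
  assumes i: "i < players S" and full: "full_rank_u S E i" and c: "c > 0"
    and ls: "ls_params_r S E i = {(c \<cdot>\<^sub>v alpha_of S (R i), c \<cdot>\<^sub>v \<beta> i)}"
  shows "param_set S E i = {(c \<cdot>\<^sub>v alpha_of S (R i), c \<cdot>\<^sub>v \<beta> i)}"
  using full ls params_ok_scale[OF i c] by (auto simp: param_set_def)

lemma param_set_not_singleton:
  assumes i: "i < players S" and full: "\<not> full_rank_u S E i"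
  shows "param_set S E i \<noteq> {(alpha_of S (R i), \<beta> i)}"
proof
  assume "param_set S E i = {(alpha_of S (R i), \<beta> i)}"
  \<comment> \<open>Any positive factor other than 1 yields a second element.\<close>
  then have eq: "2 \<cdot>\<^sub>v alpha_of S (R i) = alpha_of S (R i)"
    using true_params_full[OF i full, of 2] by simp
  obtain k where k: "k < total_udim S" "0 < alpha_of S (R i) $ k" by (rule alpha_of_nonzero[OF i])
  then show False
    using arg_cong[OF eq, of "\<lambda>u. u $ k"] carrier_vecD[OF alpha_carrier[OF i]] by simp
qed

end

text \<open>The factor \<open>c\<close> is shown to exist and is also quantified universally, as it
  is not determined when the leading coefficients vanish. For full rank the equivalence concerns
  \<open>ls_params_r\<close>, and \<open>param_set\<close> gets one implication, since the test may
  cut a larger least-squares set down to one point.\<close>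

theorem theorem1:
  fixes S :: "(real ^ 'n) dsystem"
    and Q :: "nat \<Rightarrow> real ^ 'n \<Rightarrow> real" and R :: "nat \<Rightarrow> nat \<Rightarrow> real mat"
    and \<mu> :: "(real ^ 'n) profile" and E :: "(real ^ 'n) ident"
    and \<beta> \<theta> :: "nat \<Rightarrow> real Matrix.vec"
  assumes game: "differential_game S Q R"
    and FNE: "is_unique_FNE S Q R \<mu>"
    and HJB: "coupled_HJB_nec_suff S Q R"
    and demos: "FNE_demonstrations S \<mu> E"
    and split: "\<forall>i<players S. basis_split S E i"
    and a: "\<forall>i<players S. \<beta> i \<in> carrier_vec (mdim E i) \<and>
        (\<forall>x. psi E i x \<in> carrier_vec (mdim E i)) \<and>
        (\<forall>k<mdim E i. C1_on (\<lambda>x. psi E i x $ k) (states S)) \<and>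
        (\<forall>x\<in>states S. Q i x = \<beta> i \<bullet> psi E i x)"
    and b: "\<forall>i<players S. \<forall>j<players S. diagonal_mat (R i j)"
    and c: "\<forall>i<players S. \<theta> i \<in> carrier_vec (hdim E i) \<and>
        (\<forall>x. phi E i x \<in> carrier_vec (hdim E i)) \<and>
        (\<forall>k<hdim E i. C2_on (\<lambda>x. phi E i x $ k) (states S)) \<and>
        (\<forall>x\<in>states S. value_fun S (Q i) (R i) \<mu> x = \<theta> i \<bullet> phi E i x)"
    and e: "\<forall>i<players S. rank_maximal (states S) (M_u_of S E i) (sample_states S E)"
    and points: "hjb_points E \<noteq> []" "set (hjb_points E) \<subseteq> states S"
    and f: "\<forall>i<players S.
        (full_rank_u S E i \<longrightarrow> rank_maximal (states S) (M_hjb_r_of S E i) (hjb_points E)) \<and>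
        (\<not> full_rank_u S E i \<longrightarrow> rank_maximal (states S) (M_hjb_of S E i) (hjb_points E))"
  shows "(\<forall>i<players S. full_rank_u S E i \<longrightarrow>
            (\<exists>c>0. theta_r_hat S E i = c \<cdot>\<^sub>v vec_first (\<theta> i) (hbar E i)) \<and>
            (\<forall>c>0. theta_r_hat S E i = c \<cdot>\<^sub>v vec_first (\<theta> i) (hbar E i) \<longrightarrow>
               (ls_params_r S E i = {(c \<cdot>\<^sub>v alpha_of S (R i), c \<cdot>\<^sub>v \<beta> i)} \<longleftrightarrow>
                  ls_freedom (L_r S E i) (M_hjb_r S E i) =
                    0\<^sub>m (total_udim S + mdim E i) (total_udim S + mdim E i + (hdim E i - hbar E i))) \<and>
               (ls_freedom (L_r S E i) (M_hjb_r S E i) =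
                    0\<^sub>m (total_udim S + mdim E i) (total_udim S + mdim E i + (hdim E i - hbar E i)) \<longrightarrow>
                  param_set S E i = {(c \<cdot>\<^sub>v alpha_of S (R i), c \<cdot>\<^sub>v \<beta> i)})))
       \<and> (\<forall>i<players S. \<not> full_rank_u S E i \<longrightarrow>
            (param_set S E i = {(alpha_of S (R i), \<beta> i)} \<longleftrightarrow>
               ls_freedom (L_full S E i) (M_hjb S E i) =
                 0\<^sub>m (total_udim S + mdim E i) (total_udim S + mdim E i + hdim E i)))
       \<and> (\<forall>\<alpha>' \<beta>'. (\<forall>i<players S. (\<alpha>' i, \<beta>' i) \<in> param_set S E i) \<longrightarrow>
            solves_inverse_game S E \<alpha>' \<beta>')"
proof -
  interpret identification S Q R \<mu> E \<beta> \<theta>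
    by (rule identification.intro[OF game FNE HJB demos split a b c e points(2) f])
  show ?thesis
  proof (intro conjI allI impI)
    fix i assume i: "i < players S" and full: "full_rank_u S E i"
    show "\<exists>c>0. theta_r_hat S E i = c \<cdot>\<^sub>v vec_first (\<theta> i) (hbar E i)"
      by (rule theta_r_hat_eq[OF i full])
    fix c :: real assume c: "0 < c" "theta_r_hat S E i = c \<cdot>\<^sub>v vec_first (\<theta> i) (hbar E i)"
    note iff = ls_params_r_iff[OF i c(2)]
    show "ls_params_r S E i = {(c \<cdot>\<^sub>v alpha_of S (R i), c \<cdot>\<^sub>v \<beta> i)} \<longleftrightarrow>
        ls_freedom (L_r S E i) (M_hjb_r S E i) =
          0\<^sub>m (total_udim S + mdim E i) (total_udim S + mdim E i + (hdim E i - hbar E i))"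
      by (rule iff)
    assume "ls_freedom (L_r S E i) (M_hjb_r S E i) =
      0\<^sub>m (total_udim S + mdim E i) (total_udim S + mdim E i + (hdim E i - hbar E i))"
    then show "param_set S E i = {(c \<cdot>\<^sub>v alpha_of S (R i), c \<cdot>\<^sub>v \<beta> i)}"
      by (intro param_set_singleton[OF i full c(1)] iff[THEN iffD2])
  next
    fix i assume "i < players S" "\<not> full_rank_u S E i"
    then show "param_set S E i = {(alpha_of S (R i), \<beta> i)} \<longleftrightarrow>
        ls_freedom (L_full S E i) (M_hjb S E i) =
          0\<^sub>m (total_udim S + mdim E i) (total_udim S + mdim E i + hdim E i)"
      using param_set_not_singleton full_freedom_nonzero by blast
  next
    fix \<alpha>' \<beta>' assume "\<forall>i<players S. (\<alpha>' i, \<beta>' i) \<in> param_set S E i"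
    then show "solves_inverse_game S E \<alpha>' \<beta>'" by (intro param_sets_solve) blast
  qed
qed

end
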